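(* Let $f(s)$ be an almost periodic function in $\mathbb{C}$ whose set of Fourier exponents $\{\lambda_1,\lambda_2,\ldots\}$ is linearly independent over $\mathbb{Q}$ and has at least three elements. Then $R_f\neq\emptyset$.
   Context: Write $s=\sigma+it$ with $\sigma,t\in\mathbb{R}$. An entire function $f$ is called almost periodic in $\mathbb{C}$ (i.e. in the vertical strip $U=\mathbb{C}$, $\alpha=-\infty$, $\beta=\infty$) if for every reduced strip $\{\alpha_1\le\sigma\le\beta_1\}$ with $-\infty<\alpha_1<\beta_1<\infty$ and every $\varepsilon>0$ there is $l>0$ such that each interval of length $l$ on the real line contains a number $\tau$ with $|f(s+i\tau)-f(s)|\le\varepsilon$ for all $s$ in the reduced strip. Equivalently, $f$ is a uniform limit, on every such reduced strip, of exponential polynomials $a_1e^{\lambda_1s}+\cdots+a_ne^{\lambda_ns}$ with $a_j\in\mathbb{C}$, $\lambda_j\in\mathbb{R}$. Fourier exponents: for $\lambda\in\mathbb{R}$ the number $a(\lambda)=\lim_{T\to\infty}\frac1{2T}\int_{-T}^{T}f(\sigma+it)e^{-\lambda(\sigma+it)}\,dt$ exists and does not depend on $\sigma\in\mathbb{R}$. It is nonzero for at most countably many $\lambda$, called the Fourier exponents of $f$ and enumerated as $\lambda_1,\lambda_2,\ldots$ (distinct; finitely or infinitely many). The set $R_f$ is defined here by $R_f:=\overline{\{\operatorname{Re}s: f(s)=0,\ s\in\mathbb{C}\}}$, where the bar denotes closure in $\mathbb{R}$. *)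

theory Defs
  imports "HOL-Analysis.Analysis"
begin

definition almost_periodic :: "(complex \<Rightarrow> complex) \<Rightarrow> bool" where
  "almost_periodic f \<longleftrightarrow>
     f holomorphic_on UNIV \<and>
     (\<forall>\<alpha> \<beta> \<epsilon> :: real. \<alpha> < \<beta> \<longrightarrow> \<epsilon> > 0 \<longrightarrow>
        (\<exists>l>0. \<forall>c. \<exists>\<tau>\<in>{c..c + l}. \<forall>s. \<alpha> \<le> Re s \<and> Re s \<le> \<beta> \<longrightarrow>
           norm (f (s + \<i> * of_real \<tau>) - f s) \<le> \<epsilon>))"

(* The value a is required to be the limit on every vertical line: for almost periodic f
   the limit exists and is independent of the abscissa. *)
definition has_fourier_coeff :: "(complex \<Rightarrow> complex) \<Rightarrow> real \<Rightarrow> complex \<Rightarrow> bool" where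
  "has_fourier_coeff f \<mu> a \<longleftrightarrow>
     (\<forall>\<sigma>. ((\<lambda>T. 1 / (2 * of_real T) *
              integral {-T..T} (\<lambda>t. f (Complex \<sigma> t) * exp (- of_real \<mu> * Complex \<sigma> t)))
           \<longlongrightarrow> a) at_top)"

definition fourier_exponents :: "(complex \<Rightarrow> complex) \<Rightarrow> real set" where
  "fourier_exponents f = {\<mu>. \<exists>a. a \<noteq> 0 \<and> has_fourier_coeff f \<mu> a}"

definition zero_abscissae :: "(complex \<Rightarrow> complex) \<Rightarrow> real set" where
  "zero_abscissae f = closure {Re s | s. f s = 0}"

lemma vector_space_rat_real: "vector_space (\<lambda>q. (*) (real_of_rat q))"
  by unfold_locales (auto simp: algebra_simps of_rat_add of_rat_mult)

abbreviation rat_independent :: "real set \<Rightarrow> bool" where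
  "rat_independent \<equiv> module.independent (\<lambda>q. (*) (real_of_rat q))"

end

(*
  Let Lambda be the set of Fourier exponents. Since Lambda is independent, testing f on each vertical
  line against a Riesz product prod (1 + Re (w_l exp(-i l t))), l in a finite subset of Lambda, bounds
  sum |a_l| exp(l sigma) by 2 sup |f|; hence the Fourier series of f converges absolutely on every
  line, and by the uniqueness theorem for almost periodic functions it represents f. At some abscissa
  sigma two terms tie for the largest modulus, because no single term dominates for all sigma; there the
  phases of the terms can be changed so that the series with the new phases vanishes at sigma.
  By Kronecker's theorem the vertical translates of f approximate the changed series, locally
  uniformly, so Hurwitz's theorem gives a zero of f.
*)
theory Submission
  imports Defs "HOL-Complex_Analysis.Complex_Analysis"
begin

text \<open>Boundedness of \<open>f\<close> alone gives no control over the sum of the moduli of its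
  coefficients; independence does. The Riesz product is nonnegative with mean 1, and in the mean of
  \<open>f\<close> times the product only the first-order terms of the expansion survive. They carry
  a factor 1/2, whence the constant 2. For uniqueness, the obstacle is that vanishing coefficients
  make averages small uniformly over bounded frequencies only, by compactness. Sampling on a fine
  mesh removes the unbounded frequencies by aliasing, after which finite Fourier analysis suffices.
  Total boundedness of the translates is preferred to almost periods because it passes to sums and
  products and supplies the finite nets on which the counting rests. For the phases, let R be the
  tied maximum: greedy signs bring the sum of all other terms into [-2R, 2R], and two terms of
  modulus R with conjugate phases attain every value there. Hurwitz's theorem requires a limit that
  is not constant; this holds because the changed series keeps its nonzero coefficient
  moduli.\<close>

section \<open>Almost periodic functions of a real variable\<close>

text \<open>Bochner's criterion: the translates of \<open>\<phi>\<close> form a totally bounded set in the sup norm.\<close>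
definition bohr :: "(real \<Rightarrow> complex) \<Rightarrow> bool" where
  "bohr \<phi> \<longleftrightarrow> continuous_on UNIV \<phi> \<and>
     (\<forall>\<epsilon>>0. \<exists>U. finite U \<and> (\<forall>u. \<exists>v\<in>U. \<forall>t. norm (\<phi> (t + u) - \<phi> (t + v)) \<le> \<epsilon>))"

text \<open>The mean value, attained uniformly in the left end point \<open>a\<close> of the averaging interval.\<close>
definition uniform_mean :: "(real \<Rightarrow> complex) \<Rightarrow> complex \<Rightarrow> bool" where
  "uniform_mean \<phi> m \<longleftrightarrow> continuous_on UNIV \<phi> \<and>
     (\<forall>\<epsilon>>0. \<exists>T0>0. \<forall>T\<ge>T0. \<forall>a. norm (integral {a..a + T} \<phi> - of_real T * m) \<le> \<epsilon> * T)"

lemma bohr_continuous: "bohr \<phi> \<Longrightarrow> continuous_on S \<phi>"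
  unfolding bohr_def by (meson continuous_on_subset subset_UNIV)

lemma bohr_net:
  assumes "bohr \<phi>" "\<epsilon> > 0"
  obtains U where "finite U" "\<And>u. \<exists>v\<in>U. \<forall>t. norm (\<phi> (t + u) - \<phi> (t + v)) \<le> \<epsilon>"
  using assms unfolding bohr_def by meson

lemma bohr_bounded:
  assumes "bohr \<phi>"
  obtains B where "B > 0" "\<And>t. norm (\<phi> t) \<le> B"
proof -
  obtain U where U: "finite U" "\<And>u. \<exists>v\<in>U. \<forall>t. norm (\<phi> (t + u) - \<phi> (t + v)) \<le> 1"
    using bohr_net[OF assms, of 1] by auto
  show thesis
  proof (rule that[of "1 + (\<Sum>v\<in>U. norm (\<phi> v))"])
    show "1 + (\<Sum>v\<in>U. norm (\<phi> v)) > 0"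
      by (intro add_pos_nonneg sum_nonneg) auto
    fix t
    obtain v where v: "v \<in> U" "norm (\<phi> (0 + t) - \<phi> (0 + v)) \<le> 1"
      using U(2)[of t] by blast
    have "norm (\<phi> v) \<le> (\<Sum>v\<in>U. norm (\<phi> v))"
      using U v by (intro member_le_sum) auto
    then show "norm (\<phi> t) \<le> 1 + (\<Sum>v\<in>U. norm (\<phi> v))"
      using v norm_triangle_sub[of "\<phi> t" "\<phi> v"] by auto
  qed
qed

text \<open>The translate that carries \<open>y\<close> to 0 is close to the one that carries a net
  point \<open>v\<close> to 0. So continuity at the finitely many net points, with the smallest of
  their moduli of continuity, controls \<open>\<phi>\<close> near every \<open>y\<close>.\<close>

lemma bohr_uniformly_continuous:
  assumes "bohr \<phi>" "\<epsilon> > 0"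
  obtains \<delta> where "\<delta> > 0" "\<And>x y. \<bar>x - y\<bar> \<le> \<delta> \<Longrightarrow> norm (\<phi> x - \<phi> y) \<le> \<epsilon>"
proof -
  obtain U where U: "finite U" "\<And>u. \<exists>v\<in>U. \<forall>t. norm (\<phi> (t + u) - \<phi> (t + v)) \<le> \<epsilon>/3"
    using bohr_net[OF assms(1), of "\<epsilon>/3"] assms(2) by auto
  have "\<exists>d>0. \<forall>x. \<bar>x - v\<bar> \<le> d \<longrightarrow> norm (\<phi> x - \<phi> v) \<le> \<epsilon>/3" for v
  proof -
    have "isCont \<phi> v"
      using bohr_continuous[OF assms(1), of UNIV] by (simp add: continuous_on_eq_continuous_at)
    then obtain d where "d > 0" "\<forall>x. dist x v < d \<longrightarrow> dist (\<phi> x) (\<phi> v) < \<epsilon>/3"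
      unfolding continuous_at_eps_delta using assms(2) by (metis zero_less_divide_iff zero_less_numeral)
    then show ?thesis
      by (intro exI[of _ "d/2"]) (auto simp: dist_norm less_imp_le)
  qed
  then obtain d where d: "\<And>v. d v > 0"
      "\<And>v x. \<bar>x - v\<bar> \<le> d v \<Longrightarrow> norm (\<phi> x - \<phi> v) \<le> \<epsilon>/3" by metis
  define \<delta> where "\<delta> = Min (insert 1 (d ` U))"
  show thesis
  proof (rule that[of \<delta>])
    show "\<delta> > 0" using U d by (auto simp: \<delta>_def)
    fix x y :: real assume xy: "\<bar>x - y\<bar> \<le> \<delta>"
    obtain v where v: "v \<in> U" "\<And>t. norm (\<phi> (t + y) - \<phi> (t + v)) \<le> \<epsilon>/3"
      using U(2)[of y] by blast
    have "\<delta> \<le> d v" using v U by (auto simp: \<delta>_def)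
    then have 1: "norm (\<phi> (x - y + v) - \<phi> v) \<le> \<epsilon>/3"
      using xy by (intro d(2)) auto
    have 2: "norm (\<phi> x - \<phi> (x - y + v)) \<le> \<epsilon>/3" using v(2)[of "x - y"] by simp
    have 3: "norm (\<phi> v - \<phi> y) \<le> \<epsilon>/3" using v(2)[of 0] by (simp add: norm_minus_commute)
    have "norm ((\<phi> x - \<phi> (x - y + v)) + (\<phi> (x - y + v) - \<phi> v) + (\<phi> v - \<phi> y)) \<le> \<epsilon>" using 1 2 3
      norm_triangle_ineq[of "(\<phi> x - \<phi> (x - y + v)) + (\<phi> (x - y + v) - \<phi> v)" "\<phi> v - \<phi> y"]
      norm_triangle_ineq[of "\<phi> x - \<phi> (x - y + v)" "\<phi> (x - y + v) - \<phi> v"] by linarith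
    then show "norm (\<phi> x - \<phi> y) \<le> \<epsilon>" by simp
  qed
qed

lemma bohr_common_net:
  assumes "bohr \<phi>" "bohr \<psi>" "\<epsilon> > 0"
  obtains U where "finite U"
    "\<And>u. \<exists>v\<in>U. \<forall>t. norm (\<phi> (t + u) - \<phi> (t + v)) \<le> \<epsilon> \<and> norm (\<psi> (t + u) - \<psi> (t + v)) \<le> \<epsilon>"
proof -
  obtain U1 where U1: "finite U1" "\<And>u. \<exists>v\<in>U1. \<forall>t. norm (\<phi> (t + u) - \<phi> (t + v)) \<le> \<epsilon>/2"
    using bohr_net[OF assms(1), of "\<epsilon>/2"] assms(3) by auto
  obtain U2 where U2: "finite U2" "\<And>u. \<exists>v\<in>U2. \<forall>t. norm (\<psi> (t + u) - \<psi> (t + v)) \<le> \<epsilon>/2"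
    using bohr_net[OF assms(2), of "\<epsilon>/2"] assms(3) by auto
  define near where "near = (\<lambda>(u, v, w).
     (\<forall>t. norm (\<phi> (t + u) - \<phi> (t + v)) \<le> \<epsilon>/2) \<and> (\<forall>t. norm (\<psi> (t + u) - \<psi> (t + w)) \<le> \<epsilon>/2))"
  define r where "r = (\<lambda>(v, w). SOME u. near (u, v, w))"
  show thesis
  proof (rule that[of "r ` (U1 \<times> U2)"])
    show "finite (r ` (U1 \<times> U2))" using U1 U2 by auto
    fix u
    obtain v w where vw: "v \<in> U1" "w \<in> U2" and n: "near (u, v, w)"
      using U1(2)[of u] U2(2)[of u] unfolding near_def by auto
    have n': "near (r (v, w), v, w)"
      unfolding r_def using n by (auto intro: someI)
    have half: "norm (x - y) \<le> \<epsilon>" if "norm (x - z) \<le> \<epsilon>/2" "norm (y - z) \<le> \<epsilon>/2" for x y z :: complex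
      using norm_triangle_ineq4[of "x - z" "y - z"] that by simp
    have "norm (\<phi> (t + u) - \<phi> (t + r (v, w))) \<le> \<epsilon>" for t
      using n n' unfolding near_def by (auto intro: half[of _ "\<phi> (t + v)"])
    moreover have "norm (\<psi> (t + u) - \<psi> (t + r (v, w))) \<le> \<epsilon>" for t
      using n n' unfolding near_def by (auto intro: half[of _ "\<psi> (t + w)"])
    ultimately show "\<exists>v\<in>r ` (U1 \<times> U2). \<forall>t. norm (\<phi> (t + u) - \<phi> (t + v)) \<le> \<epsilon> \<and> norm (\<psi> (t + u) - \<psi> (t + v)) \<le> \<epsilon>"
      using vw by blast
  qed
qed

lemma bohr_add:
  assumes "bohr \<phi>" "bohr \<psi>"
  shows "bohr (\<lambda>t. \<phi> t + \<psi> t)"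
  unfolding bohr_def
proof (intro conjI allI impI)
  show "continuous_on UNIV (\<lambda>t. \<phi> t + \<psi> t)"
    using assms by (intro continuous_intros bohr_continuous)
  fix \<epsilon> :: real assume "\<epsilon> > 0"
  then obtain U where U: "finite U"
    "\<And>u. \<exists>v\<in>U. \<forall>t. norm (\<phi> (t + u) - \<phi> (t + v)) \<le> \<epsilon>/2 \<and> norm (\<psi> (t + u) - \<psi> (t + v)) \<le> \<epsilon>/2"
    using bohr_common_net[OF assms, of "\<epsilon>/2"] by auto
  have "\<exists>v\<in>U. \<forall>t. norm (\<phi> (t + u) + \<psi> (t + u) - (\<phi> (t + v) + \<psi> (t + v))) \<le> \<epsilon>" for u
  proof -
    obtain v where v: "v \<in> U" "\<And>t. norm (\<phi> (t + u) - \<phi> (t + v)) \<le> \<epsilon>/2" "\<And>t. norm (\<psi> (t + u) - \<psi> (t + v)) \<le> \<epsilon>/2"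
      using U(2)[of u] by blast
    have "norm (\<phi> (t + u) + \<psi> (t + u) - (\<phi> (t + v) + \<psi> (t + v))) \<le> \<epsilon>" for t
      using norm_diff_triangle_ineq[of "\<phi> (t + u)" "\<psi> (t + u)" "\<phi> (t + v)" "\<psi> (t + v)"] v(2,3)[of t]
      by linarith
    then show ?thesis using v(1) by blast
  qed
  then show "\<exists>U. finite U \<and> (\<forall>u. \<exists>v\<in>U. \<forall>t. norm (\<phi> (t + u) + \<psi> (t + u) - (\<phi> (t + v) + \<psi> (t + v))) \<le> \<epsilon>)"
    using U(1) by blast
qed

lemma bohr_mult:
  assumes "bohr \<phi>" "bohr \<psi>"
  shows "bohr (\<lambda>t. \<phi> t * \<psi> t)"
  unfolding bohr_def
proof (intro conjI allI impI)
  show "continuous_on UNIV (\<lambda>t. \<phi> t * \<psi> t)"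
    using assms by (intro continuous_intros bohr_continuous)
  obtain A where A: "A > 0" "\<And>t. norm (\<phi> t) \<le> A" using bohr_bounded[OF assms(1)] by metis
  obtain B where B: "B > 0" "\<And>t. norm (\<psi> t) \<le> B" using bohr_bounded[OF assms(2)] by metis
  fix \<epsilon> :: real assume e: "\<epsilon> > 0"
  define \<eta> where "\<eta> = \<epsilon> / (A + B)"
  have \<eta>: "\<eta> > 0" "A * \<eta> + B * \<eta> = \<epsilon>" using e A(1) B(1)
    unfolding distrib_right[symmetric] by (auto simp: \<eta>_def add_pos_pos add_eq_0_iff2)
  obtain U where U: "finite U"
    "\<And>u. \<exists>v\<in>U. \<forall>t. norm (\<phi> (t + u) - \<phi> (t + v)) \<le> \<eta> \<and> norm (\<psi> (t + u) - \<psi> (t + v)) \<le> \<eta>"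
    using bohr_common_net[OF assms \<eta>(1)] by auto
  have "\<exists>v\<in>U. \<forall>t. norm (\<phi> (t + u) * \<psi> (t + u) - \<phi> (t + v) * \<psi> (t + v)) \<le> \<epsilon>" for u
  proof -
    obtain v where v: "v \<in> U" "\<And>t. norm (\<phi> (t + u) - \<phi> (t + v)) \<le> \<eta>" "\<And>t. norm (\<psi> (t + u) - \<psi> (t + v)) \<le> \<eta>"
      using U(2)[of u] by blast
    have "norm (\<phi> (t + u) * \<psi> (t + u) - \<phi> (t + v) * \<psi> (t + v)) \<le> \<epsilon>" for t
    proof -
      have "\<phi> (t + u) * \<psi> (t + u) - \<phi> (t + v) * \<psi> (t + v) =
         \<phi> (t + u) * (\<psi> (t + u) - \<psi> (t + v)) + (\<phi> (t + u) - \<phi> (t + v)) * \<psi> (t + v)"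
        by (simp add: algebra_simps)
      also have "norm \<dots> \<le> A * \<eta> + B * \<eta>"
        using A B v \<eta> unfolding mult.commute[of B]
          by (intro norm_triangle_le add_mono) (auto simp: norm_mult intro!: mult_mono intro: less_imp_le)
      finally show ?thesis using \<eta> by simp
    qed
    then show ?thesis using v(1) by blast
  qed
  then show "\<exists>U. finite U \<and> (\<forall>u. \<exists>v\<in>U. \<forall>t. norm (\<phi> (t + u) * \<psi> (t + u) - \<phi> (t + v) * \<psi> (t + v)) \<le> \<epsilon>)"
    using U(1) by blast
qed

lemma bohr_const: "bohr (\<lambda>_. c)"
  unfolding bohr_def by (auto intro: exI[of _ "{0}"])

lemma bohr_cmult: "bohr \<phi> \<Longrightarrow> bohr (\<lambda>t. c * \<phi> t)"
  using bohr_mult[OF bohr_const] .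

lemma bohr_diff: "bohr \<phi> \<Longrightarrow> bohr \<psi> \<Longrightarrow> bohr (\<lambda>t. \<phi> t - \<psi> t)"
  using bohr_add[OF _ bohr_cmult[of \<psi> "-1"]] by simp

lemma bohr_cnj: "bohr \<phi> \<Longrightarrow> bohr (\<lambda>t. cnj (\<phi> t))"
  unfolding bohr_def complex_cnj_diff[symmetric] complex_mod_cnj
  by (auto intro: continuous_intros)

lemma bohr_sum: "(\<And>i. i \<in> I \<Longrightarrow> bohr (\<phi> i)) \<Longrightarrow> bohr (\<lambda>t. \<Sum>i\<in>I. \<phi> i t)"
  by (induction I rule: infinite_finite_induct) (auto intro: bohr_const bohr_add)

lemma bohr_uniform_limit:
  assumes "\<And>\<epsilon>. \<epsilon> > 0 \<Longrightarrow> \<exists>\<psi>. bohr \<psi> \<and> (\<forall>t. norm (\<phi> t - \<psi> t) \<le> \<epsilon>)"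
  shows "bohr \<phi>"
  unfolding bohr_def
proof (intro conjI allI impI)
  have "\<exists>\<psi>. bohr \<psi> \<and> (\<forall>t. norm (\<phi> t - \<psi> t) \<le> 1 / real (Suc n))" for n
    by (rule assms) simp
  then obtain \<psi> where \<psi>: "\<And>n. bohr (\<psi> n)" "\<And>n t. norm (\<phi> t - \<psi> n t) \<le> 1 / real (Suc n)"
    by metis
  show "continuous_on UNIV \<phi>"
  proof (rule uniform_limit_theorem)
    show "\<forall>\<^sub>F n in sequentially. continuous_on UNIV (\<psi> n)"
      using \<psi>(1) by (simp add: bohr_continuous)
    show "uniform_limit UNIV \<psi> \<phi> sequentially"
    proof (rule uniform_limitI)
      fix e :: real assume "e > 0"
      then obtain N where N: "1 / real (Suc N) < e" using nat_approx_posE by blast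
      show "\<forall>\<^sub>F n in sequentially. \<forall>x\<in>UNIV. dist (\<psi> n x) (\<phi> x) < e"
        using eventually_ge_at_top[of N]
      proof eventually_elim
        case (elim n)
        then have "1 / real (Suc n) \<le> 1 / real (Suc N)" by (simp add: frac_le)
        then show ?case using N \<psi>(2)[of _ n] by (auto simp: dist_norm norm_minus_commute intro: le_less_trans order_trans)
      qed
    qed
  qed auto
  fix \<epsilon> :: real assume "\<epsilon> > 0"
  then obtain \<psi> where p: "bohr \<psi>" "\<And>t. norm (\<phi> t - \<psi> t) \<le> \<epsilon>/3" using assms[of "\<epsilon>/3"] by auto
  then obtain U where U: "finite U" "\<And>u. \<exists>v\<in>U. \<forall>t. norm (\<psi> (t + u) - \<psi> (t + v)) \<le> \<epsilon>/3"
    using bohr_net[of \<psi> "\<epsilon>/3"] \<open>\<epsilon> > 0\<close> by auto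
  have "norm (\<phi> (t + u) - \<phi> (t + v)) \<le> \<epsilon>" if "norm (\<psi> (t + u) - \<psi> (t + v)) \<le> \<epsilon>/3" for t u v
  proof -
    have "\<phi> (t + u) - \<phi> (t + v) = (\<phi> (t + u) - \<psi> (t + u)) + (\<psi> (t + u) - \<psi> (t + v)) - (\<phi> (t + v) - \<psi> (t + v))"
      by simp
    also have "norm \<dots> \<le> \<epsilon>/3 + \<epsilon>/3 + \<epsilon>/3"
      using p(2)[of "t + u"] p(2)[of "t + v"] that norm_triangle_ineq4[of "(\<phi> (t + u) - \<psi> (t + u)) + (\<psi> (t + u) - \<psi> (t + v))" "\<phi> (t + v) - \<psi> (t + v)"]
        norm_triangle_ineq[of "\<phi> (t + u) - \<psi> (t + u)" "\<psi> (t + u) - \<psi> (t + v)"] by linarith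
    finally show ?thesis by simp
  qed
  then show "\<exists>U. finite U \<and> (\<forall>u. \<exists>v\<in>U. \<forall>t. norm (\<phi> (t + u) - \<phi> (t + v)) \<le> \<epsilon>)"
    using U by meson
qed

text \<open>Two translates differ by the unimodular factor \<open>cis (\<mu> * t)\<close> times a
  constant, so a finite net of the unit circle yields one of the translates.\<close>

lemma bohr_cis: "bohr (\<lambda>t. cis (\<mu> * t))"
  unfolding bohr_def
proof (intro conjI allI impI)
  show "continuous_on UNIV (\<lambda>t. cis (\<mu> * t))" by (intro continuous_intros)
  fix \<epsilon> :: real assume e: "\<epsilon> > 0"
  have "compact (sphere (0::complex) 1)" by simp
  then have "\<exists>K. finite K \<and> sphere (0::complex) 1 \<subseteq> (\<Union>z\<in>K. ball z (\<epsilon>/2))"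
    using e unfolding compact_eq_totally_bounded by simp
  then obtain K where K: "finite K" "sphere (0::complex) 1 \<subseteq> (\<Union>z\<in>K. ball z (\<epsilon>/2))"
    by blast
  define r where "r z = (SOME u. cis (\<mu> * u) \<in> ball z (\<epsilon>/2))" for z
  have "\<exists>v\<in>r ` K. \<forall>t. norm (cis (\<mu> * (t + u)) - cis (\<mu> * (t + v))) \<le> \<epsilon>" for u
  proof -
    have "cis (\<mu> * u) \<in> sphere 0 1" by simp
    then obtain z where z: "z \<in> K" "cis (\<mu> * u) \<in> ball z (\<epsilon>/2)" using K by blast
    then have "cis (\<mu> * r z) \<in> ball z (\<epsilon>/2)" unfolding r_def by (metis (no_types, lifting) someI)
    with z have "dist (cis (\<mu> * u)) (cis (\<mu> * r z)) \<le> \<epsilon>"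
      by (metis dist_commute dist_triangle_half_r less_imp_le mem_ball)
    moreover have "cis (\<mu> * (t + u)) - cis (\<mu> * (t + r z)) = cis (\<mu> * t) * (cis (\<mu> * u) - cis (\<mu> * r z))" for t
      by (simp add: algebra_simps cis_mult)
    ultimately show ?thesis using z(1) by (intro bexI[of _ "r z"]) (auto simp: norm_mult dist_norm)
  qed
  then show "\<exists>U. finite U \<and> (\<forall>u. \<exists>v\<in>U. \<forall>t. norm (cis (\<mu> * (t + u)) - cis (\<mu> * (t + v))) \<le> \<epsilon>)"
    using K(1) by (intro exI[of _ "r ` K"]) auto
qed

section \<open>Mean values and their existence for almost periodic functions of a real
  variable\<close>

lemma norm_integral_diff_le:
  fixes \<phi> :: "real \<Rightarrow> complex"
  assumes cont: "continuous_on UNIV \<phi>" and B: "\<And>t. norm (\<phi> t) \<le> B" and "a \<le> b" "a' \<le> b'"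
  shows "norm (integral {a..b} \<phi> - integral {a'..b'} \<phi>) \<le> B * (\<bar>a - a'\<bar> + \<bar>b - b'\<bar>)"
proof -
  have I: "\<phi> integrable_on {x..y}" for x y
    by (intro integrable_continuous_interval continuous_on_subset[OF cont]) auto
  have 1: "norm (integral {x..y} \<phi>) \<le> B * (y - x)" if "x \<le> y" for x y
    using that B by (intro integral_bound continuous_on_subset[OF cont]) auto
  have 2: "norm (integral {c..x} \<phi> - integral {c..y} \<phi>) \<le> B * \<bar>x - y\<bar>" if "c \<le> x" "c \<le> y" for c x y
  proof (cases "x \<le> y")
    case True
    then have "integral {c..x} \<phi> + integral {x..y} \<phi> = integral {c..y} \<phi>"
      using that I by (intro Henstock_Kurzweil_Integration.integral_combine) auto
    then have "integral {c..x} \<phi> - integral {c..y} \<phi> = - integral {x..y} \<phi>" by (simp add: algebra_simps)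
    then show ?thesis using 1[OF True] True by (simp add: abs_if)
  next
    case False
    then have "integral {c..y} \<phi> + integral {y..x} \<phi> = integral {c..x} \<phi>"
      using that I by (intro Henstock_Kurzweil_Integration.integral_combine) auto
    then have "integral {c..x} \<phi> - integral {c..y} \<phi> = integral {y..x} \<phi>" by (simp add: algebra_simps)
    then show ?thesis using 1[of y x] False by (simp add: abs_if)
  qed
  define c where "c = min a a'"
  have 3: "integral {c..a} \<phi> + integral {a..b} \<phi> = integral {c..b} \<phi>"
    "integral {c..a'} \<phi> + integral {a'..b'} \<phi> = integral {c..b'} \<phi>"
    using assms I by (auto simp: c_def intro!: Henstock_Kurzweil_Integration.integral_combine)
  have "integral {a..b} \<phi> - integral {a'..b'} \<phi> =
     (integral {c..b} \<phi> - integral {c..b'} \<phi>) - (integral {c..a} \<phi> - integral {c..a'} \<phi>)"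
    unfolding 3[symmetric] by simp
  also have "norm \<dots> \<le> B * \<bar>b - b'\<bar> + B * \<bar>a - a'\<bar>"
    using assms by (intro norm_triangle_le_diff add_mono 2) (auto simp: c_def)
  finally show ?thesis by (simp add: algebra_simps)
qed

lemma uniform_mean_continuous: "uniform_mean \<phi> m \<Longrightarrow> continuous_on S \<phi>"
  unfolding uniform_mean_def by (meson continuous_on_subset subset_UNIV)

lemma uniform_mean_integrable: "uniform_mean \<phi> m \<Longrightarrow> \<phi> integrable_on {a..b::real}"
  by (intro integrable_continuous_interval uniform_mean_continuous)

lemma uniform_meanE:
  assumes "uniform_mean \<phi> m" "\<epsilon> > 0"
  obtains T0 where "T0 > 0" "\<And>T a. T \<ge> T0 \<Longrightarrow> norm (integral {a..a + T} \<phi> - of_real T * m) \<le> \<epsilon> * T"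
  using assms unfolding uniform_mean_def by meson

lemma uniform_mean_unique:
  assumes "uniform_mean \<phi> m" "uniform_mean \<phi> m'"
  shows "m = m'"
proof (rule ccontr)
  assume "m \<noteq> m'"
  define \<epsilon> where "\<epsilon> = norm (m - m') / 3"
  have e: "\<epsilon> > 0" using \<open>m \<noteq> m'\<close> by (simp add: \<epsilon>_def)
  obtain T1 where T1: "T1 > 0" "\<And>T a. T \<ge> T1 \<Longrightarrow> norm (integral {a..a + T} \<phi> - of_real T * m) \<le> \<epsilon> * T"
    using uniform_meanE[OF assms(1) e] by metis
  obtain T2 where T2: "T2 > 0" "\<And>T a. T \<ge> T2 \<Longrightarrow> norm (integral {a..a + T} \<phi> - of_real T * m') \<le> \<epsilon> * T"
    using uniform_meanE[OF assms(2) e] by metis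
  define T where "T = max T1 T2"
  have T: "T \<ge> T1" "T \<ge> T2" "T > 0" using T1 T2 by (auto simp: T_def)
  have "norm ((integral {0..0 + T} \<phi> - of_real T * m') - (integral {0..0 + T} \<phi> - of_real T * m)) \<le> \<epsilon> * T + \<epsilon> * T"
    by (intro norm_triangle_le_diff add_mono T1(2) T2(2) T)
  moreover have "(integral {0..0 + T} \<phi> - of_real T * m') - (integral {0..0 + T} \<phi> - of_real T * m) = of_real T * (m - m')"
    by (simp add: algebra_simps)
  ultimately have "norm (of_real T * (m - m')) \<le> \<epsilon> * T + \<epsilon> * T" by simp
  then have "T * (3 * \<epsilon>) \<le> T * (2 * \<epsilon>)"
    using T by (simp add: norm_mult \<epsilon>_def)
  then show False using T e by simp
qed

lemma uniform_mean_add: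
  assumes "uniform_mean \<phi> m" "uniform_mean \<psi> n"
  shows "uniform_mean (\<lambda>t. \<phi> t + \<psi> t) (m + n)"
  unfolding uniform_mean_def
proof (intro conjI allI impI)
  show "continuous_on UNIV (\<lambda>t. \<phi> t + \<psi> t)"
    using assms by (intro continuous_intros uniform_mean_continuous)
  fix \<epsilon> :: real assume "\<epsilon> > 0"
  then have e: "\<epsilon>/2 > 0" by simp
  obtain T1 where T1: "T1 > 0" "\<And>T a. T \<ge> T1 \<Longrightarrow> norm (integral {a..a + T} \<phi> - of_real T * m) \<le> \<epsilon>/2 * T"
    using uniform_meanE[OF assms(1) e] by metis
  obtain T2 where T2: "T2 > 0" "\<And>T a. T \<ge> T2 \<Longrightarrow> norm (integral {a..a + T} \<psi> - of_real T * n) \<le> \<epsilon>/2 * T"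
    using uniform_meanE[OF assms(2) e] by metis
  have "norm (integral {a..a + T} (\<lambda>t. \<phi> t + \<psi> t) - of_real T * (m + n)) \<le> \<epsilon> * T" if T: "T \<ge> max T1 T2" for T a
  proof -
    have "integral {a..a + T} (\<lambda>t. \<phi> t + \<psi> t) - of_real T * (m + n) =
      (integral {a..a + T} \<phi> - of_real T * m) + (integral {a..a + T} \<psi> - of_real T * n)"
      using assms uniform_mean_integrable
      by (subst Henstock_Kurzweil_Integration.integral_add) (auto simp: algebra_simps)
    also have "norm \<dots> \<le> \<epsilon>/2 * T + \<epsilon>/2 * T"
      using T1 T2 T by (intro norm_triangle_le add_mono) auto
    finally show ?thesis by (simp add: mult.commute)
  qed
  then show "\<exists>T0>0. \<forall>T\<ge>T0. \<forall>a. norm (integral {a..a + T} (\<lambda>t. \<phi> t + \<psi> t) - of_real T * (m + n)) \<le> \<epsilon> * T"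
    using T1(1) by (intro exI[of _ "max T1 T2"]) auto
qed

lemma uniform_mean_cmult:
  assumes "uniform_mean \<phi> m"
  shows "uniform_mean (\<lambda>t. c * \<phi> t) (c * m)"
  unfolding uniform_mean_def
proof (intro conjI allI impI)
  show "continuous_on UNIV (\<lambda>t. c * \<phi> t)"
    using assms by (intro continuous_intros uniform_mean_continuous)
  fix \<epsilon> :: real assume e: "\<epsilon> > 0"
  define \<eta> where "\<eta> = \<epsilon> / (1 + norm c)"
  have \<eta>: "\<eta> > 0" using e by (auto simp: \<eta>_def add_pos_nonneg)
  have \<eta>': "norm c * \<eta> \<le> \<epsilon>"
    using e by (simp add: \<eta>_def field_simps add_pos_nonneg)
  obtain T0 where T0: "T0 > 0" "\<And>T a. T \<ge> T0 \<Longrightarrow> norm (integral {a..a + T} \<phi> - of_real T * m) \<le> \<eta> * T"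
    using uniform_meanE[OF assms \<eta>] by metis
  have "norm (integral {a..a + T} (\<lambda>t. c * \<phi> t) - of_real T * (c * m)) \<le> \<epsilon> * T" if T: "T \<ge> T0" for T a
  proof -
    have "integral {a..a + T} (\<lambda>t. c * \<phi> t) - of_real T * (c * m) = c * (integral {a..a + T} \<phi> - of_real T * m)"
      by (simp add: algebra_simps)
    also have "norm \<dots> \<le> norm c * (\<eta> * T)"
      unfolding norm_mult using T0 T by (intro mult_left_mono) auto
    also have "\<dots> \<le> \<epsilon> * T"
      using \<eta>' T T0(1) by (simp add: mult.assoc[symmetric] mult_right_mono)
    finally show ?thesis .
  qed
  then show "\<exists>T0>0. \<forall>T\<ge>T0. \<forall>a. norm (integral {a..a + T} (\<lambda>t. c * \<phi> t) - of_real T * (c * m)) \<le> \<epsilon> * T"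
    using T0(1) by (intro exI[of _ T0]) auto
qed

lemma uniform_mean_zero: "uniform_mean (\<lambda>_. 0) 0"
  unfolding uniform_mean_def by (auto intro: exI[of _ 1])

lemma uniform_mean_const: "uniform_mean (\<lambda>_. c) c"
  unfolding uniform_mean_def by (auto intro!: exI[of _ 1] simp: scaleR_conv_of_real)

lemma uniform_mean_diff:
  assumes "uniform_mean \<phi> m" "uniform_mean \<psi> n"
  shows "uniform_mean (\<lambda>t. \<phi> t - \<psi> t) (m - n)"
  using uniform_mean_add[OF assms(1) uniform_mean_cmult[OF assms(2), of "-1"]] by simp

lemma uniform_mean_sum:
  "(\<And>i. i \<in> I \<Longrightarrow> uniform_mean (\<phi> i) (m i)) \<Longrightarrow> uniform_mean (\<lambda>t. \<Sum>i\<in>I. \<phi> i t) (\<Sum>i\<in>I. m i)"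
  by (induction I rule: infinite_finite_induct) (auto intro: uniform_mean_zero uniform_mean_add)

lemma uniform_mean_uniform_limit:
  assumes cont: "continuous_on UNIV \<phi>"
    and lim: "\<And>\<epsilon>. \<epsilon> > 0 \<Longrightarrow> \<exists>\<psi> n. uniform_mean \<psi> n \<and> (\<forall>t. norm (\<phi> t - \<psi> t) \<le> \<epsilon>) \<and> norm (m - n) \<le> \<epsilon>"
  shows "uniform_mean \<phi> m"
  unfolding uniform_mean_def
proof (intro conjI allI impI cont)
  fix \<epsilon> :: real assume "\<epsilon> > 0"
  then have e: "\<epsilon>/3 > 0" by simp
  obtain \<psi> n where p: "uniform_mean \<psi> n" "\<And>t. norm (\<phi> t - \<psi> t) \<le> \<epsilon>/3" "norm (m - n) \<le> \<epsilon>/3"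
    using lim[OF e] by blast
  obtain T0 where T0: "T0 > 0" "\<And>T a. T \<ge> T0 \<Longrightarrow> norm (integral {a..a + T} \<psi> - of_real T * n) \<le> \<epsilon>/3 * T"
    using uniform_meanE[OF p(1) e] by metis
  have "norm (integral {a..a + T} \<phi> - of_real T * m) \<le> \<epsilon> * T" if T: "T \<ge> T0" for T a
  proof -
    have "T > 0" using T T0 by simp
    have I: "\<phi> integrable_on {a..a + T}" "\<psi> integrable_on {a..a + T}"
      using continuous_on_subset[OF cont] uniform_mean_integrable[OF p(1)]
      by (auto intro!: integrable_continuous_interval)
    have "norm (integral {a..a + T} (\<lambda>t. \<phi> t - \<psi> t)) \<le> \<epsilon>/3 * (a + T - a)"
      using \<open>T > 0\<close> p by (intro integral_bound continuous_intros continuous_on_subset[OF cont] uniform_mean_continuous) auto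
    then have 1: "norm (integral {a..a + T} \<phi> - integral {a..a + T} \<psi>) \<le> \<epsilon>/3 * T"
      using I by (simp add: Henstock_Kurzweil_Integration.integral_diff)
    have 2: "norm (of_real T * (m - n)) \<le> \<epsilon>/3 * T"
      using p(3) \<open>T > 0\<close> by (simp add: norm_mult)
    have "integral {a..a + T} \<phi> - of_real T * m = (integral {a..a + T} \<phi> - integral {a..a + T} \<psi>)
        + (integral {a..a + T} \<psi> - of_real T * n) - of_real T * (m - n)"
      by (simp add: algebra_simps)
    also have "norm \<dots> \<le> (\<epsilon>/3 * T + \<epsilon>/3 * T) + \<epsilon>/3 * T"
      by (intro norm_triangle_le_diff norm_triangle_le add_mono 1 2 T0(2) T)
    finally show ?thesis by (simp add: mult.commute)
  qed
  then show "\<exists>T0>0. \<forall>T\<ge>T0. \<forall>a. norm (integral {a..a + T} \<phi> - of_real T * m) \<le> \<epsilon> * T"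
    using T0(1) by (intro exI[of _ T0]) auto
qed

text \<open>Means are defined for complex-valued functions only, so the nonnegative majorant enters
  as the real part of such a function.\<close>

lemma uniform_mean_norm_le:
  assumes "uniform_mean \<phi> m" "uniform_mean \<psi> n" "\<And>t. norm (\<phi> t) \<le> Re (\<psi> t)"
  shows "norm m \<le> Re n"
proof (rule field_le_epsilon)
  fix e :: real assume "e > 0"
  then have e: "e/2 > 0" by simp
  obtain T1 where T1: "T1 > 0" "\<And>T a. T \<ge> T1 \<Longrightarrow> norm (integral {a..a + T} \<phi> - of_real T * m) \<le> e/2 * T"
    using uniform_meanE[OF assms(1) e] by metis
  obtain T2 where T2: "T2 > 0" "\<And>T a. T \<ge> T2 \<Longrightarrow> norm (integral {a..a + T} \<psi> - of_real T * n) \<le> e/2 * T"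
    using uniform_meanE[OF assms(2) e] by metis
  define T where "T = max T1 T2"
  have T: "T \<ge> T1" "T \<ge> T2" "T > 0" using T1 T2 by (auto simp: T_def)
  have I: "\<phi> integrable_on {0..T}" "\<psi> integrable_on {0..T}"
    using assms uniform_mean_integrable by auto
  have I2: "(\<lambda>t. Re (\<psi> t)) integrable_on {0..T}"
    using integrable_linear[OF I(2) bounded_linear_Re] by (simp add: o_def)
  have "norm (integral {0..T} \<phi>) \<le> integral {0..T} (\<lambda>t. Re (\<psi> t))"
    using assms(3) by (intro integral_norm_bound_integral I I2) auto
  also have "\<dots> = Re (integral {0..T} \<psi>)"
    using integral_linear[OF I(2) bounded_linear_Re] by (simp add: o_def)
  also have "\<dots> \<le> T * Re n + e/2 * T"
    using T2(2)[OF T(2), of 0] complex_Re_le_cmod[of "integral {0..0+T} \<psi> - of_real T * n"] by simp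
  finally have 1: "norm (integral {0..T} \<phi>) \<le> T * Re n + e/2 * T" .
  have "norm (of_real T * m) \<le> norm (integral {0..T} \<phi>) + e/2 * T"
    using T1(2)[OF T(1), of 0] norm_triangle_sub[of "of_real T * m" "integral {0..T} \<phi>"] by (simp add: norm_minus_commute)
  then have "T * norm m \<le> T * (Re n + e)"
    using 1 T(3) by (simp add: norm_mult algebra_simps)
  then show "norm m \<le> Re n + e" using T(3) by simp
qed

lemma uniform_mean_shift:
  assumes "uniform_mean \<phi> m"
  shows "uniform_mean (\<lambda>t. \<phi> (t + c)) m"
proof -
  have "integral {a..b} (\<lambda>t. \<phi> (t + c)) = integral {a + c..b + c} \<phi>" for a b
    using integral_shift[of a c b \<phi>] uniform_mean_continuous[OF assms] by (simp add: o_def)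
  then have "integral {a..a + T} (\<lambda>t. \<phi> (t + c)) = integral {(a + c)..(a + c) + T} \<phi>" for a T
    by (simp add: algebra_simps)
  moreover have "continuous_on UNIV (\<lambda>t. \<phi> (t + c))"
    by (rule continuous_on_compose2[OF uniform_mean_continuous[OF assms, of UNIV]])
       (auto intro: continuous_intros)
  ultimately show ?thesis using assms unfolding uniform_mean_def by (simp, meson)
qed

lemma uniform_mean_cis:
  assumes "\<mu> \<noteq> 0"
  shows "uniform_mean (\<lambda>t. cis (\<mu> * t)) 0"
  unfolding uniform_mean_def
proof (intro conjI allI impI)
  show "continuous_on UNIV (\<lambda>t. cis (\<mu> * t))" by (intro continuous_intros)
  fix \<epsilon> :: real assume e: "\<epsilon> > 0"
  have "norm (integral {a..a + T} (\<lambda>t. cis (\<mu> * t))) \<le> 2 / \<bar>\<mu>\<bar>" if "T \<ge> 0" for a T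
  proof -
    have d: "((\<lambda>t. cis (\<mu> * t)) has_vector_derivative (of_real \<mu> * \<i> * cis (\<mu> * t))) (at t within S)" for t S
      unfolding has_vector_derivative_def
      by (rule derivative_eq_intros | rule ext | simp add: scaleR_conv_of_real algebra_simps)+
    have "((\<lambda>t. of_real \<mu> * \<i> * cis (\<mu> * t)) has_integral (cis (\<mu> * (a + T)) - cis (\<mu> * a))) {a..a + T}"
      using that by (intro fundamental_theorem_of_calculus d) auto
    then have "integral {a..a + T} (\<lambda>t. of_real \<mu> * \<i> * cis (\<mu> * t)) = cis (\<mu> * (a + T)) - cis (\<mu> * a)"
      by (rule integral_unique)
    then have "of_real \<mu> * \<i> * integral {a..a + T} (\<lambda>t. cis (\<mu> * t)) = cis (\<mu> * (a + T)) - cis (\<mu> * a)"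
      by simp
    then have "\<bar>\<mu>\<bar> * norm (integral {a..a + T} (\<lambda>t. cis (\<mu> * t))) = norm (cis (\<mu> * (a + T)) - cis (\<mu> * a))"
      by (metis norm_mult norm_of_real norm_ii mult.right_neutral)
    also have "\<dots> \<le> 2" using norm_triangle_ineq4[of "cis (\<mu> * (a + T))" "cis (\<mu> * a)"] by simp
    finally show ?thesis using assms by (simp add: field_simps)
  qed
  moreover have "2 / \<bar>\<mu>\<bar> \<le> \<epsilon> * T" if "T \<ge> 2 / (\<bar>\<mu>\<bar> * \<epsilon>)" for T
    using that e assms by (simp add: field_simps)
  moreover have "2 / (\<bar>\<mu>\<bar> * \<epsilon>) > 0" using e assms by simp
  ultimately have "\<forall>T\<ge>2 / (\<bar>\<mu>\<bar> * \<epsilon>). \<forall>a. norm (integral {a..a + T} (\<lambda>t. cis (\<mu> * t)) - of_real T * 0) \<le> \<epsilon> * T"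
    by (simp only: mult_zero_right diff_zero) (meson less_imp_le order_trans)
  then show "\<exists>T0>0. \<forall>T\<ge>T0. \<forall>a. norm (integral {a..a + T} (\<lambda>t. cis (\<mu> * t)) - of_real T * 0) \<le> \<epsilon> * T"
    using \<open>2 / (\<bar>\<mu>\<bar> * \<epsilon>) > 0\<close> by blast
qed

text \<open>The integral over a window of length \<open>T\<close> barely depends on its position, by
  a finite net of translates. Averaging this over positions and exchanging the two integrations
  compares windows of lengths \<open>T\<close> and \<open>T'\<close>, which makes the averages a
  Cauchy family.\<close>

lemma bohr_uniform_mean:
  assumes "bohr \<phi>"
  obtains m where "uniform_mean \<phi> m"
proof -
  obtain B where B: "B > 0" "\<And>t. norm (\<phi> t) \<le> B" using bohr_bounded[OF assms] by metis
  note cont = bohr_continuous[OF assms, of UNIV]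
  define A where "A u T = integral {0..T} (\<lambda>t. \<phi> (t + u))" for u T
  have A_shift: "A u T = integral {u..u + T} \<phi>" for u T
    unfolding A_def using integral_shift[of 0 u T \<phi>] bohr_continuous[OF assms]
    by (simp add: o_def add.commute)
  have contA: "continuous_on S (\<lambda>u. A u T)" for S T
  proof -
    have "continuous_on UNIV (\<lambda>u. integral (cbox 0 T) (\<lambda>t. \<phi> (t + u)))"
      by (rule integral_continuous_on_param) (auto simp: case_prod_unfold intro!: continuous_intros continuous_on_compose2[OF cont])
    then show ?thesis unfolding A_def by (auto intro: continuous_on_subset)
  qed
  have unif: "\<exists>T0>0. \<forall>T\<ge>T0. \<forall>u. norm (A u T - A 0 T) \<le> \<epsilon> * T" if e: "\<epsilon> > 0" for \<epsilon>
  proof -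
    obtain U where U: "finite U" "\<And>u. \<exists>v\<in>U. \<forall>t. norm (\<phi> (t + u) - \<phi> (t + v)) \<le> \<epsilon>/2"
      using bohr_net[OF assms, of "\<epsilon>/2"] e by auto
    define K where "K = 1 + (\<Sum>v\<in>U. \<bar>v\<bar>)"
    have K: "\<bar>v\<bar> \<le> K" if "v \<in> U" for v
      unfolding K_def using member_le_sum[of v U abs] U(1) that by auto
    have K0: "K > 0" unfolding K_def by (intro add_pos_nonneg sum_nonneg) auto
    \<comment> \<open>Moving a window by a net point, which is at most \<open>K\<close> in modulus,
      changes the integral by at most \<open>2 * B * K\<close>; this is at most
      \<open>\<epsilon>/2 * T\<close> from \<open>T0\<close> on.\<close>
    define T0 where "T0 = 4 * B * K / \<epsilon>"
    have T0: "T0 > 0" using B K0 e by (simp add: T0_def)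
    have "norm (A u T - A 0 T) \<le> \<epsilon> * T" if T: "T \<ge> T0" for T u
    proof -
      have "T > 0" using T T0 by simp
      obtain v where v: "v \<in> U" "\<And>t. norm (\<phi> (t + u) - \<phi> (t + v)) \<le> \<epsilon>/2" using U(2)[of u] by blast
      have c: "continuous_on {0..T} (\<lambda>t. \<phi> (t + w))" for w
        by (rule continuous_on_compose2[OF cont]) (auto intro: continuous_intros)
      have "A u T - A v T = integral {0..T} (\<lambda>t. \<phi> (t + u) - \<phi> (t + v))"
        unfolding A_def using c by (intro Henstock_Kurzweil_Integration.integral_diff[symmetric] integrable_continuous_interval)
      also have "norm \<dots> \<le> \<epsilon>/2 * (T - 0)"
        using \<open>T > 0\<close> v by (intro integral_bound continuous_on_diff c) auto
      finally have 1: "norm (A u T - A v T) \<le> \<epsilon>/2 * T" by simp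
      have "norm (A v T - A 0 T) \<le> B * (\<bar>v - 0\<bar> + \<bar>v + T - (0 + T)\<bar>)"
        unfolding A_shift using \<open>T > 0\<close> by (intro norm_integral_diff_le cont B) auto
      also have "\<dots> \<le> B * (K + K)" using K[OF v(1)] B(1) by (intro mult_left_mono) auto
      also have "\<dots> \<le> \<epsilon>/2 * T" using T e by (simp add: T0_def field_simps)
      finally have 2: "norm (A v T - A 0 T) \<le> \<epsilon>/2 * T" .
      have "norm ((A u T - A v T) + (A v T - A 0 T)) \<le> \<epsilon>/2 * T + \<epsilon>/2 * T"
        by (intro norm_triangle_le add_mono 1 2)
      then show ?thesis by (simp add: mult.commute)
    qed
    then show ?thesis using T0 by blast
  qed
  have cauchy: "norm (A 0 T' / of_real T' - A 0 T / of_real T) \<le> 2 * \<epsilon>"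
    if h: "\<And>T u. T \<ge> T0 \<Longrightarrow> norm (A u T - A 0 T) \<le> \<epsilon> * T" and T: "T0 > 0" "T \<ge> T0" "T' \<ge> T0" for \<epsilon> T0 T T'
  proof -
    have pos: "T > 0" "T' > 0" using T by auto
    \<comment> \<open>Both sides integrate \<open>\<phi> (t + u)\<close> over the same rectangle.
      The left one is nearly \<open>T * A 0 T'\<close> and the right one nearly
      \<open>T' * A 0 T\<close>.\<close>
    have swap: "integral {0..T} (\<lambda>u. A u T') = integral {0..T'} (\<lambda>u. A u T)"
    proof -
      have "integral (cbox 0 T) (\<lambda>u. integral (cbox 0 T') (\<lambda>t. \<phi> (t + u))) =
            integral (cbox 0 T') (\<lambda>t. integral (cbox 0 T) (\<lambda>u. \<phi> (t + u)))"
        by (rule integral_swap_continuous) (auto simp: case_prod_unfold intro!: continuous_intros continuous_on_compose2[OF cont])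
      then show ?thesis unfolding A_def by (simp add: add.commute)
    qed
    have est: "norm (integral {0..S} (\<lambda>u. A u S') - of_real S * A 0 S') \<le> \<epsilon> * S' * S" if S: "S \<ge> T0" "S' \<ge> T0" for S S'
    proof -
      have "integral {0..S} (\<lambda>u. A u S' - A 0 S') = integral {0..S} (\<lambda>u. A u S') - integral {0..S} (\<lambda>u. A 0 S')"
        by (intro Henstock_Kurzweil_Integration.integral_diff integrable_continuous_interval contA) auto
      also have "integral {0..S} (\<lambda>u. A 0 S') = of_real S * A 0 S'"
        using S T by (simp add: scaleR_conv_of_real)
      finally have "integral {0..S} (\<lambda>u. A u S') - of_real S * A 0 S' = integral {0..S} (\<lambda>u. A u S' - A 0 S')" by simp
      also have "norm \<dots> \<le> \<epsilon> * S' * (S - 0)"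
        using S T h by (intro integral_bound continuous_on_diff contA) auto
      finally show ?thesis by simp
    qed
    have "of_real T * A 0 T' - of_real T' * A 0 T = (integral {0..T'} (\<lambda>u. A u T) - of_real T' * A 0 T) - (integral {0..T} (\<lambda>u. A u T') - of_real T * A 0 T')"
      using swap by simp
    also have "norm \<dots> \<le> \<epsilon> * T * T' + \<epsilon> * T' * T"
      by (intro norm_triangle_le_diff add_mono est T)
    finally have "norm (of_real T * A 0 T' - of_real T' * A 0 T) \<le> 2 * \<epsilon> * (T * T')" by (simp add: algebra_simps)
    moreover have eq: "A 0 T' / of_real T' - A 0 T / of_real T = (of_real T * A 0 T' - of_real T' * A 0 T) / of_real (T * T')"
      using pos by (simp add: field_simps)
    moreover have "T * T' > 0" using pos by simp
    ultimately show ?thesis unfolding eq norm_divide norm_of_real by (simp only: abs_of_pos pos_divide_le_eq)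
  qed
  define x where "x n = A 0 (real (Suc n)) / of_real (real (Suc n))" for n
  have "Cauchy x"
  proof (rule CauchyI)
    fix e :: real assume "e > 0"
    then have "e/3 > 0" by simp
    then obtain T0 where T0: "T0 > 0" "\<And>T u. T \<ge> T0 \<Longrightarrow> norm (A u T - A 0 T) \<le> e/3 * T"
      using unif[of "e/3"] by blast
    obtain M where M: "real M \<ge> T0" using real_arch_simple by blast
    have "norm (x m - x n) < e" if "m \<ge> M" "n \<ge> M" for m n
    proof -
      have "norm (x m - x n) \<le> 2 * (e/3)"
        unfolding x_def using that M by (intro cauchy[OF T0(2,1)]) auto
      then show ?thesis using \<open>e > 0\<close> by simp
    qed
    then show "\<exists>M. \<forall>m\<ge>M. \<forall>n\<ge>M. norm (x m - x n) < e" by blast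
  qed
  then obtain m where m: "x \<longlonglongrightarrow> m" using Cauchy_convergent convergent_def by blast
  have "uniform_mean \<phi> m"
    unfolding uniform_mean_def
  proof (intro conjI allI impI cont)
    fix \<epsilon> :: real assume "\<epsilon> > 0"
    then have e: "\<epsilon>/3 > 0" by simp
    then obtain T0 where T0: "T0 > 0" "\<And>T u. T \<ge> T0 \<Longrightarrow> norm (A u T - A 0 T) \<le> \<epsilon>/3 * T"
      using unif[OF e] by blast
    have "norm (integral {a..a + T} \<phi> - of_real T * m) \<le> \<epsilon> * T" if T: "T \<ge> T0" for T a
    proof -
      have "T > 0" using T T0 by simp
      obtain M where M: "real M \<ge> T0" using real_arch_simple by blast
      have "norm (m - A 0 T / of_real T) \<le> 2 * (\<epsilon>/3)"
      proof (rule Lim_norm_ubound)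
        show "(\<lambda>n. x n - A 0 T / of_real T) \<longlonglongrightarrow> m - A 0 T / of_real T"
          using m by (intro tendsto_intros)
        show "\<forall>\<^sub>F n in sequentially. norm (x n - A 0 T / of_real T) \<le> 2 * (\<epsilon>/3)"
          using eventually_ge_at_top[of M]
          by eventually_elim (unfold x_def, use M T in \<open>intro cauchy[OF T0(2,1)], auto\<close>)
      qed auto
      then have "T * norm (m - A 0 T / of_real T) \<le> T * (2 * (\<epsilon>/3))" using \<open>T > 0\<close> by (intro mult_left_mono) auto
      moreover have "of_real T * (m - A 0 T / of_real T) = of_real T * m - A 0 T"
        using \<open>T > 0\<close> by (simp add: field_simps)
      ultimately have 1: "norm (of_real T * m - A 0 T) \<le> 2 * \<epsilon>/3 * T"
        using \<open>T > 0\<close> by (metis abs_of_pos mult.commute norm_mult norm_of_real times_divide_eq_right)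
      have "norm ((A a T - A 0 T) - (of_real T * m - A 0 T)) \<le> \<epsilon>/3 * T + 2 * \<epsilon>/3 * T"
        by (intro norm_triangle_le_diff add_mono 1 T0(2) T)
      then show ?thesis by (simp add: A_shift mult.commute)
    qed
    then show "\<exists>T0>0. \<forall>T\<ge>T0. \<forall>a. norm (integral {a..a + T} \<phi> - of_real T * m) \<le> \<epsilon> * T"
      using T0(1) by blast
  qed
  then show thesis using that by blast
qed

text \<open>If \<open>\<phi> t0 \<noteq> 0\<close>, finitely many translates of \<open>|\<phi>|\<^sup>2\<close> have a sum bounded below by a positive
  constant, although its mean vanishes.\<close>
lemma bohr_energy_zero:
  assumes "bohr \<phi>" and mean: "uniform_mean (\<lambda>t. \<phi> t * cnj (\<phi> t)) 0"
  shows "\<phi> t0 = 0"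
proof (rule ccontr)
  assume nz: "\<phi> t0 \<noteq> 0"
  define \<psi> where "\<psi> t = \<phi> t * cnj (\<phi> t)" for t
  have \<psi>: "\<psi> t = of_real ((norm (\<phi> t))\<^sup>2)" for t
    by (simp add: \<psi>_def complex_norm_square[symmetric])
  have b: "bohr \<psi>" unfolding \<psi>_def by (intro bohr_mult bohr_cnj assms)
  have m: "uniform_mean \<psi> 0" using mean unfolding \<psi>_def .
  define c where "c = (norm (\<phi> t0))\<^sup>2"
  have c: "c > 0" using nz by (simp add: c_def)
  obtain U where U: "finite U" "\<And>u. \<exists>v\<in>U. \<forall>t. norm (\<psi> (t + u) - \<psi> (t + v)) \<le> c/2"
    using bohr_net[OF b, of "c/2"] c by auto
  \<comment> \<open>For every \<open>u\<close> some net point \<open>v\<close> makes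
    \<open>\<psi> (u + (t0 - v))\<close> differ from \<open>\<psi> t0 = c\<close> by at most
    \<open>c/2\<close>. The other summands are nonnegative, so the sum never falls below
    \<open>c/2\<close>.\<close>
  have S: "uniform_mean (\<lambda>u. \<Sum>v\<in>U. \<psi> (u + (t0 - v))) (\<Sum>v\<in>U. 0)"
    by (intro uniform_mean_sum uniform_mean_shift m)
  have "norm (complex_of_real (c/2)) \<le> Re (\<Sum>v\<in>U. 0)"
  proof (rule uniform_mean_norm_le[OF uniform_mean_const S])
    fix u
    obtain v where v: "v \<in> U" "norm (\<psi> (t0 - v + u) - \<psi> (t0 - v + v)) \<le> c/2" using U(2)[of u] by blast
    have "\<bar>Re (\<psi> (t0 - v + u) - \<psi> (t0 - v + v))\<bar> \<le> c/2"
      using v(2) abs_Re_le_cmod order_trans by blast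
    moreover have "Re (\<psi> (t0 - v + v)) = c" by (simp add: \<psi> c_def)
    moreover have "t0 - v + u = u + (t0 - v)" by simp
    ultimately have "c/2 \<le> Re (\<psi> (u + (t0 - v)))" by (simp only: minus_complex.sel)
    also have "\<dots> \<le> (\<Sum>v\<in>U. Re (\<psi> (u + (t0 - v))))"
      using v(1) U(1) by (intro member_le_sum) (auto simp: \<psi>)
    finally show "norm (complex_of_real (c/2)) \<le> Re (\<Sum>v\<in>U. \<psi> (u + (t0 - v)))"
      using c by simp
  qed
  then show False using c by simp
qed

section \<open>Riesz products\<close>

text \<open>The exponent carries a minus sign so that \<open>w l\<close> gets paired with the
  Fourier coefficient at \<open>l\<close>, and its conjugate with the one at
  \<open>-l\<close>.\<close>

definition riesz_product :: "(real \<Rightarrow> complex) \<Rightarrow> real set \<Rightarrow> real \<Rightarrow> real" where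
  "riesz_product w F t = (\<Prod>l\<in>F. 1 + Re (w l * cis (- (l * t))))"

lemma riesz_product_nonneg:
  assumes "\<And>l. norm (w l) \<le> 1"
  shows "riesz_product w F t \<ge> 0"
  unfolding riesz_product_def
proof (rule prod_nonneg)
  fix l
  have "\<bar>Re (w l * cis (- (l * t)))\<bar> \<le> norm (w l * cis (- (l * t)))" by (rule abs_Re_le_cmod)
  also have "\<dots> \<le> 1" using assms by (simp add: norm_mult)
  finally show "0 \<le> 1 + Re (w l * cis (- (l * t)))" by simp
qed

text \<open>The real part is half the sum of a number and its conjugate, so a new factor splits the
  frequency \<open>\<nu>\<close> into \<open>\<nu>\<close>, \<open>\<nu> + k\<close> and
  \<open>\<nu> - k\<close>. This is the recursion behind both computations of means below.\<close>

lemma riesz_product_insert: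
  assumes "finite F" "k \<notin> F"
  shows "complex_of_real (riesz_product w (insert k F) t) * cis (- (\<nu> * t)) =
    of_real (riesz_product w F t) * cis (- (\<nu> * t))
    + w k / 2 * (of_real (riesz_product w F t) * cis (- ((\<nu> + k) * t)))
    + cnj (w k) / 2 * (of_real (riesz_product w F t) * cis (- ((\<nu> - k) * t)))"
proof -
  have "complex_of_real (1 + Re (w k * cis (- (k * t)))) = 1 + (w k / 2 * cis (- (k * t)) + cnj (w k) / 2 * cis (k * t))"
    using complex_add_cnj[of "w k * cis (- (k * t))"] by (simp add: cis_cnj field_simps)
  moreover have "cis (- ((\<nu> + k) * t)) = cis (- (k * t)) * cis (- (\<nu> * t))"
     "cis (- ((\<nu> - k) * t)) = cis (k * t) * cis (- (\<nu> * t))"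
    by (simp_all add: cis_mult algebra_simps)
  moreover have "complex_of_real (riesz_product w (insert k F) t) =
      of_real (1 + Re (w k * cis (- (k * t)))) * of_real (riesz_product w F t)"
    unfolding riesz_product_def prod.insert[OF assms] of_real_mult ..
  ultimately show ?thesis by (simp only:) (simp add: algebra_simps)
qed

lemma uniform_mean_riesz_insert:
  assumes "finite F" "k \<notin> F"
    and d: "\<And>\<nu>. uniform_mean (\<lambda>t. \<phi> t * (of_real (riesz_product w F t) * cis (- (\<nu> * t)))) (d \<nu>)"
  shows "uniform_mean (\<lambda>t. \<phi> t * (of_real (riesz_product w (insert k F) t) * cis (- (\<nu> * t))))
           (d \<nu> + w k / 2 * d (\<nu> + k) + cnj (w k) / 2 * d (\<nu> - k))"
proof -
  have "uniform_mean (\<lambda>t. \<phi> t * (of_real (riesz_product w F t) * cis (- (\<nu> * t)))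
     + w k / 2 * (\<phi> t * (of_real (riesz_product w F t) * cis (- ((\<nu> + k) * t))))
     + cnj (w k) / 2 * (\<phi> t * (of_real (riesz_product w F t) * cis (- ((\<nu> - k) * t)))))
    (d \<nu> + w k / 2 * d (\<nu> + k) + cnj (w k) / 2 * d (\<nu> - k))"
    by (intro uniform_mean_add uniform_mean_cmult d)
  then show ?thesis
    unfolding riesz_product_insert[OF assms(1,2)] by (simp add: algebra_simps)
qed

interpretation rat_real: vector_space "\<lambda>q. (*) (real_of_rat q)"
  by (rule vector_space_rat_real)

lemma rat_independent_not_in_span:
  assumes "rat_independent \<Lambda>" "l \<in> \<Lambda>" "G \<subseteq> \<Lambda>" "l \<notin> G"
  shows "l \<notin> rat_real.span G"
proof
  assume "l \<in> rat_real.span G"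
  moreover have "rat_real.span G \<subseteq> rat_real.span (\<Lambda> - {l})" using assms by (intro rat_real.span_mono) auto
  ultimately show False using assms unfolding rat_real.dependent_def by blast
qed

text \<open>Only \<open>d 0\<close> is wanted, but the recursion also needs \<open>d k\<close> and
  \<open>d (- k)\<close> for the next exponent \<open>k\<close>. Hence the induction carries two
  more facts: frequencies outside \<open>\<Lambda>\<close> plus the span of \<open>F\<close> have
  coefficient 0, and the coefficients at exponents not yet in \<open>F\<close> are unchanged.
  Independence excludes every coincidence of frequencies that could spoil them.\<close>

lemma riesz_coefficients:
  assumes ind: "rat_independent \<Lambda>"
    and c: "\<And>\<nu>. uniform_mean (\<lambda>t. \<phi> t * cis (- (\<nu> * t))) (c \<nu>)" "\<And>\<nu>. \<nu> \<notin> \<Lambda> \<Longrightarrow> c \<nu> = 0"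
    and "finite F" "F \<subseteq> \<Lambda>"
  shows "\<exists>d. (\<forall>\<nu>. uniform_mean (\<lambda>t. \<phi> t * (of_real (riesz_product w F t) * cis (- (\<nu> * t)))) (d \<nu>)) \<and>
     (\<forall>\<nu>. (\<forall>l\<in>\<Lambda>. \<nu> - l \<notin> rat_real.span F) \<longrightarrow> d \<nu> = 0) \<and>
     (\<forall>l\<in>\<Lambda> - F. d l = c l) \<and> d 0 = (\<Sum>l\<in>F. w l * c l) / 2"
  using assms(4,5)
proof (induction F rule: finite_induct)
  case empty
  have "0 \<notin> \<Lambda>" using rat_independent_not_in_span[OF ind, of 0 "{}"] by auto
  then show ?case using c by (intro exI[of _ c]) (auto simp: riesz_product_def)
next
  case (insert k F)
  have kF: "k \<in> \<Lambda>" "F \<subseteq> \<Lambda>" using insert.prems by auto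
  have F_span: "F \<subseteq> rat_real.span F" by (rule rat_real.span_superset)
  have big: "rat_real.span F \<subseteq> rat_real.span (\<Lambda> - {l})" if "l \<notin> F" for l
    using kF that by (intro rat_real.span_mono) auto
  have base: "x \<in> rat_real.span (\<Lambda> - {l})" if "x \<in> \<Lambda>" "x \<noteq> l" for x l
    using that by (intro rat_real.span_base) auto
  have nl: "l \<notin> rat_real.span (\<Lambda> - {l})" if "l \<in> \<Lambda>" for l
    using rat_independent_not_in_span[OF ind that] by auto
  obtain d where d: "\<And>\<nu>. uniform_mean (\<lambda>t. \<phi> t * (of_real (riesz_product w F t) * cis (- (\<nu> * t)))) (d \<nu>)"
    "\<And>\<nu>. (\<forall>l\<in>\<Lambda>. \<nu> - l \<notin> rat_real.span F) \<Longrightarrow> d \<nu> = 0"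
    "\<And>l. l \<in> \<Lambda> - F \<Longrightarrow> d l = c l" "d 0 = (\<Sum>l\<in>F. w l * c l) / 2"
    using insert.IH kF by blast
  define d' where "d' \<nu> = d \<nu> + w k / 2 * d (\<nu> + k) + cnj (w k) / 2 * d (\<nu> - k)" for \<nu>
  have "uniform_mean (\<lambda>t. \<phi> t * (of_real (riesz_product w (insert k F) t) * cis (- (\<nu> * t)))) (d' \<nu>)" for \<nu>
    unfolding d'_def by (rule uniform_mean_riesz_insert[OF insert.hyps d(1)])
  moreover have "d' \<nu> = 0" if \<nu>: "\<forall>l\<in>\<Lambda>. \<nu> - l \<notin> rat_real.span (insert k F)" for \<nu>
  proof -
    have sub: "x \<in> rat_real.span (insert k F)" if "x \<in> rat_real.span F" for x
      using that rat_real.span_mono[of F "insert k F"] by auto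
    have k: "k \<in> rat_real.span (insert k F)" by (intro rat_real.span_base) auto
    have "\<nu> - l \<notin> rat_real.span F" if "l \<in> \<Lambda>" for l using \<nu> sub that by blast
    moreover have "\<nu> + k - l \<notin> rat_real.span F" if "l \<in> \<Lambda>" for l
      using \<nu> that rat_real.span_diff[OF sub k, of "\<nu> + k - l"] by (auto simp: algebra_simps)
    moreover have "\<nu> - k - l \<notin> rat_real.span F" if "l \<in> \<Lambda>" for l
      using \<nu> that rat_real.span_add[OF sub k, of "\<nu> - k - l"] by (auto simp: algebra_simps)
    ultimately show ?thesis unfolding d'_def by (simp add: d(2))
  qed
  moreover have "d' l = c l" if l: "l \<in> \<Lambda> - insert k F" for l
  proof -
    have kk: "k \<in> rat_real.span (\<Lambda> - {l})" using base kF l by auto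
    have "l + k - x \<notin> rat_real.span F" if x: "x \<in> \<Lambda>" for x
    proof
      assume a: "l + k - x \<in> rat_real.span F"
      show False
      proof (cases "x = l")
        case True
        then show False using a big[of k] nl[of k] kF insert.hyps by auto
      next
        case False
        have "l + k - x \<in> rat_real.span (\<Lambda> - {l})" using a big[of l] l by auto
        then have "(l + k - x) - k + x \<in> rat_real.span (\<Lambda> - {l})"
          by (rule rat_real.span_add[OF rat_real.span_diff[OF _ kk] base[OF x False]])
        then show False using nl l by simp
      qed
    qed
    moreover have "l - k - x \<notin> rat_real.span F" if x: "x \<in> \<Lambda>" for x
    proof
      assume a: "l - k - x \<in> rat_real.span F"
      show False
      proof (cases "x = l")
        case True
        then have "- k \<in> rat_real.span F" using a by simp
        then have "k \<in> rat_real.span F" using rat_real.span_neg by fastforce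
        then show False using a big[of k] nl[of k] kF insert.hyps by auto
      next
        case False
        have "l - k - x \<in> rat_real.span (\<Lambda> - {l})" using a big[of l] l by auto
        then have "(l - k - x) + k + x \<in> rat_real.span (\<Lambda> - {l})"
          by (rule rat_real.span_add[OF rat_real.span_add[OF _ kk] base[OF x False]])
        then show False using nl l by simp
      qed
    qed
    ultimately show ?thesis unfolding d'_def using d(3) l by (simp add: d(2))
  qed
  moreover have "d' 0 = (\<Sum>l\<in>insert k F. w l * c l) / 2"
  proof -
    \<comment> \<open>This kills the conjugate contribution \<open>d (- k)\<close>. The delicate
      case is \<open>x = k\<close>, where \<open>-2 * k\<close> lies in the span and has to be
      divided by -2 to contradict independence.\<close>
    have "- k - x \<notin> rat_real.span F" if x: "x \<in> \<Lambda>" for x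
    proof
      assume a: "- k - x \<in> rat_real.span F"
      then have a: "- k - x \<in> rat_real.span (\<Lambda> - {k})" using big insert.hyps by blast
      have "k \<in> rat_real.span (\<Lambda> - {k})"
      proof (cases "x = k")
        case True
        then show ?thesis using rat_real.span_scale[OF a, of "-1/2"] by (simp add: of_rat_divide of_rat_minus)
      next
        case False
        show ?thesis using rat_real.span_neg[OF rat_real.span_add[OF a base[OF x False]]] by simp
      qed
      then show False using nl kF by blast
    qed
    then have "d (- k) = 0" by (simp add: d(2))
    then show ?thesis unfolding d'_def using d(3,4) kF insert.hyps by (simp add: add_divide_distrib)
  qed
  ultimately show ?case by (intro exI[of _ d']) blast
qed

text \<open>The same recursion with \<open>\<phi>\<close> constantly 1, written as
  \<open>1 * ...\<close> so that the insertion lemma applies. A new exponent \<open>k\<close> and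
  its negative lie outside the span of \<open>F\<close>, so the mean stays 1.\<close>

lemma riesz_product_mean:
  assumes ind: "rat_independent \<Lambda>" and "finite F" "F \<subseteq> \<Lambda>"
  shows "\<exists>d. (\<forall>\<nu>. uniform_mean (\<lambda>t. 1 * (of_real (riesz_product w F t) * cis (- (\<nu> * t)))) (d \<nu>)) \<and>
     (\<forall>\<nu>. \<nu> \<notin> rat_real.span F \<longrightarrow> d \<nu> = 0) \<and> d 0 = 1"
  using assms(2,3)
proof (induction F rule: finite_induct)
  case empty
  have "uniform_mean (\<lambda>t. 1 * (of_real (riesz_product w {} t) * cis (- (\<nu> * t)))) (if \<nu> = 0 then 1 else 0)" for \<nu>
    using uniform_mean_cis[of "-\<nu>"] by (auto simp: riesz_product_def uniform_mean_const)
  then show ?case by (intro exI[of _ "\<lambda>\<nu>. if \<nu> = 0 then 1 else 0"]) auto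
next
  case (insert k F)
  have kF: "k \<in> \<Lambda>" "F \<subseteq> \<Lambda>" using insert.prems by auto
  obtain d where d: "\<And>\<nu>. uniform_mean (\<lambda>t. 1 * (of_real (riesz_product w F t) * cis (- (\<nu> * t)))) (d \<nu>)"
    "\<And>\<nu>. \<nu> \<notin> rat_real.span F \<Longrightarrow> d \<nu> = 0" "d 0 = 1"
    using insert.IH kF by blast
  define d' where "d' \<nu> = d \<nu> + w k / 2 * d (\<nu> + k) + cnj (w k) / 2 * d (\<nu> - k)" for \<nu>
  have "uniform_mean (\<lambda>t. 1 * (of_real (riesz_product w (insert k F) t) * cis (- (\<nu> * t)))) (d' \<nu>)" for \<nu>
    unfolding d'_def by (rule uniform_mean_riesz_insert[OF insert.hyps d(1)])
  moreover have "d' \<nu> = 0" if \<nu>: "\<nu> \<notin> rat_real.span (insert k F)" for \<nu>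
  proof -
    have sub: "x \<in> rat_real.span (insert k F)" if "x \<in> rat_real.span F" for x
      using that rat_real.span_mono[of F "insert k F"] by auto
    have k: "k \<in> rat_real.span (insert k F)" by (intro rat_real.span_base) auto
    have "\<nu> \<notin> rat_real.span F" using \<nu> sub by blast
    moreover have "\<nu> + k \<notin> rat_real.span F"
      using \<nu> rat_real.span_diff[OF sub k, of "\<nu> + k"] by auto
    moreover have "\<nu> - k \<notin> rat_real.span F"
      using \<nu> rat_real.span_add[OF sub k, of "\<nu> - k"] by auto
    ultimately show ?thesis unfolding d'_def by (simp add: d(2))
  qed
  moreover have "d' 0 = 1"
  proof -
    have k: "k \<notin> rat_real.span F" using rat_independent_not_in_span[OF ind kF] insert.hyps by blast
    then have "- k \<notin> rat_real.span F" using rat_real.span_neg[of "-k" F] by auto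
    then show ?thesis unfolding d'_def using d k by simp
  qed
  ultimately show ?case by (intro exI[of _ d']) blast
qed

text \<open>With \<open>w l\<close> the conjugate sign of \<open>c l\<close>, the mean of
  \<open>\<phi>\<close> times the product is half the sum of the moduli. Since the product is
  nonnegative with mean 1, that mean is at most \<open>B\<close> in modulus.\<close>

lemma sum_norm_coefficients_le:
  assumes ind: "rat_independent \<Lambda>"
    and c: "\<And>\<nu>. uniform_mean (\<lambda>t. \<phi> t * cis (- (\<nu> * t))) (c \<nu>)" "\<And>\<nu>. \<nu> \<notin> \<Lambda> \<Longrightarrow> c \<nu> = 0"
    and F: "finite F" "F \<subseteq> \<Lambda>" and B: "\<And>t. norm (\<phi> t) \<le> B"
  shows "(\<Sum>l\<in>F. norm (c l)) \<le> 2 * B"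
proof -
  define w where "w l = cnj (sgn (c l))" for l
  have w: "norm (w l) \<le> 1" "w l * c l = of_real (norm (c l))" for l
    by (cases "c l = 0"; simp add: w_def norm_sgn)
      (cases "c l = 0"; simp add: w_def sgn_eq complex_norm_square[symmetric] mult.commute[of "cnj _"] power2_eq_square)
  obtain d where d: "\<And>\<nu>. uniform_mean (\<lambda>t. \<phi> t * (of_real (riesz_product w F t) * cis (- (\<nu> * t)))) (d \<nu>)"
      "d 0 = (\<Sum>l\<in>F. w l * c l) / 2"
    using riesz_coefficients[OF ind c F, of w] by blast
  obtain e where e: "\<And>\<nu>. uniform_mean (\<lambda>t. 1 * (of_real (riesz_product w F t) * cis (- (\<nu> * t)))) (e \<nu>)" "e 0 = 1"
    using riesz_product_mean[OF ind F, of w] by blast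
  have 1: "uniform_mean (\<lambda>t. \<phi> t * of_real (riesz_product w F t)) (d 0)" using d(1)[of 0] by simp
  have 2: "uniform_mean (\<lambda>t. of_real B * of_real (riesz_product w F t)) (of_real B * 1)"
    using e(1)[of 0] e(2) by (intro uniform_mean_cmult) simp
  have "norm (d 0) \<le> Re (of_real B * 1)"
  proof (rule uniform_mean_norm_le[OF 1 2])
    fix t
    have "norm (\<phi> t) * riesz_product w F t \<le> B * riesz_product w F t"
      by (intro mult_right_mono B riesz_product_nonneg w)
    then show "norm (\<phi> t * of_real (riesz_product w F t)) \<le> Re (of_real B * of_real (riesz_product w F t))"
      using riesz_product_nonneg[of w F t] w(1) by (simp add: norm_mult)
  qed
  moreover have "d 0 = of_real ((\<Sum>l\<in>F. norm (c l)) / 2)" using d(2) w(2) by simp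
  moreover have "(\<Sum>l\<in>F. norm (c l)) / 2 \<ge> 0" by (simp add: sum_nonneg)
  ultimately show ?thesis by (simp only: norm_of_real) simp
qed

section \<open>Uniqueness of Fourier expansions\<close>

lemma sum_roots_of_unity:
  assumes "n < M" "m < M"
  shows "(\<Sum>k<M. cis (2 * pi * real k * (real n - real m) / real M)) = (if n = m then of_nat M else 0)"
proof (cases "n = m")
  case False
  have M: "M > 0" using assms by simp
  define z where "z = cis (2 * pi * (real n - real m) / real M)"
  have "cis (2 * pi * real k * (real n - real m) / real M) = z ^ k" for k
    unfolding z_def Complex.DeMoivre by (simp add: mult_ac)
  then have "(\<Sum>k<M. cis (2 * pi * real k * (real n - real m) / real M)) = (\<Sum>k<M. z ^ k)" by simp
  moreover have "z \<noteq> 1"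
  proof
    assume "z = 1"
    then have "cos (2 * pi * (real n - real m) / real M) = 1" unfolding z_def by (metis cis.sel(1) one_complex.sel(1))
    then obtain j :: int where "2 * pi * (real n - real m) / real M = of_int j * 2 * pi"
      unfolding cos_one_2pi_int by blast
    then have "(2 * pi) * (real n - real m) = (2 * pi) * (of_int j * real M)" using M by (simp add: field_simps)
    then have "real n - real m = of_int j * real M" by (simp del: right_diff_distrib)
    then have "int n - int m = j * int M" by (metis of_int_diff of_int_eq_iff of_int_mult of_int_of_nat_eq)
    then have "int M dvd int n - int m" by simp
    moreover have "\<bar>int n - int m\<bar> < int M" using assms by linarith
    ultimately show False using False zdvd_imp_le[of "int M" "\<bar>int n - int m\<bar>"] by fastforce
  qed
  moreover have "z ^ M = 1"
  proof -
    have "z ^ M = cis (2 * pi * of_int (int n - int m))" using M by (simp add: z_def Complex.DeMoivre)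
    then show ?thesis using cis_multiple_2pi[of "of_int (int n - int m)"] by (simp only: Ints_of_int)
  qed
  ultimately show ?thesis using False by (simp add: geometric_sum)
qed auto

lemma finite_parseval:
  fixes x :: "nat \<Rightarrow> complex"
  assumes "M > 0"
  shows "(\<Sum>k<M. (norm (\<Sum>n<M. x n * cis (- (2 * pi * real k * real n / real M))))\<^sup>2) = real M * (\<Sum>n<M. (norm (x n))\<^sup>2)"
proof -
  have "complex_of_real ((norm (\<Sum>n<M. x n * cis (- (2 * pi * real k * real n / real M))))\<^sup>2)
     = (\<Sum>n<M. \<Sum>m<M. x n * cnj (x m) * cis (2 * pi * real k * (real m - real n) / real M))" for k
  proof -
    have "complex_of_real ((norm (\<Sum>n<M. x n * cis (- (2 * pi * real k * real n / real M))))\<^sup>2)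
      = (\<Sum>n<M. x n * cis (- (2 * pi * real k * real n / real M))) * (\<Sum>m<M. cnj (x m) * cis (2 * pi * real k * real m / real M))"
      unfolding complex_norm_square cnj_sum by (simp add: cis_cnj)
    also have "\<dots> = (\<Sum>n<M. \<Sum>m<M. x n * cnj (x m) * (cis (- (2 * pi * real k * real n / real M)) * cis (2 * pi * real k * real m / real M)))"
      unfolding sum_product by (intro sum.cong refl) (simp add: mult_ac)
    finally show ?thesis
      by (simp add: cis_mult diff_divide_distrib right_diff_distrib algebra_simps)
  qed
  then have "complex_of_real (\<Sum>k<M. (norm (\<Sum>n<M. x n * cis (- (2 * pi * real k * real n / real M))))\<^sup>2)
     = (\<Sum>k<M. \<Sum>n<M. \<Sum>m<M. x n * cnj (x m) * cis (2 * pi * real k * (real m - real n) / real M))"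
    by simp
  also have "\<dots> = (\<Sum>n<M. \<Sum>k<M. \<Sum>m<M. x n * cnj (x m) * cis (2 * pi * real k * (real m - real n) / real M))"
    by (rule sum.swap)
  also have "\<dots> = (\<Sum>n<M. \<Sum>m<M. \<Sum>k<M. x n * cnj (x m) * cis (2 * pi * real k * (real m - real n) / real M))"
    by (intro sum.cong refl sum.swap)
  also have "\<dots> = (\<Sum>n<M. \<Sum>m<M. if n = m then x n * cnj (x m) * of_nat M else 0)"
    unfolding sum_distrib_left[symmetric]
    by (intro sum.cong refl) (subst sum_roots_of_unity, auto)
  also have "\<dots> = (\<Sum>n<M. x n * cnj (x n) * of_nat M)"
    by (intro sum.cong refl) (simp add: sum.delta')
  also have "\<dots> = complex_of_real (real M * (\<Sum>n<M. (norm (x n))\<^sup>2))"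
    by (simp add: complex_norm_square[symmetric] sum_distrib_left mult.commute)
  finally show ?thesis unfolding of_real_eq_iff .
qed

lemma sum_periodic_shift:
  fixes P :: "nat \<Rightarrow> 'a::ab_group_add"
  assumes "\<And>n. P (n + M) = P n"
  shows "(\<Sum>u<M. P (n + u)) = (\<Sum>u<M. P u)"
proof (induction n)
  case (Suc n)
  have "P n + (\<Sum>u<M. P (Suc n + u)) = (\<Sum>u<Suc M. P (n + u))"
    by (subst sum.lessThan_Suc_shift) simp
  also have "\<dots> = (\<Sum>u<M. P (n + u)) + P n" using assms by simp
  finally show ?case using Suc by (simp add: add.commute)
qed simp

text \<open>The discrete transform of a cyclic correlation is the transform of \<open>H\<close>
  times the conjugate transform of \<open>g\<close>. Parseval, used for the correlation and for
  \<open>g\<close>, turns the uniform bound \<open>q\<close> on the first factor into a mean-square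
  bound.\<close>

lemma cyclic_correlation_bound:
  fixes H g :: "nat \<Rightarrow> complex"
  assumes M: "M > 0" and per: "\<And>n. H (n + M) = H n"
    and q: "\<And>k. k < M \<Longrightarrow> norm (\<Sum>n<M. H n * cis (- (2 * pi * real k * real n / real M))) \<le> q"
  shows "(\<Sum>u<M. (norm (\<Sum>n<M. H (n + u) * cnj (g n)))\<^sup>2) \<le> q\<^sup>2 * (\<Sum>n<M. (norm (g n))\<^sup>2)"
proof -
  define e where "e k n = cis (- (2 * pi * real k * real n / real M))" for k n
  define C where "C u = (\<Sum>n<M. H (n + u) * cnj (g n))" for u
  define dft where "dft x k = (\<Sum>n<M. x n * e k n)" for x k
  have e_add: "e k (m + n) = e k m * e k n" for k m n
    by (simp add: e_def cis_mult add_divide_distrib distrib_left)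
  have e_M: "e k M = 1" for k
  proof -
    have "e k M = cis (2 * pi * of_int (- int k))" using M by (simp add: e_def)
    then show ?thesis using cis_multiple_2pi[of "of_int (- int k)"] by (simp only: Ints_of_int)
  qed
  have e_cnj: "cnj (e k n) * e k n = 1" for k n by (simp add: e_def cis_cnj cis_mult)
  have "dft C k = dft H k * cnj (dft g k)" for k
  proof -
    have "dft C k = (\<Sum>u<M. \<Sum>n<M. H (n + u) * cnj (g n) * e k u)"
      unfolding dft_def C_def sum_distrib_right ..
    also have "\<dots> = (\<Sum>n<M. \<Sum>u<M. H (n + u) * cnj (g n) * e k u)" by (rule sum.swap)
    also have "\<dots> = (\<Sum>n<M. cnj (g n) * cnj (e k n) * (\<Sum>u<M. H (n + u) * e k (n + u)))"
    proof -
      have "H (n + u) * cnj (g n) * e k u = cnj (g n) * cnj (e k n) * (H (n + u) * e k (n + u))" for n u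
      proof -
        have "cnj (g n) * cnj (e k n) * (H (n + u) * e k (n + u)) = H (n + u) * cnj (g n) * e k u * (cnj (e k n) * e k n)"
          unfolding e_add by (simp only: mult_ac)
        then show ?thesis by (simp only: e_cnj mult_1_right)
      qed
      then show ?thesis by (simp only: sum_distrib_left)
    qed
    also have "\<dots> = (\<Sum>n<M. cnj (g n) * cnj (e k n) * dft H k)"
    proof -
      have "(\<Sum>u<M. H (n + u) * e k (n + u)) = dft H k" for n
        unfolding dft_def by (rule sum_periodic_shift) (simp add: per e_add e_M)
      then show ?thesis by simp
    qed
    also have "\<dots> = dft H k * cnj (dft g k)"
      unfolding dft_def[of g] cnj_sum complex_cnj_mult sum_distrib_left by (simp only: mult_ac)
    finally show ?thesis .
  qed
  then have "real M * (\<Sum>u<M. (norm (C u))\<^sup>2) = (\<Sum>k<M. (norm (dft H k))\<^sup>2 * (norm (dft g k))\<^sup>2)"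
    using finite_parseval[OF M, of C] unfolding e_def[symmetric] dft_def[symmetric]
    by (simp add: norm_mult power_mult_distrib)
  also have "\<dots> \<le> (\<Sum>k<M. q\<^sup>2 * (norm (dft g k))\<^sup>2)"
    using q unfolding e_def[symmetric] dft_def[symmetric]
    by (intro sum_mono mult_right_mono power_mono) auto
  also have "\<dots> = real M * (q\<^sup>2 * (\<Sum>n<M. (norm (g n))\<^sup>2))"
    using finite_parseval[OF M, of g] unfolding e_def[symmetric] dft_def[symmetric]
    by (simp add: sum_distrib_left[symmetric])
  finally show ?thesis unfolding C_def using M by simp
qed

section \<open>Sampling on a mesh, and averages bounded uniformly in the frequency\<close>

lemma norm_cis_minus_one_le: "norm (cis x - 1) \<le> \<bar>x\<bar>"
proof -
  have "(norm (cis x - 1))\<^sup>2 = (2 * sin (x/2))\<^sup>2"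
  proof -
    have "(norm (cis x - 1))\<^sup>2 = (cos x - 1)\<^sup>2 + (sin x)\<^sup>2" by (simp add: cmod_power2)
    also have "\<dots> = 2 - 2 * cos x" using sin_cos_squared_add[of x] by (simp add: power2_eq_square algebra_simps)
    also have "\<dots> = (2 * sin (x/2))\<^sup>2" using cos_double_sin[of "x/2"] by (simp add: power_mult_distrib)
    finally show ?thesis .
  qed
  then have "norm (cis x - 1) = \<bar>2 * sin (x/2)\<bar>" by (metis norm_ge_zero real_sqrt_abs real_sqrt_unique)
  also have "\<dots> \<le> \<bar>x\<bar>" using abs_sin_x_le_abs_x[of "x/2"] by (simp add: abs_mult)
  finally show ?thesis .
qed

text \<open>Integrating \<open>1 - (\<mu> * s)\<^sup>2 / 2\<close>, a lower bound for the cosine,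
  gives \<open>h * (1 - (\<mu> * h)\<^sup>2 / 24)\<close>. As the square of pi is at most 16, the
  bracket is at least 1/3. Thus dividing by this integral costs at most a factor
  \<open>3 / h\<close>.\<close>

lemma sinc_lower_bound:
  assumes "h > 0" "\<bar>\<mu> * h\<bar> \<le> pi"
  shows "h / 3 \<le> norm (integral {-(h/2)..h/2} (\<lambda>s. cis (- (\<mu> * s))))"
proof -
  have I: "(\<lambda>s. cis (- (\<mu> * s))) integrable_on {-(h/2)..h/2}"
    by (intro integrable_continuous_interval continuous_intros)
  have P: "((\<lambda>s. 1 - (\<mu> * s)\<^sup>2 / 2) has_integral
      ((h/2 - \<mu>\<^sup>2 * (h/2)^3 / 6) - (-(h/2) - \<mu>\<^sup>2 * (-(h/2))^3 / 6))) {-(h/2)..h/2}"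
  proof (rule fundamental_theorem_of_calculus)
    show "((\<lambda>s. s - \<mu>\<^sup>2 * s^3 / 6) has_vector_derivative (1 - (\<mu> * x)\<^sup>2 / 2)) (at x within {-(h/2)..h/2})" for x
      unfolding has_real_derivative_iff_has_vector_derivative[symmetric]
      by (auto intro!: derivative_eq_intros simp: power2_eq_square)
  qed (use assms in auto)
  have "h / 3 \<le> h * (1 - (\<mu> * h)\<^sup>2 / 24)"
  proof -
    have "(\<mu> * h)\<^sup>2 \<le> pi\<^sup>2" using assms(2) by (metis abs_ge_zero power2_abs power_mono)
    also have "\<dots> \<le> 4\<^sup>2" using pi_less_4 pi_gt_zero by (intro power_mono) auto
    finally have "1/3 \<le> 1 - (\<mu> * h)\<^sup>2 / 24" by simp
    then show ?thesis using mult_left_mono[of "1/3" "1 - (\<mu> * h)\<^sup>2 / 24" h] assms(1) by simp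
  qed
  also have "\<dots> = (h/2 - \<mu>\<^sup>2 * (h/2)^3 / 6) - (-(h/2) - \<mu>\<^sup>2 * (-(h/2))^3 / 6)"
    by (simp add: power2_eq_square power3_eq_cube algebra_simps)
  also have "\<dots> \<le> integral {-(h/2)..h/2} (\<lambda>s. Re (cis (- (\<mu> * s))))"
  proof (rule has_integral_le[OF P])
    show "((\<lambda>s. Re (cis (- (\<mu> * s)))) has_integral integral {-(h/2)..h/2} (\<lambda>s. Re (cis (- (\<mu> * s))))) {-(h/2)..h/2}"
      by (intro integrable_integral integrable_continuous_interval continuous_intros)
    fix s
    have "1 - cos (\<mu> * s) = 2 * (sin (\<mu> * s / 2))\<^sup>2" using cos_double_sin[of "\<mu> * s / 2"] by simp
    moreover have "(sin (\<mu> * s / 2))\<^sup>2 \<le> (\<mu> * s / 2)\<^sup>2" by (metis abs_ge_zero abs_sin_x_le_abs_x power2_abs power_mono)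
    ultimately show "1 - (\<mu> * s)\<^sup>2 / 2 \<le> Re (cis (- (\<mu> * s)))" by (simp add: power2_eq_square)
  qed
  also have "\<dots> = Re (integral {-(h/2)..h/2} (\<lambda>s. cis (- (\<mu> * s))))"
    using integral_linear[OF I bounded_linear_Re] by (simp add: o_def)
  also have "\<dots> \<le> norm (integral {-(h/2)..h/2} (\<lambda>s. cis (- (\<mu> * s))))" by (rule complex_Re_le_cmod)
  finally show ?thesis .
qed

text \<open>In each cell of width \<open>h\<close>, centred at a sample point, only
  \<open>\<psi>\<close> is frozen while the exponential is integrated exactly. The error therefore
  does not depend on \<open>\<mu>\<close>, however fast the exponential oscillates.\<close>

lemma riemann_sum_error:
  fixes \<psi> :: "real \<Rightarrow> complex"
  assumes cont: "continuous_on UNIV \<psi>" and h: "h > 0"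
    and uc: "\<And>x y. \<bar>x - y\<bar> \<le> h \<Longrightarrow> norm (\<psi> x - \<psi> y) \<le> \<eta>"
  shows "norm (integral {x - h/2..x - h/2 + real N * h} (\<lambda>t. \<psi> t * cis (- (\<mu> * t)))
     - integral {-(h/2)..h/2} (\<lambda>s. cis (- (\<mu> * s))) * (\<Sum>n<N. \<psi> (x + real n * h) * cis (- (\<mu> * (x + real n * h)))))
    \<le> \<eta> * (real N * h)"
proof (induction N)
  case (Suc N)
  define \<kappa> where "\<kappa> = integral {-(h/2)..h/2} (\<lambda>s. cis (- (\<mu> * s)))"
  define p where "p = x + real N * h"
  let ?f = "\<lambda>t. \<psi> t * cis (- (\<mu> * t))"
  have c: "continuous_on S ?f" for S
    by (intro continuous_intros continuous_on_subset[OF cont]) auto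
  have c\<psi>: "continuous_on S \<psi>" for S by (intro continuous_on_subset[OF cont]) auto
  have "integral {x - h/2..p - h/2} ?f + integral {p - h/2..p + h/2} ?f = integral {x - h/2..p + h/2} ?f"
    using h by (intro Henstock_Kurzweil_Integration.integral_combine integrable_continuous_interval c) (auto simp: p_def)
  moreover have "p + h/2 = x - h/2 + real (Suc N) * h" by (simp add: p_def algebra_simps)
  ultimately have split: "integral {x - h/2..x - h/2 + real (Suc N) * h} ?f =
      integral {x - h/2..x - h/2 + real N * h} ?f + integral {p - h/2..p + h/2} ?f"
    by (simp add: p_def algebra_simps)
  have \<kappa>: "integral {p - h/2..p + h/2} (\<lambda>t. cis (- (\<mu> * t))) = cis (- (\<mu> * p)) * \<kappa>"
  proof -
    have "integral {-(h/2)..h/2} ((\<lambda>t. cis (- (\<mu> * t))) \<circ> (\<lambda>x. x + p)) = integral {-(h/2) + p..h/2 + p} (\<lambda>t. cis (- (\<mu> * t)))"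
      by (intro integral_shift continuous_intros)
    moreover have "(\<lambda>t. cis (- (\<mu> * t))) \<circ> (\<lambda>x. x + p) = (\<lambda>s. cis (- (\<mu> * p)) * cis (- (\<mu> * s)))"
      by (auto simp: cis_mult algebra_simps)
    ultimately show ?thesis unfolding \<kappa>_def by (simp add: algebra_simps)
  qed
  have "integral {p - h/2..p + h/2} (\<lambda>t. (\<psi> t - \<psi> p) * cis (- (\<mu> * t))) =
     integral {p - h/2..p + h/2} ?f - integral {p - h/2..p + h/2} (\<lambda>t. \<psi> p * cis (- (\<mu> * t)))"
    unfolding left_diff_distrib
    by (intro Henstock_Kurzweil_Integration.integral_diff integrable_continuous_interval c continuous_intros)
  then have "integral {p - h/2..p + h/2} ?f - \<kappa> * (\<psi> p * cis (- (\<mu> * p))) =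
     integral {p - h/2..p + h/2} (\<lambda>t. (\<psi> t - \<psi> p) * cis (- (\<mu> * t)))"
    using \<kappa> by simp
  also have "norm \<dots> \<le> \<eta> * (p + h/2 - (p - h/2))"
    using h by (intro integral_bound continuous_intros c\<psi>) (auto simp: norm_mult abs_le_iff intro!: uc)
  finally have step: "norm (integral {p - h/2..p + h/2} ?f - \<kappa> * (\<psi> p * cis (- (\<mu> * p)))) \<le> \<eta> * h" by simp
  have "integral {x - h/2..x - h/2 + real (Suc N) * h} ?f - \<kappa> * (\<Sum>n<Suc N. \<psi> (x + real n * h) * cis (- (\<mu> * (x + real n * h))))
     = (integral {x - h/2..x - h/2 + real N * h} ?f - \<kappa> * (\<Sum>n<N. \<psi> (x + real n * h) * cis (- (\<mu> * (x + real n * h)))))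
      + (integral {p - h/2..p + h/2} ?f - \<kappa> * (\<psi> p * cis (- (\<mu> * p))))"
    unfolding split by (simp add: p_def algebra_simps)
  also have "norm \<dots> \<le> \<eta> * (real N * h) + \<eta> * h"
    by (intro norm_triangle_le add_mono step) (use Suc.IH in \<open>simp add: \<kappa>_def\<close>)
  finally show ?case by (simp add: \<kappa>_def algebra_simps)
qed simp

lemma norm_integral_multiple_le:
  fixes \<psi> :: "real \<Rightarrow> complex"
  assumes cont: "continuous_on UNIV \<psi>" and "S > 0"
    and block: "\<And>a. norm (integral {a..a + S} \<psi>) \<le> C"
  shows "norm (integral {a..a + real n * S} \<psi>) \<le> real n * C"
proof (induction n)
  case (Suc n)
  have "integral {a..a + real n * S} \<psi> + integral {a + real n * S..a + real n * S + S} \<psi>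
      = integral {a..a + real n * S + S} \<psi>"
    using assms by (intro Henstock_Kurzweil_Integration.integral_combine integrable_continuous_interval continuous_on_subset[OF cont]) auto
  moreover have eq: "a + real (Suc n) * S = a + real n * S + S" by (simp add: algebra_simps)
  ultimately have "integral {a..a + real (Suc n) * S} \<psi> = integral {a..a + real n * S} \<psi> + integral {a + real n * S..a + real n * S + S} \<psi>"
    by (simp only: eq)
  also have "norm \<dots> \<le> real n * C + C"
    by (intro norm_triangle_le add_mono Suc.IH block)
  finally show ?case by (simp add: algebra_simps)
qed simp

text \<open>On one block whose length \<open>S\<close> is chosen for \<open>\<mu>0\<close>, nearby
  frequencies stay in phase up to a unimodular constant. A long interval consists of such blocks and
  a remainder shorter than a block.\<close>

lemma locally_uniform_frequency_bound:
  assumes cont: "continuous_on UNIV \<phi>" and B: "B > 0" "\<And>t. norm (\<phi> t) \<le> B"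
    and mean: "uniform_mean (\<lambda>t. \<phi> t * cis (- (\<mu>0 * t))) 0" and e: "\<epsilon> > 0"
  obtains \<delta> T0 where "\<delta> > 0" "T0 > 0"
    "\<And>\<mu> T a. \<bar>\<mu> - \<mu>0\<bar> < \<delta> \<Longrightarrow> T \<ge> T0 \<Longrightarrow> norm (integral {a..a + T} (\<lambda>t. \<phi> t * cis (- (\<mu> * t)))) \<le> \<epsilon> * T"
proof -
  have "\<epsilon>/3 > 0" using e by simp
  from uniform_meanE[OF mean this] obtain S where S: "S > 0"
    "\<And>T a. T \<ge> S \<Longrightarrow> norm (integral {a..a + T} (\<lambda>t. \<phi> t * cis (- (\<mu>0 * t))) - of_real T * 0) \<le> \<epsilon>/3 * T"
    by metis
  \<comment> \<open>The phase drift within a block is at most \<open>\<delta> * S\<close>, an error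
    of \<open>\<epsilon>/3\<close> per unit length; the frequency \<open>\<mu>0\<close> itself
    accounts for another \<open>\<epsilon>/3\<close>. \<open>T0\<close> makes the remainder, at most
    \<open>B * S\<close>, the last third.\<close>
  define \<delta> where "\<delta> = \<epsilon> / (3 * B * S)"
  define T0 where "T0 = 3 * B * S / \<epsilon>"
  have c: "continuous_on X (\<lambda>t. \<phi> t * cis (- (\<mu> * t)))" for \<mu> X
    by (intro continuous_intros continuous_on_subset[OF cont]) auto
  have block: "norm (integral {a..a + S} (\<lambda>t. \<phi> t * cis (- (\<mu> * t)))) \<le> 2 * \<epsilon>/3 * S" if \<mu>: "\<bar>\<mu> - \<mu>0\<bar> < \<delta>" for \<mu> a
  proof -
    \<comment> \<open>This factor aligns the two exponentials at the left end of the block, so the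
      estimate is independent of the position \<open>a\<close>.\<close>
    define w where "w = cis (- ((\<mu> - \<mu>0) * a))"
    have "integral {a..a + S} (\<lambda>t. \<phi> t * cis (- (\<mu> * t)) - w * (\<phi> t * cis (- (\<mu>0 * t)))) =
       integral {a..a + S} (\<lambda>t. \<phi> t * cis (- (\<mu> * t))) - integral {a..a + S} (\<lambda>t. w * (\<phi> t * cis (- (\<mu>0 * t))))"
      by (intro Henstock_Kurzweil_Integration.integral_diff integrable_continuous_interval c continuous_intros
          continuous_on_subset[OF cont]) auto
    then have eq: "integral {a..a + S} (\<lambda>t. \<phi> t * cis (- (\<mu> * t))) =
       integral {a..a + S} (\<lambda>t. \<phi> t * cis (- (\<mu> * t)) - w * (\<phi> t * cis (- (\<mu>0 * t))))
       + w * integral {a..a + S} (\<lambda>t. \<phi> t * cis (- (\<mu>0 * t)))" by simp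
    have "norm (integral {a..a + S} (\<lambda>t. \<phi> t * cis (- (\<mu> * t)) - w * (\<phi> t * cis (- (\<mu>0 * t))))) \<le> \<epsilon>/(3 * S) * S * (a + S - a)"
    proof (rule integral_bound)
      fix t assume t: "t \<in> {a..a + S}"
      have "cis (- (\<mu> * t)) = cis (- ((\<mu> - \<mu>0) * (t - a))) * (w * cis (- (\<mu>0 * t)))"
        by (simp add: w_def cis_mult algebra_simps)
      then have "\<phi> t * cis (- (\<mu> * t)) - w * (\<phi> t * cis (- (\<mu>0 * t))) =
         \<phi> t * (w * cis (- (\<mu>0 * t)) * (cis (- ((\<mu> - \<mu>0) * (t - a))) - 1))"
        by (simp only:) (simp add: algebra_simps)
      then have "norm (\<phi> t * cis (- (\<mu> * t)) - w * (\<phi> t * cis (- (\<mu>0 * t)))) = norm (\<phi> t) * norm (cis (- ((\<mu> - \<mu>0) * (t - a))) - 1)"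
        by (simp add: norm_mult w_def)
      also have "\<dots> \<le> B * (\<delta> * S)"
      proof (intro mult_mono B)
        have "norm (cis (- ((\<mu> - \<mu>0) * (t - a))) - 1) \<le> \<bar>- ((\<mu> - \<mu>0) * (t - a))\<bar>" by (rule norm_cis_minus_one_le)
        also have "\<dots> = \<bar>\<mu> - \<mu>0\<bar> * \<bar>t - a\<bar>" by (simp add: abs_mult)
        also have "\<dots> \<le> \<delta> * S" using \<mu> t by (intro mult_mono) auto
        finally show "norm (cis (- ((\<mu> - \<mu>0) * (t - a))) - 1) \<le> \<delta> * S" .
      qed (use B in auto)
      also have "\<dots> = \<epsilon>/(3 * S) * S" using B S(1) by (simp add: \<delta>_def)
      finally show "norm (\<phi> t * cis (- (\<mu> * t)) - w * (\<phi> t * cis (- (\<mu>0 * t)))) \<le> \<epsilon>/(3 * S) * S" .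
    qed (use S(1) in \<open>auto intro!: continuous_intros continuous_on_subset[OF cont]\<close>)
    also have "\<dots> = \<epsilon>/3 * S" using S(1) by simp
    finally have "norm (integral {a..a + S} (\<lambda>t. \<phi> t * cis (- (\<mu> * t)))) \<le> \<epsilon>/3 * S + \<epsilon>/3 * S"
      unfolding eq using S(2)[of S a] by (intro norm_triangle_le add_mono) (auto simp: norm_mult w_def)
    then show ?thesis by (simp add: mult_ac)
  qed
  have "norm (integral {a..a + T} (\<lambda>t. \<phi> t * cis (- (\<mu> * t)))) \<le> \<epsilon> * T"
    if \<mu>: "\<bar>\<mu> - \<mu>0\<bar> < \<delta>" and T: "T \<ge> T0" for \<mu> T a
  proof -
    have T0: "T0 > 0" using B S e by (simp add: T0_def)
    define n where "n = nat \<lfloor>T / S\<rfloor>"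
    have "real n = of_int \<lfloor>T / S\<rfloor>" using T T0 S(1) by (simp add: n_def)
    then have "real n \<le> T / S" "T / S < real n + 1" by linarith+
    then have n: "real n * S \<le> T" "T - real n * S \<le> S" using S(1) by (simp_all add: field_simps)
    have "norm (integral {a..a + real n * S} (\<lambda>t. \<phi> t * cis (- (\<mu> * t)))) \<le> real n * (2 * \<epsilon>/3 * S)"
      by (intro norm_integral_multiple_le c S(1) block \<mu>)
    also have "\<dots> \<le> 2 * \<epsilon>/3 * T" using mult_left_mono[OF n(1), of "2 * \<epsilon>/3"] e by (simp add: mult_ac)
    finally have 1: "norm (integral {a..a + real n * S} (\<lambda>t. \<phi> t * cis (- (\<mu> * t)))) \<le> 2 * \<epsilon>/3 * T" .
    have "norm (integral {a..a + T} (\<lambda>t. \<phi> t * cis (- (\<mu> * t))) - integral {a..a + real n * S} (\<lambda>t. \<phi> t * cis (- (\<mu> * t))))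
       \<le> B * (\<bar>a - a\<bar> + \<bar>(a + T) - (a + real n * S)\<bar>)"
      using S(1) T T0 B by (intro norm_integral_diff_le c) (auto simp: norm_mult)
    also have "\<dots> \<le> B * S" using n B by (intro mult_left_mono) auto
    also have "\<dots> \<le> \<epsilon>/3 * T" using T e by (simp add: T0_def field_simps)
    finally have "norm (integral {a..a + T} (\<lambda>t. \<phi> t * cis (- (\<mu> * t)))) \<le> 2 * \<epsilon>/3 * T + \<epsilon>/3 * T"
      using 1 norm_triangle_sub[of "integral {a..a + T} (\<lambda>t. \<phi> t * cis (- (\<mu> * t)))" "integral {a..a + real n * S} (\<lambda>t. \<phi> t * cis (- (\<mu> * t)))"]
      by linarith
    then show ?thesis by (simp add: algebra_simps)
  qed
  moreover have "\<delta> > 0" "T0 > 0" using e B S by (auto simp: \<delta>_def T0_def)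
  ultimately show thesis using that by blast
qed

text \<open>Finitely many of the local neighbourhoods cover the compact range of frequencies, and
  the largest of their thresholds works for all.\<close>

lemma uniform_frequency_bound:
  assumes cont: "continuous_on UNIV \<phi>" and B: "B > 0" "\<And>t. norm (\<phi> t) \<le> B"
    and mean: "\<And>\<mu>. uniform_mean (\<lambda>t. \<phi> t * cis (- (\<mu> * t))) 0" and e: "\<epsilon> > 0"
  obtains T0 where
    "\<And>\<mu> T a. \<bar>\<mu>\<bar> \<le> R \<Longrightarrow> T \<ge> T0 \<Longrightarrow> norm (integral {a..a + T} (\<lambda>t. \<phi> t * cis (- (\<mu> * t)))) \<le> \<epsilon> * T"
proof -
  have "\<exists>\<delta> T0. \<delta> > 0 \<and> (\<forall>\<mu> T a. \<bar>\<mu> - \<mu>0\<bar> < \<delta> \<longrightarrow> T \<ge> T0 \<longrightarrow>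
      norm (integral {a..a + T} (\<lambda>t. \<phi> t * cis (- (\<mu> * t)))) \<le> \<epsilon> * T)" for \<mu>0
    using locally_uniform_frequency_bound[OF cont B mean e, of \<mu>0] by metis
  then obtain \<delta> T where \<delta>: "\<And>m. \<delta> m > 0" and
    T: "\<And>m \<mu> S a. \<bar>\<mu> - m\<bar> < \<delta> m \<Longrightarrow> S \<ge> T m \<Longrightarrow> norm (integral {a..a + S} (\<lambda>t. \<phi> t * cis (- (\<mu> * t)))) \<le> \<epsilon> * S"
    by metis
  have "compact {-R..R}" by simp
  moreover have "{-R..R} \<subseteq> (\<Union>m\<in>UNIV. ball m (\<delta> m))" using centre_in_ball \<delta> by blast
  ultimately obtain D where D: "finite D" "{-R..R} \<subseteq> (\<Union>m\<in>D. ball m (\<delta> m))"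
    using compactE_image[of "{-R..R}" UNIV "\<lambda>m. ball m (\<delta> m)"] by auto
  show thesis
  proof (rule that[of "Max (insert 0 (T ` D))"])
    fix \<mu> S a assume "\<bar>\<mu>\<bar> \<le> R" and S: "S \<ge> Max (insert 0 (T ` D))"
    then have "\<mu> \<in> {-R..R}" by auto
    then obtain m where m: "m \<in> D" "\<mu> \<in> ball m (\<delta> m)" using D by blast
    then have "S \<ge> T m" using S D(1) by auto
    then show "norm (integral {a..a + S} (\<lambda>t. \<phi> t * cis (- (\<mu> * t)))) \<le> \<epsilon> * S"
      using m by (intro T) (auto simp: dist_real_def abs_minus_commute)
  qed
qed

text \<open>Aliasing: samples of mesh \<open>h\<close> see a frequency only through the phase gained
  per step, so it may be replaced by one of modulus at most \<open>pi / h\<close>.\<close>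

lemma cis_power_rescale:
  fixes z :: complex
  assumes "norm z = 1" "h > 0"
  obtains \<mu> where "\<bar>\<mu> * h\<bar> \<le> pi" "\<And>n. z ^ n = cis (- (\<mu> * (real n * h)))"
proof (rule that[of "- Arg z / h"])
  show "\<bar>- Arg z / h * h\<bar> \<le> pi" using assms Arg_bounded[of z] by (simp add: abs_le_iff)
  fix n
  have "z \<noteq> 0" using assms by auto
  then have "cis (Arg z) = z" using assms cis_Arg[of z] by (simp add: sgn_eq)
  then have "z ^ n = cis (real n * Arg z)" by (metis Complex.DeMoivre)
  then show "z ^ n = cis (- (- Arg z / h * (real n * h)))" using assms(2) by (simp add: mult.commute)
qed

text \<open>De la Vallee Poussin's argument. Sample \<open>\<phi>\<close> at \<open>M = 2N\<close> points of mesh \<open>h\<close>. All discrete Fourier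
  coefficients are small compared with \<open>M\<close>, so for each \<open>v\<close> of a finite net the correlations of the sample
  with the translate of \<open>\<phi>\<close> by \<open>v\<close> are small in mean square. But every translate of \<open>\<phi>\<close> is close to
  one in the net, so one of the correlations is at least about the mean of \<open>|\<phi>|\<^sup>2\<close>. The translates
  in the net are cut off at \<open>N\<close>, so that cyclic shifts by \<open>u < N\<close> never wrap around.\<close>
lemma bohr_eq_zero:
  assumes "bohr \<phi>" and mean: "\<And>\<mu>. uniform_mean (\<lambda>t. \<phi> t * cis (- (\<mu> * t))) 0"
  shows "\<phi> t0 = 0"
proof -
  define \<psi> where "\<psi> t = \<phi> t * cnj (\<phi> t)" for t
  have \<psi>: "\<psi> t = of_real ((norm (\<phi> t))\<^sup>2)" for t
    by (simp add: \<psi>_def complex_norm_square[symmetric])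
  have bpsi: "bohr \<psi>" unfolding \<psi>_def by (intro bohr_mult bohr_cnj assms(1))
  obtain m where m: "uniform_mean \<psi> m" using bohr_uniform_mean[OF bpsi] .
  define r where "r = Re m"
  have mr: "norm m \<le> r" unfolding r_def
    by (rule uniform_mean_norm_le[OF m m]) (simp add: \<psi> norm_power)
  have "\<not> r > 0"
  proof
    assume r: "r > 0"
    obtain B where B: "B > 0" "\<And>t. norm (\<phi> t) \<le> B" using bohr_bounded[OF assms(1)] by metis
    \<comment> \<open>In a correlation the other factor is at most \<open>B\<close>, so replacing a
      translate by a net translate costs at most \<open>r/4\<close> per sample.\<close>
    obtain U where U: "finite U" "\<And>u. \<exists>v\<in>U. \<forall>t. norm (\<phi> (t + u) - \<phi> (t + v)) \<le> r / (4 * B)"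
      using bohr_net[OF assms(1), of "r / (4 * B)"] r B by auto
    define k where "k = real (card U)"
    \<comment> \<open>Dictated by the final comparison: \<open>144 * k * (e * B)\<^sup>2\<close>
      equals \<open>r\<^sup>2 / 16\<close> times \<open>k / (4 * (k + 1)\<^sup>2)\<close>, which is
      less than \<open>r\<^sup>2 / 16\<close>. The summand 1 keeps the divisor positive.\<close>
    define e where "e = r / (96 * B * (k + 1))"
    have k: "k \<ge> 0" by (simp add: k_def)
    have e: "e > 0" using r B k by (simp add: e_def add_nonneg_pos)
    obtain h1 where h1: "h1 > 0" "\<And>x y. \<bar>x - y\<bar> \<le> h1 \<Longrightarrow> norm (\<phi> x - \<phi> y) \<le> e"
      using bohr_uniformly_continuous[OF assms(1) e] by metis
    have r4: "r/4 > 0" using r by simp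
    obtain h2 where h2: "h2 > 0" "\<And>x y. \<bar>x - y\<bar> \<le> h2 \<Longrightarrow> norm (\<psi> x - \<psi> y) \<le> r/4"
      using bohr_uniformly_continuous[OF bpsi r4] by metis
    define h where "h = min h1 h2"
    have h: "h > 0" using h1 h2 by (simp add: h_def)
    obtain T1 where T1: "\<And>T a. T \<ge> T1 \<Longrightarrow> norm (integral {a..a + T} \<psi> - of_real T * m) \<le> r/4 * T"
      using uniform_meanE[OF m r4] by metis
    obtain T2 where T2: "\<And>\<mu> T a. \<bar>\<mu>\<bar> \<le> pi / h \<Longrightarrow> T \<ge> T2 \<Longrightarrow> norm (integral {a..a + T} (\<lambda>t. \<phi> t * cis (- (\<mu> * t)))) \<le> e * T"
      using uniform_frequency_bound[OF bohr_continuous[OF assms(1)] B mean e] by metis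
    obtain N0 where N0: "real N0 \<ge> max T1 T2 / h" using real_arch_simple by blast
    define N where "N = Suc N0"
    define M where "M = 2 * N"
    have N: "N > 0" "real N * h \<ge> T1" "real N * h \<ge> T2"
      using N0 h by (auto simp: N_def field_simps intro: order_trans)
    have MN: "real M = 2 * real N" "M > 0" using N by (auto simp: M_def)
    have NT2: "real M * h \<ge> T2"
    proof -
      have "real N * h \<le> real M * h" using h MN by (intro mult_right_mono) auto
      then show ?thesis using N by simp
    qed
    define H where "H n = \<phi> (real (n mod M) * h)" for n
    define g where "g v n = (if n < N then \<phi> (real n * h + v) else 0)" for v n
    define Q where "Q v u = (\<Sum>n<M. H (n + u) * cnj (g v n))" for v u
    \<comment> \<open>After aliasing to a frequency of modulus at most \<open>pi / h\<close>, the
      Riemann sum error and the average of \<open>\<phi>\<close> at that frequency cost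
      \<open>e * (M * h)\<close> each. Division by \<open>h / 3\<close> gives
      \<open>6 * e * M\<close>, and \<open>M = 2 * N\<close>.\<close>
    have dft: "norm (\<Sum>n<M. H n * cis (- (2 * pi * real j * real n / real M))) \<le> 12 * e * real N" for j
    proof -
      obtain \<mu> where \<mu>: "\<bar>\<mu> * h\<bar> \<le> pi" "\<And>n. cis (- (2 * pi * real j / real M)) ^ n = cis (- (\<mu> * (real n * h)))"
        using cis_power_rescale[of "cis (- (2 * pi * real j / real M))" h] h by auto
      have ph: "cis (- (2 * pi * real j * real n / real M)) = cis (- (\<mu> * (0 + real n * h)))" for n
        using \<mu>(2)[of n] by (simp add: Complex.DeMoivre mult_ac)
      have eq: "(\<Sum>n<M. H n * cis (- (2 * pi * real j * real n / real M))) = (\<Sum>n<M. \<phi> (0 + real n * h) * cis (- (\<mu> * (0 + real n * h))))"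
        unfolding ph by (intro sum.cong refl) (simp add: H_def)
      define \<kappa> where "\<kappa> = integral {-(h/2)..h/2} (\<lambda>s. cis (- (\<mu> * s)))"
      define s where "s = (\<Sum>n<M. \<phi> (0 + real n * h) * cis (- (\<mu> * (0 + real n * h))))"
      have 1: "norm (integral {0 - h/2..0 - h/2 + real M * h} (\<lambda>t. \<phi> t * cis (- (\<mu> * t))) - \<kappa> * s) \<le> e * (real M * h)"
        unfolding \<kappa>_def s_def
        by (rule riemann_sum_error) (use h h1 in \<open>auto simp: h_def intro!: bohr_continuous assms(1)\<close>)
      have 2: "norm (integral {0 - h/2..0 - h/2 + real M * h} (\<lambda>t. \<phi> t * cis (- (\<mu> * t)))) \<le> e * (real M * h)"
        using \<mu>(1) h NT2 by (intro T2) (auto simp: abs_mult field_simps)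
      have 3: "norm (\<kappa> * s) \<le> e * (real M * h) + e * (real M * h)"
        using 1 2 norm_triangle_sub[of "\<kappa> * s" "integral {0 - h/2..0 - h/2 + real M * h} (\<lambda>t. \<phi> t * cis (- (\<mu> * t)))"]
        unfolding norm_minus_commute[of "\<kappa> * s"] by linarith
      have "h / 3 * norm s \<le> norm \<kappa> * norm s"
        unfolding \<kappa>_def by (intro mult_right_mono sinc_lower_bound h \<mu>(1)) auto
      also have "\<dots> \<le> h / 3 * (6 * e * real M)" using 3 by (simp add: norm_mult)
      finally have "norm s \<le> 6 * e * real M" using h by simp
      also have "6 * e * real M = 12 * e * real N" using MN by simp
      finally show ?thesis unfolding eq s_def .
    qed
    have g_norm: "(\<Sum>n<M. (norm (g v n))\<^sup>2) \<le> real N * B\<^sup>2" for v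
    proof -
      have "(\<Sum>n<M. (norm (g v n))\<^sup>2) = (\<Sum>n<N. (norm (g v n))\<^sup>2)"
        by (rule sum.mono_neutral_right) (auto simp: g_def M_def)
      also have "\<dots> \<le> (\<Sum>n<N. B\<^sup>2)"
        by (intro sum_mono power_mono) (auto simp: g_def B)
      finally show ?thesis by simp
    qed
    have upper: "(\<Sum>u<N. (norm (Q v u))\<^sup>2) \<le> (12 * e * real N)\<^sup>2 * (real N * B\<^sup>2)" for v
    proof -
      have "(\<Sum>u<N. (norm (Q v u))\<^sup>2) \<le> (\<Sum>u<M. (norm (Q v u))\<^sup>2)"
        by (rule sum_mono2) (auto simp: M_def)
      also have "\<dots> \<le> (12 * e * real N)\<^sup>2 * (\<Sum>n<M. (norm (g v n))\<^sup>2)"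
        unfolding Q_def by (rule cyclic_correlation_bound[OF MN(2)]) (use dft in \<open>auto simp: H_def\<close>)
      also have "\<dots> \<le> (12 * e * real N)\<^sup>2 * (real N * B\<^sup>2)"
        by (intro mult_left_mono g_norm) auto
      finally show ?thesis .
    qed
    have lower: "\<exists>v\<in>U. norm (Q v u) \<ge> real N * (r/4)" if u: "u < N" for u
    \<comment> \<open>Per sample, the Riemann sum error (with \<open>\<mu> = 0\<close>) and the
      deviation from the mean take \<open>r/4\<close> each from \<open>r\<close>, leaving
      \<open>r/2\<close> for the samples of \<open>\<psi>\<close>. The passage to the net translate
      takes another \<open>r/4\<close>.\<close>
    proof -
      define E where "E = (\<Sum>n<N. \<psi> (real u * h + real n * h))"
      have "norm (integral {real u * h - h/2..real u * h - h/2 + real N * h} (\<lambda>t. \<psi> t * cis (- (0 * t)))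
         - integral {-(h/2)..h/2} (\<lambda>s. cis (- (0 * s))) * (\<Sum>n<N. \<psi> (real u * h + real n * h) * cis (- (0 * (real u * h + real n * h)))))
        \<le> r/4 * (real N * h)"
        by (rule riemann_sum_error) (use h h2 in \<open>auto simp: h_def intro!: bohr_continuous bpsi\<close>)
      then have 1: "norm (integral {real u * h - h/2..real u * h - h/2 + real N * h} \<psi> - of_real h * E) \<le> r/4 * (real N * h)"
        using h by (simp add: E_def scaleR_conv_of_real)
      have 2: "norm (integral {real u * h - h/2..real u * h - h/2 + real N * h} \<psi> - of_real (real N * h) * m) \<le> r/4 * (real N * h)"
        by (rule T1) (rule N)
      have "norm (of_real (real N * h) * m - of_real h * E) \<le> r/4 * (real N * h) + r/4 * (real N * h)"
        using norm_triangle_mono[OF 1 2] norm_triangle_ineq4[of "integral {real u * h - h/2..real u * h - h/2 + real N * h} \<psi> - of_real h * E" "integral {real u * h - h/2..real u * h - h/2 + real N * h} \<psi> - of_real (real N * h) * m"] 1 2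
        by (simp add: algebra_simps)
      then have "\<bar>Re (of_real (real N * h) * m - of_real h * E)\<bar> \<le> r/2 * (real N * h)"
        using abs_Re_le_cmod[of "of_real (real N * h) * m - of_real h * E"] by linarith
      from abs_le_D1[OF this] have "h * Re E \<ge> h * (real N * (r/2))" by (simp add: r_def algebra_simps)
      then have E: "Re E \<ge> real N * (r/2)" using h by simp
      obtain v where v: "v \<in> U" "\<And>t. norm (\<phi> (t + real u * h) - \<phi> (t + v)) \<le> r / (4 * B)"
        using U(2)[of "real u * h"] by blast
      have Q: "Q v u = (\<Sum>n<N. \<phi> (real n * h + real u * h) * cnj (\<phi> (real n * h + v)))"
      proof -
        have "Q v u = (\<Sum>n<N. H (n + u) * cnj (g v n))"
          unfolding Q_def by (rule sum.mono_neutral_right) (auto simp: g_def M_def)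
        also have "\<dots> = (\<Sum>n<N. \<phi> (real n * h + real u * h) * cnj (\<phi> (real n * h + v)))"
          using u by (intro sum.cong refl) (auto simp: H_def g_def M_def algebra_simps)
        finally show ?thesis .
      qed
      have "E - Q v u = (\<Sum>n<N. \<phi> (real n * h + real u * h) * cnj (\<phi> (real n * h + real u * h) - \<phi> (real n * h + v)))"
        unfolding E_def Q \<psi>_def sum_subtractf[symmetric] by (intro sum.cong refl) (simp add: algebra_simps)
      also have "norm \<dots> \<le> (\<Sum>n<N. B * (r / (4 * B)))"
      proof (rule sum_norm_le)
        fix n
        show "norm (\<phi> (real n * h + real u * h) * cnj (\<phi> (real n * h + real u * h) - \<phi> (real n * h + v))) \<le> B * (r / (4 * B))"
          unfolding norm_mult complex_mod_cnj by (intro mult_mono B v(2)) (use B in auto)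
      qed
      finally have "norm (E - Q v u) \<le> real N * (r/4)" using B by simp
      moreover have "Re E \<le> norm E" by (rule complex_Re_le_cmod)
      ultimately have "norm (Q v u) \<ge> real N * (r/4)"
        using E norm_triangle_sub[of E "Q v u"] by (simp add: algebra_simps)
      then show ?thesis using v(1) by blast
    qed
    \<comment> \<open>Every shift \<open>u < N\<close> is served by some net point, so the double
      sum over shifts and net points is large; summed over shifts first, it is small for each net
      point. Both bounds scale like the cube of \<open>N\<close>, which cancels.\<close>
    have "real N * (real N * (r/4))\<^sup>2 = (\<Sum>u<N. (real N * (r/4))\<^sup>2)" by simp
    also have "\<dots> \<le> (\<Sum>u<N. \<Sum>v\<in>U. (norm (Q v u))\<^sup>2)"
    proof (rule sum_mono)
      fix u assume "u \<in> {..<N}"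
      then obtain v where v: "v \<in> U" "norm (Q v u) \<ge> real N * (r/4)" using lower by blast
      have "(real N * (r/4))\<^sup>2 \<le> (norm (Q v u))\<^sup>2" using v(2) r by (intro power_mono) auto
      also have "\<dots> \<le> (\<Sum>v\<in>U. (norm (Q v u))\<^sup>2)" using v(1) U(1) by (intro member_le_sum) auto
      finally show "(real N * (r/4))\<^sup>2 \<le> (\<Sum>v\<in>U. (norm (Q v u))\<^sup>2)" .
    qed
    also have "\<dots> = (\<Sum>v\<in>U. \<Sum>u<N. (norm (Q v u))\<^sup>2)" by (rule sum.swap)
    also have "\<dots> \<le> (\<Sum>v\<in>U. (12 * e * real N)\<^sup>2 * (real N * B\<^sup>2))" by (intro sum_mono upper)
    also have "\<dots> = k * ((12 * e * real N)\<^sup>2 * (real N * B\<^sup>2))" by (simp add: k_def)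
    finally have "(real N)^3 * (r\<^sup>2 / 16) \<le> (real N)^3 * (k * (144 * e\<^sup>2 * B\<^sup>2))"
      by (simp add: power2_eq_square power3_eq_cube algebra_simps)
    then have "r\<^sup>2 / 16 \<le> k * (144 * (e * B)\<^sup>2)" using N(1) by (simp add: power_mult_distrib)
    also have "e * B = r / (96 * (k + 1))" using B(1) by (simp add: e_def)
    also have "k * (144 * (r / (96 * (k + 1)))\<^sup>2) = r\<^sup>2 / 16 * (k / (4 * (k + 1)\<^sup>2))"
      by (simp add: power_divide power_mult_distrib del: distrib_left_numeral)
    finally have "r\<^sup>2 / 16 * 1 \<le> r\<^sup>2 / 16 * (k / (4 * (k + 1)\<^sup>2))" by simp
    then have "1 \<le> k / (4 * (k + 1)\<^sup>2)" using r by (simp only: mult_le_cancel_left_pos zero_less_power divide_pos_pos zero_less_numeral)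
    moreover have "k < 4 * (k + 1)\<^sup>2" using k by (simp add: power2_eq_square algebra_simps add_pos_nonneg)
    ultimately show False using k by (simp add: divide_simps split: if_splits)
  qed
  then have "m = 0" using mr by (metis norm_le_zero_iff not_less order_trans)
  then have "uniform_mean (\<lambda>t. \<phi> t * cnj (\<phi> t)) 0" using m unfolding \<psi>_def by simp
  then show ?thesis by (rule bohr_energy_zero[OF assms(1)])
qed

section \<open>Almost periodic entire functions\<close>

lemma Complex_add_imaginary: "Complex \<sigma> t + \<i> * of_real \<tau> = Complex \<sigma> (t + \<tau>)"
  by (simp add: complex_eq_iff)

lemma continuous_on_vertical_line:
  assumes "f holomorphic_on UNIV"
  shows "continuous_on S (\<lambda>t. f (Complex \<sigma> t))"
proof (rule continuous_on_compose2[of UNIV f])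
  show "continuous_on UNIV f" using assms by (rule holomorphic_on_imp_continuous_on)
  show "continuous_on S (Complex \<sigma>)"
    unfolding Complex_eq by (intro continuous_intros)
qed auto

lemma almost_periodicE:
  assumes "almost_periodic f" "\<alpha> < \<beta>" "\<epsilon> > 0"
  obtains l where "l > 0"
    "\<And>c. \<exists>\<tau>\<in>{c..c + l}. \<forall>s. \<alpha> \<le> Re s \<and> Re s \<le> \<beta> \<longrightarrow> norm (f (s + \<i> * of_real \<tau>) - f s) \<le> \<epsilon>"
  using assms unfolding almost_periodic_def by meson

text \<open>An almost period for the error 1 moves any point of the strip into a fixed compact
  rectangle of height \<open>l\<close>.\<close>

lemma almost_periodic_bounded_on_strip:
  assumes "almost_periodic f" "\<alpha> < \<beta>"
  obtains B where "B > 0" "\<And>s. \<alpha> \<le> Re s \<Longrightarrow> Re s \<le> \<beta> \<Longrightarrow> norm (f s) \<le> B"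
proof -
  obtain l where l: "l > 0"
    "\<And>c. \<exists>\<tau>\<in>{c..c + l}. \<forall>s. \<alpha> \<le> Re s \<and> Re s \<le> \<beta> \<longrightarrow> norm (f (s + \<i> * of_real \<tau>) - f s) \<le> 1"
    using almost_periodicE[OF assms, of 1] by auto
  have "f holomorphic_on UNIV" using assms(1) by (simp add: almost_periodic_def)
  then have "continuous_on (cbox (Complex \<alpha> 0) (Complex \<beta> l)) f"
    by (meson holomorphic_on_imp_continuous_on holomorphic_on_subset subset_UNIV)
  then have "bounded (f ` cbox (Complex \<alpha> 0) (Complex \<beta> l))"
    by (intro compact_imp_bounded compact_continuous_image compact_cbox)
  then obtain K where K: "\<And>s. s \<in> cbox (Complex \<alpha> 0) (Complex \<beta> l) \<Longrightarrow> norm (f s) \<le> K"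
    unfolding bounded_iff by auto
  show thesis
  proof (rule that[of "\<bar>K\<bar> + 1"])
    fix s assume s: "\<alpha> \<le> Re s" "Re s \<le> \<beta>"
    obtain \<tau> where \<tau>: "\<tau> \<in> {- Im s..- Im s + l}" "norm (f (s + \<i> * of_real \<tau>) - f s) \<le> 1"
      using l(2)[of "- Im s"] s by blast
    have "s + \<i> * of_real \<tau> \<in> cbox (Complex \<alpha> 0) (Complex \<beta> l)"
      using s \<tau>(1) by (auto simp: in_cbox_complex_iff)
    then have "norm (f (s + \<i> * of_real \<tau>)) \<le> K" by (rule K)
    then show "norm (f s) \<le> \<bar>K\<bar> + 1"
      using \<tau>(2) norm_triangle_sub[of "f s" "f (s + \<i> * of_real \<tau>)"] by (simp add: norm_minus_commute)
  qed auto
qed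

text \<open>From almost periods to totally bounded translates: an almost period brings any shift
  \<open>u\<close> into the compact interval \<open>{0..l}\<close>, and there uniform continuity
  allows a finite net of shifts.\<close>

lemma almost_periodic_bohr:
  assumes "almost_periodic f"
  shows "bohr (\<lambda>t. f (Complex \<sigma> t))"
proof -
  define \<phi> where "\<phi> t = f (Complex \<sigma> t)" for t
  have cont: "continuous_on S \<phi>" for S
    unfolding \<phi>_def using assms by (intro continuous_on_vertical_line) (simp add: almost_periodic_def)
  have ap: "\<exists>l>0. \<forall>c. \<exists>\<tau>\<in>{c..c + l}. \<forall>t. norm (\<phi> (t + \<tau>) - \<phi> t) \<le> \<epsilon>" if e: "\<epsilon> > 0" for \<epsilon>
  proof -
    \<comment> \<open>Almost periods are provided for strips of positive width only, so the line is
      enclosed in one.\<close>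
    obtain l where l: "l > 0"
      "\<And>c. \<exists>\<tau>\<in>{c..c + l}. \<forall>s. \<sigma> - 1 \<le> Re s \<and> Re s \<le> \<sigma> + 1 \<longrightarrow> norm (f (s + \<i> * of_real \<tau>) - f s) \<le> \<epsilon>"
      using almost_periodicE[OF assms _ e, of "\<sigma> - 1" "\<sigma> + 1"] by auto
    have "\<exists>\<tau>\<in>{c..c + l}. \<forall>t. norm (\<phi> (t + \<tau>) - \<phi> t) \<le> \<epsilon>" for c
    proof -
      obtain \<tau> where \<tau>: "\<tau> \<in> {c..c + l}"
        "\<And>s. \<sigma> - 1 \<le> Re s \<and> Re s \<le> \<sigma> + 1 \<Longrightarrow> norm (f (s + \<i> * of_real \<tau>) - f s) \<le> \<epsilon>"
        using l(2)[of c] by blast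
      have "norm (\<phi> (t + \<tau>) - \<phi> t) \<le> \<epsilon>" for t
        using \<tau>(2)[of "Complex \<sigma> t"] unfolding \<phi>_def Complex_add_imaginary by simp
      then show ?thesis using \<tau>(1) by blast
    qed
    then show ?thesis using l(1) by blast
  qed
  have uc: "\<exists>\<delta>>0. \<forall>x y. \<bar>x - y\<bar> < \<delta> \<longrightarrow> norm (\<phi> x - \<phi> y) \<le> \<epsilon>" if e: "\<epsilon> > 0" for \<epsilon>
  proof -
    have e3: "\<epsilon>/3 > 0" using e by simp
    obtain l where l: "l > 0" "\<And>c. \<exists>\<tau>\<in>{c..c + l}. \<forall>t. norm (\<phi> (t + \<tau>) - \<phi> t) \<le> \<epsilon>/3"
      using ap[OF e3] by blast
    have "uniformly_continuous_on {0..l+1} \<phi>"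
      by (intro compact_uniformly_continuous cont) auto
    then obtain d where d: "d > 0" "\<And>x y. x \<in> {0..l+1} \<Longrightarrow> y \<in> {0..l+1} \<Longrightarrow> dist y x < d \<Longrightarrow> dist (\<phi> y) (\<phi> x) < \<epsilon>/3"
      unfolding uniformly_continuous_on_def using e3 by metis
    \<comment> \<open>An almost period takes the smaller point into \<open>{0..l}\<close>; since the
      other is less than 1 away, both land in \<open>{0..l+1}\<close>, where the modulus
      \<open>d\<close> is valid.\<close>
    have ordered: "norm (\<phi> x - \<phi> y) \<le> \<epsilon>" if "x \<le> y" "y < x + min d 1" for x y
    proof -
      obtain \<tau> where \<tau>: "\<tau> \<in> {-x..-x + l}" "\<And>t. norm (\<phi> (t + \<tau>) - \<phi> t) \<le> \<epsilon>/3"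
        using l(2)[of "-x"] by blast
      have "y < x + d" "y < x + 1" using that by linarith+
      then have "norm (\<phi> (x + \<tau>) - \<phi> (y + \<tau>)) \<le> \<epsilon>/3"
        using d(2)[of "y + \<tau>" "x + \<tau>"] \<tau>(1) that(1) by (simp add: dist_norm)
      then have "norm ((\<phi> (x + \<tau>) - \<phi> (y + \<tau>)) - (\<phi> (x + \<tau>) - \<phi> x) + (\<phi> (y + \<tau>) - \<phi> y)) \<le> \<epsilon>/3 + \<epsilon>/3 + \<epsilon>/3"
        by (rule norm_triangle_le[OF add_mono[OF norm_triangle_le_diff[OF add_mono[OF _ \<tau>(2)]] \<tau>(2)]])
      then show ?thesis by simp
    qed
    have "norm (\<phi> x - \<phi> y) \<le> \<epsilon>" if "\<bar>x - y\<bar> < min d 1" for x y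
      using ordered[of x y] ordered[of y x] that
      by (cases "x \<le> y") (auto simp: norm_minus_commute abs_if split: if_splits)
    then show ?thesis using d(1) by (intro exI[of _ "min d 1"]) auto
  qed
  have "bohr \<phi>"
    unfolding bohr_def
  proof (intro conjI allI impI cont)
    fix \<epsilon> :: real assume "\<epsilon> > 0"
    then have e: "\<epsilon>/2 > 0" by simp
    obtain l where l: "l > 0" "\<And>c. \<exists>\<tau>\<in>{c..c + l}. \<forall>t. norm (\<phi> (t + \<tau>) - \<phi> t) \<le> \<epsilon>/2"
      using ap[OF e] by blast
    obtain \<delta> where \<delta>: "\<delta> > 0" "\<And>x y. \<bar>x - y\<bar> < \<delta> \<Longrightarrow> norm (\<phi> x - \<phi> y) \<le> \<epsilon>/2"
      using uc[OF e] by blast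
    have "compact {0..l}" by simp
    then have "\<exists>K. finite K \<and> {0..l} \<subseteq> (\<Union>v\<in>K. ball v \<delta>)"
      using \<delta>(1) unfolding compact_eq_totally_bounded by simp
    then obtain K where K: "finite K" "{0..l} \<subseteq> (\<Union>v\<in>K. ball v \<delta>)" by blast
    have "\<exists>v\<in>K. \<forall>t. norm (\<phi> (t + u) - \<phi> (t + v)) \<le> \<epsilon>" for u
    proof -
      obtain \<tau> where \<tau>: "\<tau> \<in> {-u..-u + l}" "\<And>t. norm (\<phi> (t + \<tau>) - \<phi> t) \<le> \<epsilon>/2"
        using l(2)[of "-u"] by blast
      then have "u + \<tau> \<in> {0..l}" by auto
      then obtain v where v: "v \<in> K" "\<bar>(u + \<tau>) - v\<bar> < \<delta>"
        using K(2) by (force simp: dist_real_def abs_minus_commute)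
      have "norm (\<phi> (t + u) - \<phi> (t + v)) \<le> \<epsilon>" for t
      proof -
        have 1: "norm (\<phi> (t + (u + \<tau>)) - \<phi> (t + v)) \<le> \<epsilon>/2" by (rule \<delta>(2)) (use v(2) in simp)
        have 2: "norm (\<phi> (t + u + \<tau>) - \<phi> (t + u)) \<le> \<epsilon>/2" by (rule \<tau>(2))
        have "norm ((\<phi> (t + (u + \<tau>)) - \<phi> (t + v)) - (\<phi> (t + u + \<tau>) - \<phi> (t + u))) \<le> \<epsilon>/2 + \<epsilon>/2"
          by (rule norm_triangle_le_diff[OF add_mono[OF 1 2]])
        then show ?thesis by (simp add: add.assoc)
      qed
      then show ?thesis using v(1) by blast
    qed
    then show "\<exists>U. finite U \<and> (\<forall>u. \<exists>v\<in>U. \<forall>t. norm (\<phi> (t + u) - \<phi> (t + v)) \<le> \<epsilon>)"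
      using K(1) by blast
  qed
  then show ?thesis unfolding \<phi>_def .
qed

lemma uniform_mean_bounded_integral:
  assumes um: "uniform_mean \<phi> m" and K: "\<And>T. T \<ge> 0 \<Longrightarrow> norm (integral {0..T} \<phi>) \<le> K"
  shows "m = 0"
proof (rule ccontr)
  assume "m \<noteq> 0"
  then have e: "norm m / 2 > 0" by simp
  obtain T0 where T0: "T0 > 0" "\<And>T a. T \<ge> T0 \<Longrightarrow> norm (integral {a..a + T} \<phi> - of_real T * m) \<le> norm m / 2 * T"
    using uniform_meanE[OF um e] by metis
  define T where "T = max T0 ((2 * \<bar>K\<bar> + 1) / norm m)"
  have T: "T \<ge> T0" "T > 0" using T0(1) by (auto simp: T_def)
  have "T \<ge> (2 * \<bar>K\<bar> + 1) / norm m" by (simp add: T_def)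
  then have big: "T * norm m \<ge> 2 * \<bar>K\<bar> + 1" using \<open>m \<noteq> 0\<close> by (simp add: field_simps)
  have "norm (of_real T * m) \<le> norm (integral {0..0 + T} \<phi>) + norm (integral {0..0 + T} \<phi> - of_real T * m)"
    by (metis norm_minus_commute norm_triangle_sub)
  also have "\<dots> \<le> K + norm m / 2 * T" using K[of T] T0(2)[of T 0] T by (intro add_mono) auto
  finally have "T * norm m \<le> K + T * norm m / 2" using T(2) by (simp add: norm_mult mult.commute)
  then show False using big by linarith
qed

text \<open>Cauchy's theorem on a long rectangle, stated through a primitive \<open>P\<close> of the
  entire function \<open>g\<close>. Integrals along the two lines differ only by the increments of
  \<open>P\<close> across the two horizontal sides, which stay bounded as the height grows; hence
  the difference of the means is 0.\<close>

lemma fourier_mean_abscissa_independent: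
  assumes ap: "almost_periodic f"
    and m: "uniform_mean (\<lambda>t. f (Complex \<sigma> t) * exp (- of_real \<mu> * Complex \<sigma> t)) m"
    and n: "uniform_mean (\<lambda>t. f (Complex \<sigma>' t) * exp (- of_real \<mu> * Complex \<sigma>' t)) n"
  shows "m = n"
proof -
  define g where "g s = f s * exp (- of_real \<mu> * s)" for s
  define \<alpha> where "\<alpha> = min \<sigma> \<sigma>' - 1"
  define \<beta> where "\<beta> = max \<sigma> \<sigma>' + 1"
  have ab: "\<alpha> < \<beta>" by (simp add: \<alpha>_def \<beta>_def)
  obtain B where B: "B > 0" "\<And>s. \<alpha> \<le> Re s \<Longrightarrow> Re s \<le> \<beta> \<Longrightarrow> norm (f s) \<le> B"
    using almost_periodic_bounded_on_strip[OF ap ab] by metis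
  define C where "C = B * exp (\<bar>\<mu>\<bar> * (\<bar>\<alpha>\<bar> + \<bar>\<beta>\<bar>))"
  have C: "norm (g s) \<le> C" if s: "\<alpha> \<le> Re s" "Re s \<le> \<beta>" for s
  proof -
    have "- (\<mu> * Re s) \<le> \<bar>\<mu>\<bar> * \<bar>Re s\<bar>" by (metis abs_ge_minus_self abs_mult)
    also have "\<dots> \<le> \<bar>\<mu>\<bar> * (\<bar>\<alpha>\<bar> + \<bar>\<beta>\<bar>)" using s by (intro mult_left_mono) auto
    finally show ?thesis unfolding g_def C_def norm_mult
      using B s by (intro mult_mono) auto
  qed
  have holg: "g holomorphic_on UNIV"
    unfolding g_def using ap by (intro holomorphic_intros) (simp add: almost_periodic_def)
  then obtain P where P: "\<And>s. (P has_field_derivative g s) (at s)"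
    using holomorphic_convex_primitive'[of UNIV g] by auto
  have line: "continuous_on S (\<lambda>t. g (Complex x t))" for S x
    by (rule continuous_on_vertical_line[OF holg])
  have ftc: "\<i> * integral {0..T} (\<lambda>t. g (Complex x t)) = P (Complex x T) - P (Complex x 0)" if "T \<ge> 0" for T x
  proof -
    have d: "((\<lambda>t. P (Complex x t)) has_vector_derivative (\<i> * g (Complex x t))) (at t within S)" for t S
    proof -
      have "((\<lambda>t. Complex x t) has_vector_derivative \<i>) (at t within S)"
        unfolding Complex_eq by (auto intro!: derivative_eq_intros)
      from field_vector_diff_chain_within[OF this, of P "g (Complex x t)"] show ?thesis
        using has_field_derivative_at_within[OF P] by (simp add: o_def mult.commute)
    qed
    have "((\<lambda>t. \<i> * g (Complex x t)) has_integral (P (Complex x T) - P (Complex x 0))) {0..T}"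
      using that by (intro fundamental_theorem_of_calculus d)
    then have "integral {0..T} (\<lambda>t. \<i> * g (Complex x t)) = P (Complex x T) - P (Complex x 0)" by (rule integral_unique)
    then show ?thesis by simp
  qed
  define S where "S = {s. \<alpha> \<le> Re s \<and> Re s \<le> \<beta>}"
  have "convex S" unfolding S_def
    by (simp add: Collect_conj_eq convex_Int convex_halfspace_Re_ge convex_halfspace_Re_le)
  then have Pdiff: "norm (P (Complex \<sigma> t) - P (Complex \<sigma>' t)) \<le> C * \<bar>\<sigma> - \<sigma>'\<bar>" for t
  proof -
    have "norm (P (Complex \<sigma> t) - P (Complex \<sigma>' t)) \<le> C * norm (Complex \<sigma> t - Complex \<sigma>' t)"
      using \<open>convex S\<close> has_field_derivative_at_within[OF P] C
      by (rule field_differentiable_bound) (auto simp: S_def \<alpha>_def \<beta>_def)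
    also have "Complex \<sigma> t - Complex \<sigma>' t = of_real (\<sigma> - \<sigma>')" by (simp add: complex_eq_iff)
    finally show ?thesis by (simp only: norm_of_real)
  qed
  have um: "uniform_mean (\<lambda>t. g (Complex \<sigma> t) - g (Complex \<sigma>' t)) (m - n)"
    unfolding g_def by (rule uniform_mean_diff[OF m n])
  have "m - n = 0"
  proof (rule uniform_mean_bounded_integral[OF um])
    fix T :: real assume T: "T \<ge> 0"
    have "\<i> * integral {0..T} (\<lambda>t. g (Complex \<sigma> t) - g (Complex \<sigma>' t)) =
       \<i> * integral {0..T} (\<lambda>t. g (Complex \<sigma> t)) - \<i> * integral {0..T} (\<lambda>t. g (Complex \<sigma>' t))"
      by (subst Henstock_Kurzweil_Integration.integral_diff)
         (auto intro!: integrable_continuous_interval line simp: algebra_simps)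
    also have "\<dots> = (P (Complex \<sigma> T) - P (Complex \<sigma>' T)) - (P (Complex \<sigma> 0) - P (Complex \<sigma>' 0))"
      unfolding ftc[OF T] by simp
    also have "norm \<dots> \<le> C * \<bar>\<sigma> - \<sigma>'\<bar> + C * \<bar>\<sigma> - \<sigma>'\<bar>"
      by (rule norm_triangle_le_diff[OF add_mono[OF Pdiff Pdiff]])
    finally show "norm (integral {0..T} (\<lambda>t. g (Complex \<sigma> t) - g (Complex \<sigma>' t))) \<le> C * \<bar>\<sigma> - \<sigma>'\<bar> + C * \<bar>\<sigma> - \<sigma>'\<bar>"
      by (simp add: norm_mult)
  qed
  then show ?thesis by simp
qed

lemma has_fourier_coeff_unique:
  assumes "has_fourier_coeff f \<mu> a" "has_fourier_coeff f \<mu> b"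
  shows "a = b"
  by (rule tendsto_unique[OF trivial_limit_at_top_linorder
        assms(1)[unfolded has_fourier_coeff_def, THEN spec[of _ 0]]
        assms(2)[unfolded has_fourier_coeff_def, THEN spec[of _ 0]]])

text \<open>The symmetric interval is the window of length \<open>2 * T\<close> with left end
  \<open>-T\<close>, so uniformity in the left end includes the limit by which Fourier coefficients
  are defined.\<close>

lemma has_fourier_coeff_uniform_mean:
  assumes "\<And>\<sigma>. uniform_mean (\<lambda>t. f (Complex \<sigma> t) * exp (- of_real \<mu> * Complex \<sigma> t)) a"
  shows "has_fourier_coeff f \<mu> a"
  unfolding has_fourier_coeff_def
proof (intro allI tendstoI)
  fix \<sigma> e :: real assume "e > 0"
  then have e: "e/2 > 0" by simp
  define g where "g t = f (Complex \<sigma> t) * exp (- of_real \<mu> * Complex \<sigma> t)" for t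
  have "uniform_mean g a" using assms unfolding g_def .
  from uniform_meanE[OF this e] obtain T0 where T0: "T0 > 0"
    "\<And>T b. T \<ge> T0 \<Longrightarrow> norm (integral {b..b + T} g - of_real T * a) \<le> e/2 * T" by metis
  have "dist (1 / (2 * of_real T) * integral {-T..T} g) a < e" if T: "T \<ge> T0" for T
  proof -
    have "T > 0" using T T0 by simp
    have "norm (integral {-T..-T + 2 * T} g - of_real (2 * T) * a) \<le> e/2 * (2 * T)"
      using T \<open>T > 0\<close> by (intro T0(2)) auto
    then have 1: "norm (integral {-T..T} g - of_real (2 * T) * a) \<le> e * T" by simp
    have "1 / (2 * of_real T) * integral {-T..T} g - a = (integral {-T..T} g - of_real (2 * T) * a) / of_real (2 * T)"
      using \<open>T > 0\<close> by (simp add: field_simps)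
    then have "dist (1 / (2 * of_real T) * integral {-T..T} g) a = norm (integral {-T..T} g - of_real (2 * T) * a) / (2 * T)"
      using \<open>T > 0\<close> by (simp add: dist_norm norm_divide norm_mult)
    also have "\<dots> \<le> e * T / (2 * T)" using 1 \<open>T > 0\<close> by (intro divide_right_mono) auto
    also have "\<dots> < e" using \<open>T > 0\<close> \<open>e > 0\<close> by simp
    finally show ?thesis .
  qed
  then show "\<forall>\<^sub>F T in at_top. dist (1 / (2 * of_real T) * integral {- T..T} (\<lambda>t. f (Complex \<sigma> t) * exp (- of_real \<mu> * Complex \<sigma> t))) a < e"
    unfolding g_def eventually_at_top_linorder by blast
qed

lemma exp_Complex: "exp (of_real \<mu> * Complex \<sigma> t) = of_real (exp (\<mu> * \<sigma>)) * cis (\<mu> * t)"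
  by (simp add: exp_eq_polar)

text \<open>A single \<open>a\<close> serves all lines because the mean does not depend on the
  abscissa. The factor \<open>exp (\<mu> * \<sigma>)\<close> turns it into the ordinary Fourier
  coefficient on the line with real part \<open>\<sigma>\<close>, the form in which the Riesz
  product bound and the uniqueness theorem are applied.\<close>

lemma almost_periodic_fourier_coefficients:
  assumes ap: "almost_periodic f"
  obtains a where "\<And>\<mu> \<sigma>. uniform_mean (\<lambda>t. f (Complex \<sigma> t) * cis (- (\<mu> * t))) (a \<mu> * of_real (exp (\<mu> * \<sigma>)))"
    "fourier_exponents f = {\<mu>. a \<mu> \<noteq> 0}"
proof -
  have "\<exists>a. \<forall>\<sigma>. uniform_mean (\<lambda>t. f (Complex \<sigma> t) * exp (- of_real \<mu> * Complex \<sigma> t)) a" for \<mu>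
  proof -
    have "\<exists>m. uniform_mean (\<lambda>t. f (Complex \<sigma> t) * exp (- of_real \<mu> * Complex \<sigma> t)) m" for \<sigma>
    proof -
      have "bohr (\<lambda>t. of_real (exp (- \<mu> * \<sigma>)) * (f (Complex \<sigma> t) * cis (- \<mu> * t)))"
        by (intro bohr_cmult bohr_mult bohr_cis almost_periodic_bohr ap)
      moreover have "(\<lambda>t. of_real (exp (- \<mu> * \<sigma>)) * (f (Complex \<sigma> t) * cis (- \<mu> * t)))
          = (\<lambda>t. f (Complex \<sigma> t) * exp (- of_real \<mu> * Complex \<sigma> t))"
        using exp_Complex[of "-\<mu>" \<sigma>] by (simp add: mult_ac)
      ultimately show ?thesis using bohr_uniform_mean by metis
    qed
    then obtain m where m: "\<And>\<sigma>. uniform_mean (\<lambda>t. f (Complex \<sigma> t) * exp (- of_real \<mu> * Complex \<sigma> t)) (m \<sigma>)"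
      by metis
    have "m \<sigma> = m 0" for \<sigma> by (rule fourier_mean_abscissa_independent[OF ap m m])
    then show ?thesis using m by metis
  qed
  then obtain a where a: "\<And>\<mu> \<sigma>. uniform_mean (\<lambda>t. f (Complex \<sigma> t) * exp (- of_real \<mu> * Complex \<sigma> t)) (a \<mu>)"
    by metis
  have coeff: "has_fourier_coeff f \<mu> (a \<mu>)" for \<mu> by (rule has_fourier_coeff_uniform_mean) (rule a)
  show thesis
  proof (rule that[of a])
    fix \<mu> \<sigma>
    have "uniform_mean (\<lambda>t. of_real (exp (\<mu> * \<sigma>)) * (f (Complex \<sigma> t) * exp (- of_real \<mu> * Complex \<sigma> t))) (of_real (exp (\<mu> * \<sigma>)) * a \<mu>)"
      by (rule uniform_mean_cmult[OF a])
    moreover have "of_real (exp (\<mu> * \<sigma>)) * (f (Complex \<sigma> t) * exp (- of_real \<mu> * Complex \<sigma> t)) = f (Complex \<sigma> t) * cis (- (\<mu> * t))" for t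
    proof -
      have "exp (- of_real \<mu> * Complex \<sigma> t) = of_real (exp (- \<mu> * \<sigma>)) * cis (- \<mu> * t)"
        using exp_Complex[of "-\<mu>" \<sigma> t] by simp
      moreover have "complex_of_real (exp (\<mu> * \<sigma>)) * of_real (exp (- \<mu> * \<sigma>)) = 1"
        unfolding of_real_mult[symmetric] exp_add[symmetric] by simp
      ultimately show ?thesis by (simp del: of_real_exp of_real_mult)
    qed
    ultimately show "uniform_mean (\<lambda>t. f (Complex \<sigma> t) * cis (- (\<mu> * t))) (a \<mu> * of_real (exp (\<mu> * \<sigma>)))"
      by (simp only: mult.commute[of "a \<mu>"])
  next
    show "fourier_exponents f = {\<mu>. a \<mu> \<noteq> 0}"
      unfolding fourier_exponents_def using coeff has_fourier_coeff_unique by blast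
  qed
qed

section \<open>Absolutely convergent exponential series\<close>

text \<open>Unordered summation avoids an enumeration of the exponents. As the infinite sum is 0 by
  default when it diverges, absolute summability at every abscissa is assumed separately wherever
  the series is used.\<close>

definition exp_series :: "real set \<Rightarrow> (real \<Rightarrow> complex) \<Rightarrow> complex \<Rightarrow> complex" where
  "exp_series \<Lambda> b s = (\<Sum>\<^sub>\<infinity>l\<in>\<Lambda>. b l * exp (of_real l * s))"

lemma summable_tail_small:
  fixes h :: "'a \<Rightarrow> real"
  assumes "h summable_on A" "\<epsilon> > 0"
  obtains J where "finite J" "J \<subseteq> A" "infsum h (A - J) \<le> \<epsilon>"
proof -
  have "(h has_sum infsum h A) A" using assms(1) by (rule has_sum_infsum)
  then have "\<forall>\<^sub>F X in finite_subsets_at_top A. dist (sum h X) (infsum h A) < \<epsilon>"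
    unfolding has_sum_def using assms(2) tendstoD by blast
  then obtain J where J: "finite J" "J \<subseteq> A" "dist (sum h J) (infsum h A) < \<epsilon>"
    unfolding eventually_finite_subsets_at_top by blast
  have "infsum h (A - J) = infsum h A - infsum h J"
    using J assms(1) by (intro infsum_Diff) auto
  then have "infsum h (A - J) \<le> \<epsilon>" using J by (simp add: dist_real_def)
  then show thesis using J that by blast
qed

lemma finite_large_terms:
  fixes h :: "'a \<Rightarrow> real"
  assumes "h summable_on A" "\<And>x. x \<in> A \<Longrightarrow> h x \<ge> 0" "\<epsilon> > 0"
  shows "finite {x \<in> A. h x \<ge> \<epsilon>}"
proof -
  obtain J where J: "finite J" "J \<subseteq> A" "infsum h (A - J) \<le> \<epsilon>/2"
    using summable_tail_small[OF assms(1), of "\<epsilon>/2"] assms(3) by auto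
  have "x \<in> J" if x: "x \<in> A" "h x \<ge> \<epsilon>" for x
  proof (rule ccontr)
    assume "x \<notin> J"
    have s: "h summable_on (A - J)" using assms(1) by (rule summable_on_subset_banach) auto
    have "sum h {x} \<le> infsum h (A - J)"
      using x \<open>x \<notin> J\<close> assms(2) by (intro finite_sum_le_infsum[OF s]) auto
    then show False using J(3) x(2) assms(3) by simp
  qed
  then have "{x \<in> A. h x \<ge> \<epsilon>} \<subseteq> J" by blast
  then show ?thesis using J(1) by (rule finite_subset)
qed

lemma norm_exp_real_mult:
  fixes b s :: complex
  shows "norm (b * exp (of_real l * s)) = norm b * exp (l * Re s)"
  by (simp add: norm_mult)

lemma exp_series_summable:
  fixes b :: "real \<Rightarrow> complex"
  assumes "\<And>\<sigma>. (\<lambda>l. norm (b l) * exp (l * \<sigma>)) summable_on \<Lambda>"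
  shows "(\<lambda>l. norm (b l * exp (of_real l * s))) summable_on \<Lambda>"
  unfolding norm_exp_real_mult by (rule assms)

text \<open>The modulus of a term depends only on the abscissa, so one finite set of exponents
  serves a whole vertical line.\<close>

lemma exp_series_partial_sum:
  assumes sm: "\<And>\<sigma>. (\<lambda>l. norm (b l) * exp (l * \<sigma>)) summable_on \<Lambda>" and "\<epsilon> > 0"
  obtains J where "finite J" "J \<subseteq> \<Lambda>"
    "\<And>t. norm (exp_series \<Lambda> b (Complex \<sigma> t) - (\<Sum>l\<in>J. b l * exp (of_real l * Complex \<sigma> t))) \<le> \<epsilon>"
    "(\<Sum>\<^sub>\<infinity>l\<in>\<Lambda> - J. norm (b l) * exp (l * \<sigma>)) \<le> \<epsilon>"
proof -
  obtain J where J: "finite J" "J \<subseteq> \<Lambda>" "(\<Sum>\<^sub>\<infinity>l\<in>\<Lambda> - J. norm (b l) * exp (l * \<sigma>)) \<le> \<epsilon>"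
    using summable_tail_small[OF sm assms(2)] by metis
  have "norm (exp_series \<Lambda> b (Complex \<sigma> t) - (\<Sum>l\<in>J. b l * exp (of_real l * Complex \<sigma> t))) \<le> \<epsilon>" for t
  proof -
    define g where "g l = b l * exp (of_real l * Complex \<sigma> t)" for l
    have abs: "(\<lambda>l. norm (g l)) summable_on \<Lambda>" unfolding g_def by (rule exp_series_summable[OF sm])
    then have s: "g summable_on \<Lambda>" by (rule abs_summable_summable)
    have "infsum g (\<Lambda> - J) = infsum g \<Lambda> - infsum g J"
      using s J by (intro infsum_Diff) auto
    then have "infsum g \<Lambda> - sum g J = infsum g (\<Lambda> - J)" using J by simp
    also have "norm \<dots> \<le> (\<Sum>\<^sub>\<infinity>l\<in>\<Lambda> - J. norm (g l))"
      using abs by (intro norm_infsum_bound summable_on_subset_banach[OF abs]) auto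
    also have "\<dots> \<le> \<epsilon>" using J(3) unfolding g_def norm_exp_real_mult by simp
    finally show ?thesis unfolding exp_series_def g_def .
  qed
  then show thesis using J that by blast
qed

lemma exp_series_bohr:
  assumes sm: "\<And>\<sigma>. (\<lambda>l. norm (b l) * exp (l * \<sigma>)) summable_on \<Lambda>"
  shows "bohr (\<lambda>t. exp_series \<Lambda> b (Complex \<sigma> t))"
proof (rule bohr_uniform_limit)
  fix \<epsilon> :: real assume "\<epsilon> > 0"
  then obtain J where J: "finite J"
    "\<And>t. norm (exp_series \<Lambda> b (Complex \<sigma> t) - (\<Sum>l\<in>J. b l * exp (of_real l * Complex \<sigma> t))) \<le> \<epsilon>"
    using exp_series_partial_sum[OF sm] by metis
  have "bohr (\<lambda>t. \<Sum>l\<in>J. b l * exp (of_real l * Complex \<sigma> t))"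
    unfolding exp_Complex by (intro bohr_sum bohr_cmult bohr_cis)
  then show "\<exists>\<psi>. bohr \<psi> \<and> (\<forall>t. norm (exp_series \<Lambda> b (Complex \<sigma> t) - \<psi> t) \<le> \<epsilon>)"
    using J(2) by blast
qed

text \<open>Finite partial sums have the expected means by orthogonality of the exponentials on a
  line, and they approximate the series uniformly there.\<close>

lemma exp_series_uniform_mean:
  assumes sm: "\<And>\<sigma>. (\<lambda>l. norm (b l) * exp (l * \<sigma>)) summable_on \<Lambda>"
  shows "uniform_mean (\<lambda>t. exp_series \<Lambda> b (Complex \<sigma> t) * cis (- (\<mu> * t)))
           (if \<mu> \<in> \<Lambda> then b \<mu> * of_real (exp (\<mu> * \<sigma>)) else 0)"
proof (rule uniform_mean_uniform_limit)
  show "continuous_on UNIV (\<lambda>t. exp_series \<Lambda> b (Complex \<sigma> t) * cis (- (\<mu> * t)))"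
    by (intro continuous_intros bohr_continuous exp_series_bohr sm)
  fix \<epsilon> :: real assume e: "\<epsilon> > 0"
  obtain J where J: "finite J" "J \<subseteq> \<Lambda>"
    "\<And>t. norm (exp_series \<Lambda> b (Complex \<sigma> t) - (\<Sum>l\<in>J. b l * exp (of_real l * Complex \<sigma> t))) \<le> \<epsilon>"
    "(\<Sum>\<^sub>\<infinity>l\<in>\<Lambda> - J. norm (b l) * exp (l * \<sigma>)) \<le> \<epsilon>"
    using exp_series_partial_sum[of b \<Lambda> \<epsilon> \<sigma>, OF sm e] by blast
  define c where "c l = b l * of_real (exp (l * \<sigma>))" for l
  define n where "n = (\<Sum>l\<in>J. c l * (if l = \<mu> then 1 else 0))"
  define \<psi> where "\<psi> t = (\<Sum>l\<in>J. b l * exp (of_real l * Complex \<sigma> t)) * cis (- (\<mu> * t))" for t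
  have "uniform_mean (\<lambda>t. \<Sum>l\<in>J. c l * cis ((l - \<mu>) * t)) n"
    unfolding n_def
  proof (intro uniform_mean_sum uniform_mean_cmult)
    show "uniform_mean (\<lambda>t. cis ((l - \<mu>) * t)) (if l = \<mu> then 1 else 0)" for l
      using uniform_mean_cis[of "l - \<mu>"] uniform_mean_const[of 1] by auto
  qed
  moreover have "(\<Sum>l\<in>J. c l * cis ((l - \<mu>) * t)) = \<psi> t" for t
  proof -
    have "cis ((l - \<mu>) * t) = cis (l * t) * cis (- (\<mu> * t))" for l by (simp add: cis_mult algebra_simps)
    then show ?thesis unfolding \<psi>_def sum_distrib_right exp_Complex c_def by (simp add: mult_ac)
  qed
  ultimately have 1: "uniform_mean \<psi> n" by simp
  have 2: "norm (exp_series \<Lambda> b (Complex \<sigma> t) * cis (- (\<mu> * t)) - \<psi> t) \<le> \<epsilon>" for t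
    using J(3)[of t] unfolding \<psi>_def left_diff_distrib[symmetric] norm_mult by simp
  have 3: "norm ((if \<mu> \<in> \<Lambda> then b \<mu> * of_real (exp (\<mu> * \<sigma>)) else 0) - n) \<le> \<epsilon>"
  proof (cases "\<mu> \<in> \<Lambda> - J")
    \<comment> \<open>An exponent missed by the partial sum is itself part of the small tail, so its
      coefficient is within \<open>\<epsilon>\<close> of the mean 0.\<close>
    case True
    have "n = 0" unfolding n_def using True by (intro sum.neutral) auto
    have "sum (\<lambda>l. norm (b l) * exp (l * \<sigma>)) {\<mu>} \<le> (\<Sum>\<^sub>\<infinity>l\<in>\<Lambda> - J. norm (b l) * exp (l * \<sigma>))"
      using True by (intro finite_sum_le_infsum[OF summable_on_subset_banach[OF sm]]) auto
    then show ?thesis using True J(4) \<open>n = 0\<close> by (simp add: norm_mult)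
  next
    case False
    then have "n = (if \<mu> \<in> \<Lambda> then c \<mu> else 0)"
      using J(1,2) by (auto simp: n_def if_distrib[of "\<lambda>x. _ * x"] sum.delta cong: if_cong)
    then show ?thesis using e by (simp add: c_def)
  qed
  show "\<exists>\<psi> n. uniform_mean \<psi> n \<and> (\<forall>t. norm (exp_series \<Lambda> b (Complex \<sigma> t) * cis (- (\<mu> * t)) - \<psi> t) \<le> \<epsilon>)
     \<and> norm ((if \<mu> \<in> \<Lambda> then b \<mu> * of_real (exp (\<mu> * \<sigma>)) else 0) - n) \<le> \<epsilon>"
    using 1 2 3 by blast
qed

lemma almost_periodic_exp_series:
  assumes ap: "almost_periodic f" and ind: "rat_independent (fourier_exponents f)"
  obtains a where "\<And>l. l \<in> fourier_exponents f \<Longrightarrow> a l \<noteq> 0"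
    "\<And>\<sigma>. (\<lambda>l. norm (a l) * exp (l * \<sigma>)) summable_on fourier_exponents f"
    "\<And>s. f s = exp_series (fourier_exponents f) a s"
proof -
  obtain a where a: "\<And>\<mu> \<sigma>. uniform_mean (\<lambda>t. f (Complex \<sigma> t) * cis (- (\<mu> * t))) (a \<mu> * of_real (exp (\<mu> * \<sigma>)))"
    and \<Lambda>: "fourier_exponents f = {\<mu>. a \<mu> \<noteq> 0}"
    using almost_periodic_fourier_coefficients[OF ap] by metis
  have sm: "(\<lambda>l. norm (a l) * exp (l * \<sigma>)) summable_on fourier_exponents f" for \<sigma>
  proof -
    obtain B where B: "\<And>t. norm (f (Complex \<sigma> t)) \<le> B"
      using bohr_bounded[OF almost_periodic_bohr[OF ap]] by metis
    have "(\<Sum>l\<in>F. norm (a l) * exp (l * \<sigma>)) \<le> 2 * B" if F: "finite F" "F \<subseteq> fourier_exponents f" for F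
      using sum_norm_coefficients_le[OF ind a _ F B] \<Lambda> by (simp add: norm_mult)
    then show ?thesis
      by (intro nonneg_bdd_above_summable_on bdd_aboveI[of _ "2 * B"]) auto
  qed
  have "f s = exp_series (fourier_exponents f) a s" for s
  proof -
    have "f (Complex (Re s) (Im s)) - exp_series (fourier_exponents f) a (Complex (Re s) (Im s)) = 0"
    proof (rule bohr_eq_zero)
      show "bohr (\<lambda>t. f (Complex (Re s) t) - exp_series (fourier_exponents f) a (Complex (Re s) t))"
        by (intro bohr_diff almost_periodic_bohr[OF ap] exp_series_bohr sm)
      fix \<mu>
      have "uniform_mean (\<lambda>t. f (Complex (Re s) t) * cis (- (\<mu> * t)) - exp_series (fourier_exponents f) a (Complex (Re s) t) * cis (- (\<mu> * t)))
         (a \<mu> * of_real (exp (\<mu> * Re s)) - (if \<mu> \<in> fourier_exponents f then a \<mu> * of_real (exp (\<mu> * Re s)) else 0))"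
        by (intro uniform_mean_diff a exp_series_uniform_mean sm)
      moreover have "a \<mu> * of_real (exp (\<mu> * Re s)) - (if \<mu> \<in> fourier_exponents f then a \<mu> * of_real (exp (\<mu> * Re s)) else 0) = 0"
        using \<Lambda> by auto
      ultimately show "uniform_mean (\<lambda>t. (f (Complex (Re s) t) - exp_series (fourier_exponents f) a (Complex (Re s) t)) * cis (- (\<mu> * t))) 0"
        by (simp add: left_diff_distrib)
    qed
    then show ?thesis by simp
  qed
  then show thesis using that[of a] sm \<Lambda> by blast
qed

section \<open>Terms tied for the largest modulus, and phases that make the series vanish\<close>

lemma exists_dominant_tie:
  assumes sm: "\<And>\<sigma>. (\<lambda>l. norm (a l) * exp (l * \<sigma>)) summable_on \<Lambda>"
    and nz: "\<And>l. l \<in> \<Lambda> \<Longrightarrow> a l \<noteq> (0::complex)" and two: "l1 \<in> \<Lambda>" "l2 \<in> \<Lambda>" "l1 \<noteq> l2"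
  obtains \<sigma> p q where "p \<in> \<Lambda>" "q \<in> \<Lambda>" "p \<noteq> q" "norm (a p) * exp (p * \<sigma>) = norm (a q) * exp (q * \<sigma>)"
    "\<And>l. l \<in> \<Lambda> \<Longrightarrow> norm (a l) * exp (l * \<sigma>) \<le> norm (a p) * exp (p * \<sigma>)"
proof -
  define r where "r l \<sigma> = norm (a l) * exp (l * \<sigma>)" for l \<sigma>
  have pos: "r l \<sigma> > 0" if "l \<in> \<Lambda>" for l \<sigma> using nz[OF that] by (simp add: r_def)
  have fin: "finite {l \<in> \<Lambda>. r l \<sigma> \<ge> \<epsilon>}" if "\<epsilon> > 0" for \<sigma> \<epsilon>
    using finite_large_terms[OF sm _ that] by (simp add: r_def)
  have cont: "continuous_on S (r l)" for S l
    unfolding r_def by (intro continuous_intros)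
  \<comment> \<open>By summability only finitely many terms reach the size of the term
    \<open>l1\<close> at abscissa 0, so a largest term \<open>p\<close> exists there.\<close>
  define D where "D = {l \<in> \<Lambda>. r l 0 \<ge> r l1 0}"
  have D: "finite D" "l1 \<in> D" using fin[OF pos[OF two(1)]] two by (auto simp: D_def)
  have "Max ((\<lambda>l. r l 0) ` D) \<in> (\<lambda>l. r l 0) ` D" using D by (intro Max_in) auto
  then obtain p where "p \<in> D" "r p 0 = Max ((\<lambda>l. r l 0) ` D)" by auto
  then have p: "p \<in> D" "\<And>l. l \<in> D \<Longrightarrow> r l 0 \<le> r p 0" using D by auto
  have p\<Lambda>: "p \<in> \<Lambda>" using p by (simp add: D_def)
  define A where "A = (\<Inter>l\<in>\<Lambda>. {\<sigma>. r l \<sigma> \<le> r p \<sigma>})"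
  have "closed A"
    unfolding A_def by (intro closed_INT ballI closed_Collect_le cont)
  have "0 \<in> A"
    unfolding A_def using p D(2) by (fastforce simp: D_def)
  have "A \<noteq> UNIV"
  proof
    assume U: "A = UNIV"
    obtain q where q: "q \<in> \<Lambda>" "q \<noteq> p" using two by metis
    \<comment> \<open>At this abscissa the term \<open>q\<close> is exactly \<open>exp 1\<close>
      times the term \<open>p\<close>; whether it lies left or right depends on the sign of
      \<open>q - p\<close>.\<close>
    define \<sigma> where "\<sigma> = (ln (norm (a p) / norm (a q)) + 1) / (q - p)"
    have "(q - p) * \<sigma> = ln (norm (a p) / norm (a q)) + 1" using q by (simp add: \<sigma>_def)
    then have "exp (q * \<sigma> - p * \<sigma>) = norm (a p) / norm (a q) * exp 1"
      using nz[OF p\<Lambda>] nz[OF q(1)] by (simp add: left_diff_distrib exp_add)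
    then have "r q \<sigma> = r p \<sigma> * exp 1"
      using nz[OF q(1)] by (simp add: r_def exp_diff field_simps)
    moreover have "r q \<sigma> \<le> r p \<sigma>" using U q by (auto simp: A_def)
    moreover have "exp (1::real) > 1" by simp
    ultimately show False using pos[OF p\<Lambda>, of \<sigma>] by simp
  qed
  \<comment> \<open>At a boundary point of \<open>A\<close> the term \<open>p\<close> is maximal, but not strictly.\<close>
  then have "\<not> open A" using \<open>closed A\<close> \<open>0 \<in> A\<close> clopen by blast
  then obtain \<sigma> where \<sigma>: "\<sigma> \<in> A" "\<And>T. open T \<Longrightarrow> \<sigma> \<in> T \<Longrightarrow> \<not> T \<subseteq> A"
    using open_subopen[of A] by blast
  \<comment> \<open>Exponentials are monotone, so \<open>\<rho>\<close> bounds the term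
    \<open>p\<close> from below within distance 1 of \<open>\<sigma>\<close>, and the sum of the two
    end values bounds any other term from above. Hence only the finitely many exponents in
    \<open>J\<close> can compete with \<open>p\<close> there. Were all of them strictly smaller at
    \<open>\<sigma>\<close>, continuity would put a neighbourhood of \<open>\<sigma>\<close> into
    \<open>A\<close>.\<close>
  define \<rho> where "\<rho> = min (r p (\<sigma> - 1)) (r p (\<sigma> + 1))"
  have \<rho>: "\<rho> > 0" using pos[OF p\<Lambda>] by (simp add: \<rho>_def)
  define J where "J = {l \<in> \<Lambda>. r l (\<sigma> - 1) + r l (\<sigma> + 1) \<ge> \<rho>}"
  have "finite J"
  proof -
    have "(\<lambda>l. r l (\<sigma> - 1) + r l (\<sigma> + 1)) summable_on \<Lambda>"
      unfolding r_def by (intro summable_on_add sm)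
    then show ?thesis unfolding J_def using pos \<rho> by (intro finite_large_terms) (auto intro: add_nonneg_nonneg less_imp_le)
  qed
  have mono: "r l x \<le> r l (\<sigma> - 1) + r l (\<sigma> + 1)" "min (r l (\<sigma> - 1)) (r l (\<sigma> + 1)) \<le> r l x"
    if l: "l \<in> \<Lambda>" and x: "\<bar>x - \<sigma>\<bar> < 1" for l x
  proof -
    have "min (r l (\<sigma> - 1)) (r l (\<sigma> + 1)) \<le> r l x \<and> r l x \<le> max (r l (\<sigma> - 1)) (r l (\<sigma> + 1))"
    proof (cases "l \<ge> 0")
      case True
      then have "l * (\<sigma> - 1) \<le> l * x" "l * x \<le> l * (\<sigma> + 1)" using x by (intro mult_left_mono; linarith)+
      then have "r l (\<sigma> - 1) \<le> r l x" "r l x \<le> r l (\<sigma> + 1)" unfolding r_def by (intro mult_left_mono; simp)+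
      then show ?thesis by auto
    next
      case False
      then have "l * x \<le> l * (\<sigma> - 1)" "l * (\<sigma> + 1) \<le> l * x" using x by (intro mult_left_mono_neg; linarith)+
      then have "r l x \<le> r l (\<sigma> - 1)" "r l (\<sigma> + 1) \<le> r l x" unfolding r_def by (intro mult_left_mono; simp)+
      then show ?thesis by auto
    qed
    then show "r l x \<le> r l (\<sigma> - 1) + r l (\<sigma> + 1)" "min (r l (\<sigma> - 1)) (r l (\<sigma> + 1)) \<le> r l x"
      using pos[OF l, of "\<sigma> - 1"] pos[OF l, of "\<sigma> + 1"] by auto
  qed
  define W where "W = (\<Inter>l\<in>J - {p}. {x. r l x < r p x}) \<inter> ball \<sigma> 1"
  have "open W"
    unfolding W_def using \<open>finite J\<close> by (intro open_Int open_INT open_ball ballI open_Collect_less cont) auto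
  have "W \<subseteq> A"
  proof
    fix x assume x: "x \<in> W"
    then have x1: "\<bar>x - \<sigma>\<bar> < 1" by (auto simp: W_def dist_real_def)
    have "r l x \<le> r p x" if l: "l \<in> \<Lambda>" for l
    proof (cases "l \<in> J")
      case True
      then show ?thesis using x by (cases "l = p") (auto simp: W_def intro: less_imp_le)
    next
      case False
      then have "r l (\<sigma> - 1) + r l (\<sigma> + 1) < \<rho>" using l by (simp add: J_def)
      then show ?thesis using mono(1)[OF l x1] mono(2)[OF p\<Lambda> x1] unfolding \<rho>_def[symmetric] by linarith
    qed
    then show "x \<in> A" by (simp add: A_def)
  qed
  then have "\<sigma> \<notin> W" using \<sigma>(2)[OF \<open>open W\<close>] by blast
  then obtain q where q: "q \<in> J - {p}" "\<not> r q \<sigma> < r p \<sigma>" by (auto simp: W_def)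
  then have q\<Lambda>: "q \<in> \<Lambda>" by (simp add: J_def)
  have max: "r l \<sigma> \<le> r p \<sigma>" if "l \<in> \<Lambda>" for l using \<sigma>(1) that by (simp add: A_def)
  have "r p \<sigma> = r q \<sigma>" using q max[OF q\<Lambda>] by simp
  then show thesis using that[of p q \<sigma>] p\<Lambda> q\<Lambda> q max unfolding r_def by blast
qed

text \<open>Each new term is added with the sign opposite to that of the running sum, so the result
  is at most the larger of the two moduli. The value 1 off \<open>J\<close> leaves the tail of a
  longer series unsigned.\<close>

lemma finite_balanced_signs:
  fixes r :: "'a \<Rightarrow> real"
  assumes "finite J" "R \<ge> 0" "\<And>l. l \<in> J \<Longrightarrow> 0 \<le> r l \<and> r l \<le> R"
  shows "\<exists>s. (\<forall>l. s l = 1 \<or> s l = -1) \<and> (\<forall>l. l \<notin> J \<longrightarrow> s l = 1) \<and> \<bar>\<Sum>l\<in>J. s l * r l\<bar> \<le> R"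
  using assms(1,3)
proof (induction J rule: finite_induct)
  case empty
  then show ?case using assms(2) by (intro exI[of _ "\<lambda>_. 1"]) auto
next
  case (insert k J)
  obtain s where s: "\<forall>l. s l = 1 \<or> s l = -1" "\<forall>l. l \<notin> J \<longrightarrow> s l = 1" "\<bar>\<Sum>l\<in>J. s l * r l\<bar> \<le> R"
    using insert by auto
  define x where "x = (\<Sum>l\<in>J. s l * r l)"
  define s' where "s' = s(k := if x \<ge> 0 then -1 else 1)"
  have "(\<Sum>l\<in>J. s' l * r l) = x" unfolding x_def s'_def using insert.hyps by (intro sum.cong) auto
  then have "(\<Sum>l\<in>insert k J. s' l * r l) = (if x \<ge> 0 then - r k else r k) + x"
    using insert.hyps by (simp add: s'_def)
  moreover have "0 \<le> r k" "r k \<le> R" using insert.prems by auto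
  ultimately have "\<bar>\<Sum>l\<in>insert k J. s' l * r l\<bar> \<le> R" using s(3) unfolding x_def[symmetric] by auto
  then show ?case using s(1,2) by (intro exI[of _ s']) (auto simp: s'_def)
qed

text \<open>Greedy signs keep a finite partial sum within \<open>R\<close>; the remaining tail is at most \<open>R\<close>.\<close>
lemma balanced_signs:
  fixes r :: "'a \<Rightarrow> real"
  assumes sm: "r summable_on A" and R: "R > 0" and r: "\<And>l. l \<in> A \<Longrightarrow> 0 \<le> r l \<and> r l \<le> R"
  obtains s where "\<And>l. s l = 1 \<or> s l = -1" "\<bar>\<Sum>\<^sub>\<infinity>l\<in>A. s l * r l\<bar> \<le> 2 * R" "(\<lambda>l. s l * r l) summable_on A"
proof -
  obtain J where J: "finite J" "J \<subseteq> A" "infsum r (A - J) \<le> R" using summable_tail_small[OF sm R] .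
  obtain s where s: "\<And>l. s l = 1 \<or> s l = -1" "\<And>l. l \<notin> J \<Longrightarrow> s l = 1" "\<bar>\<Sum>l\<in>J. s l * r l\<bar> \<le> R"
    using finite_balanced_signs[OF J(1), of R r] R r J(2) by (metis less_imp_le subsetD)
  have sJ: "r summable_on (A - J)" using sm by (rule summable_on_subset_banach) auto
  have eq: "(\<Sum>\<^sub>\<infinity>l\<in>A - J. s l * r l) = infsum r (A - J)" by (rule infsum_cong) (use s(2) in auto)
  have sJ': "(\<lambda>l. s l * r l) summable_on (A - J)" using sJ by (rule summable_on_cong[THEN iffD1, rotated]) (use s(2) in auto)
  have A: "A = (A - J) \<union> J" using J(2) by auto
  have sA: "(\<lambda>l. s l * r l) summable_on A"
    by (subst A) (intro summable_on_Un_disjoint sJ' summable_on_finite J(1); auto)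
  have "(\<Sum>\<^sub>\<infinity>l\<in>A. s l * r l) = (\<Sum>\<^sub>\<infinity>l\<in>A - J. s l * r l) + (\<Sum>\<^sub>\<infinity>l\<in>J. s l * r l)"
    by (subst A) (intro infsum_Un_disjoint sJ' summable_on_finite J(1); auto)
  then have "(\<Sum>\<^sub>\<infinity>l\<in>A. s l * r l) = infsum r (A - J) + (\<Sum>l\<in>J. s l * r l)" using eq J(1) by simp
  moreover have "infsum r (A - J) \<ge> 0" by (intro infsum_nonneg) (use r in auto)
  ultimately have "\<bar>\<Sum>\<^sub>\<infinity>l\<in>A. s l * r l\<bar> \<le> 2 * R" using s(3) J(3) by auto
  then show thesis using that s(1) sA by blast
qed

text \<open>Apart from the tied pair, balanced signs give a real sum of modulus at most
  \<open>2 * R\<close>. This is exactly the range of the pair, since conjugate phases make it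
  contribute \<open>2 * R * cos \<theta>\<close>. The phases of \<open>a\<close> do not enter; only
  its moduli are kept.\<close>

lemma exists_vanishing_phases:
  assumes sm: "\<And>\<sigma>. (\<lambda>l. norm (a l) * exp (l * \<sigma>)) summable_on \<Lambda>"
    and nz: "\<And>l. l \<in> \<Lambda> \<Longrightarrow> a l \<noteq> (0::complex)" and two: "l1 \<in> \<Lambda>" "l2 \<in> \<Lambda>" "l1 \<noteq> l2"
  obtains b \<sigma> where "\<And>l. norm (b l) = norm (a l)" "exp_series \<Lambda> b (of_real \<sigma>) = 0"
proof -
  obtain \<sigma> p q where pq: "p \<in> \<Lambda>" "q \<in> \<Lambda>" "p \<noteq> q" "norm (a p) * exp (p * \<sigma>) = norm (a q) * exp (q * \<sigma>)"
    and max: "\<And>l. l \<in> \<Lambda> \<Longrightarrow> norm (a l) * exp (l * \<sigma>) \<le> norm (a p) * exp (p * \<sigma>)"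
    using exists_dominant_tie[OF sm nz two] by metis
  define R where "R = norm (a p) * exp (p * \<sigma>)"
  define A where "A = \<Lambda> - {p, q}"
  have R: "R > 0" using nz[OF pq(1)] by (simp add: R_def)
  have smA: "(\<lambda>l. norm (a l) * exp (l * \<sigma>)) summable_on A"
    unfolding A_def by (rule summable_on_subset_banach[OF sm]) auto
  obtain s where s: "\<And>l. s l = 1 \<or> s l = -1" "\<bar>\<Sum>\<^sub>\<infinity>l\<in>A. s l * (norm (a l) * exp (l * \<sigma>))\<bar> \<le> 2 * R"
    "(\<lambda>l. s l * (norm (a l) * exp (l * \<sigma>))) summable_on A"
    by (rule balanced_signs[OF smA R]) (use max in \<open>auto simp: A_def R_def\<close>)
  define \<rho> where "\<rho> = (\<Sum>\<^sub>\<infinity>l\<in>A. s l * (norm (a l) * exp (l * \<sigma>)))"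
  \<comment> \<open>The two tied terms get conjugate phases, chosen so that they cancel the signed sum \<open>\<rho>\<close>.\<close>
  define \<theta> where "\<theta> = arccos (- \<rho> / (2 * R))"
  have "\<bar>- \<rho> / (2 * R)\<bar> \<le> 1" using s(2) R by (simp add: \<rho>_def)
  then have cos: "cos \<theta> = - \<rho> / (2 * R)" unfolding \<theta>_def by (rule cos_arccos_abs)
  define b where "b l = of_real (norm (a l)) * (if l = p then cis \<theta> else if l = q then cis (- \<theta>) else of_real (s l))" for l
  have "norm (b l) = norm (a l)" for l
    using s(1)[of l] by (auto simp: b_def norm_mult)
  moreover have "exp_series \<Lambda> b (of_real \<sigma>) = 0"
  proof -
    let ?g = "\<lambda>l. b l * exp (of_real l * of_real \<sigma>)"
    have g: "?g l = of_real (s l * (norm (a l) * exp (l * \<sigma>)))" if "l \<in> A" for l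
      using that by (auto simp: A_def b_def exp_of_real[symmetric])
    have "((\<lambda>l. complex_of_real (s l * (norm (a l) * exp (l * \<sigma>)))) has_sum of_real \<rho>) A"
      unfolding \<rho>_def by (intro has_sum_of_real has_sum_infsum s(3))
    then have "(?g has_sum of_real \<rho>) A"
      using g by (subst has_sum_cong[of A ?g]) auto
    moreover have "(?g has_sum (\<Sum>l\<in>{p, q}. ?g l)) {p, q}" by (rule has_sum_finite) auto
    ultimately have "(?g has_sum (of_real \<rho> + (\<Sum>l\<in>{p, q}. ?g l))) (A \<union> {p, q})"
      by (rule has_sum_Un_disjoint) (auto simp: A_def)
    moreover have "A \<union> {p, q} = \<Lambda>" using pq by (auto simp: A_def)
    moreover have "(\<Sum>l\<in>{p, q}. ?g l) = - of_real \<rho>"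
    proof -
      have "?g p = of_real R * cis \<theta>" by (simp add: b_def R_def exp_of_real[symmetric])
      moreover have "?g q = of_real R * cis (- \<theta>)"
      proof -
        have "?g q = of_real (norm (a q) * exp (q * \<sigma>)) * cis (- \<theta>)"
          using pq(3) by (simp add: b_def exp_of_real[symmetric])
        then show ?thesis unfolding pq(4)[symmetric] R_def .
      qed
      moreover have "cis \<theta> + cis (- \<theta>) = of_real (2 * cos \<theta>)" by (simp add: complex_eq_iff)
      ultimately have "(\<Sum>l\<in>{p, q}. ?g l) = of_real R * of_real (2 * cos \<theta>)"
        using pq(3) by (simp add: distrib_left[symmetric] del: of_real_mult)
      also have "\<dots> = of_real (R * (2 * cos \<theta>))" by simp
      also have "R * (2 * cos \<theta>) = - \<rho>" using R by (simp add: cos)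
      finally show ?thesis by simp
    qed
    ultimately have "(?g has_sum 0) \<Lambda>" by simp
    then show ?thesis unfolding exp_series_def by (rule infsumI)
  qed
  ultimately show thesis using that by blast
qed

section \<open>Kronecker's theorem and the approximation of phase changes by vertical
  translates\<close>

interpretation int_real: module "\<lambda>r. (*) (real_of_int r)"
  by (simp add: module.intro distrib_left mult.commute)

text \<open>Kronecker's theorem is stated with independence over the integers; a nontrivial integer
  relation is also a rational one.\<close>

lemma rat_independent_imp_int_independent:
  assumes "rat_independent S"
  shows "module.independent (\<lambda>r. (*) (real_of_int r)) S"
proof
  assume "int_real.dependent S"
  then obtain t u where t: "finite t" "t \<subseteq> S" "(\<Sum>v\<in>t. real_of_int (u v) * v) = 0" "\<exists>v\<in>t. u v \<noteq> 0"
    unfolding int_real.dependent_explicit by blast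
  have "(\<Sum>v\<in>t. real_of_rat (of_int (u v)) * v) = 0" using t(3) by simp
  moreover have "\<exists>v\<in>t. rat_of_int (u v) \<noteq> 0" using t(4) by simp
  ultimately have "rat_real.dependent S"
    unfolding rat_real.dependent_explicit using t(1,2) by (intro exI[of _ t] exI[of _ "\<lambda>v. of_int (u v)"]) blast
  then show False using assms by blast
qed

text \<open>Kronecker's theorem applied to the arguments of the \<open>z l\<close> measured in full
  turns. The integers \<open>h i\<close> disappear under \<open>cis\<close>, and the chord is at
  most as long as the arc, so the tolerance \<open>\<epsilon>\<close> in length is
  \<open>\<epsilon> / (2 * pi)\<close> in turns.\<close>

lemma kronecker_cis:
  assumes ind: "rat_independent \<Lambda>" and J: "finite J" "J \<subseteq> \<Lambda>"
    and z: "\<And>l. l \<in> J \<Longrightarrow> norm (z l) = 1" and e: "\<epsilon> > 0"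
  obtains t where "\<And>l. l \<in> J \<Longrightarrow> norm (cis (l * t) - z l) \<le> \<epsilon>"
proof -
  obtain \<theta> where \<theta>: "bij_betw \<theta> {..<card J} J"
    using ex_bij_betw_nat_finite[OF J(1)] by (auto simp: atLeast0LessThan)
  have im: "\<theta> ` {..<card J} = J" and inj: "inj_on \<theta> {..<card J}" using \<theta> by (auto simp: bij_betw_def)
  have "rat_independent J" using ind J(2) rat_real.independent_mono by blast
  then have ii: "int_real.independent (\<theta> ` {..<card J})"
    unfolding im by (rule rat_independent_imp_int_independent)
  obtain t h where th: "\<And>i. i < card J \<Longrightarrow> \<bar>t * \<theta> i - of_int (h i) - Arg (z (\<theta> i)) / (2 * pi)\<bar> < \<epsilon> / (2 * pi)"
    using Kronecker_thm_1[OF ii inj, of "\<epsilon> / (2 * pi)" "\<lambda>i. Arg (z (\<theta> i)) / (2 * pi)"] e by auto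
  show thesis
  proof (rule that[of "2 * pi * t"])
    fix l assume l: "l \<in> J"
    then obtain i where i: "i < card J" "l = \<theta> i" using im by blast
    define x where "x = t * l - of_int (h i) - Arg (z l) / (2 * pi)"
    have "\<bar>x\<bar> < \<epsilon> / (2 * pi)" using th[OF i(1)] by (simp add: x_def i(2))
    then have x: "\<bar>2 * pi * x\<bar> \<le> \<epsilon>" by (simp add: abs_mult field_simps)
    have "l * (2 * pi * t) = Arg (z l) + (2 * pi * of_int (h i) + 2 * pi * x)"
      by (simp add: x_def algebra_simps)
    then have "cis (l * (2 * pi * t)) = cis (Arg (z l)) * (cis (2 * pi * of_int (h i)) * cis (2 * pi * x))"
      by (simp only: cis_mult)
    also have "cis (2 * pi * of_int (h i)) = 1" by (rule cis_multiple_2pi) simp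
    also have "cis (Arg (z l)) = z l" using z[OF l] cis_Arg[of "z l"] by (force simp: sgn_eq)
    finally have "cis (l * (2 * pi * t)) - z l = z l * (cis (2 * pi * x) - 1)" by (simp add: algebra_simps)
    then have "norm (cis (l * (2 * pi * t)) - z l) = norm (cis (2 * pi * x) - 1)" using z[OF l] by (simp add: norm_mult)
    also have "\<dots> \<le> \<bar>2 * pi * x\<bar>" by (rule norm_cis_minus_one_le)
    finally show "norm (cis (l * (2 * pi * t)) - z l) \<le> \<epsilon>" using x by simp
  qed
qed

text \<open>Translation by \<open>t\<close> multiplies the coefficient at \<open>l\<close> by
  \<open>cis (l * t)\<close>. On a finite set this is brought close to the unimodular quotient
  \<open>b l / a l\<close>; outside it both series have a small tail, uniformly in the
  strip.\<close>

lemma translates_approximate_phase_change: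
  assumes ind: "rat_independent \<Lambda>"
    and sm: "\<And>\<sigma>. (\<lambda>l. norm (a l) * exp (l * \<sigma>)) summable_on \<Lambda>"
    and nz: "\<And>l. l \<in> \<Lambda> \<Longrightarrow> a l \<noteq> (0::complex)" and b: "\<And>l. norm (b l) = norm (a l)"
    and \<eta>: "\<eta> > 0"
  obtains t where "\<And>s. \<bar>Re s\<bar> \<le> R \<Longrightarrow> norm (exp_series \<Lambda> a (s + \<i> * of_real t) - exp_series \<Lambda> b s) \<le> \<eta>"
proof -
  \<comment> \<open>A summable majorant valid in the whole strip: one of the two exponentials
    dominates, according to the sign of \<open>l\<close>.\<close>
  define w where "w l = norm (a l) * exp (l * R) + norm (a l) * exp (l * (- R))" for l
  have w0: "w l \<ge> 0" for l by (simp add: w_def)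
  have smw: "w summable_on \<Lambda>" unfolding w_def by (intro summable_on_add sm)
  have w: "norm (a l) * exp (l * \<sigma>) \<le> w l" if "\<bar>\<sigma>\<bar> \<le> R" for l \<sigma>
  proof -
    have "l * \<sigma> \<le> \<bar>l\<bar> * \<bar>\<sigma>\<bar>" by (metis abs_ge_self abs_mult)
    also have "\<dots> \<le> \<bar>l\<bar> * R" using that by (intro mult_left_mono) auto
    finally have "exp (l * \<sigma>) \<le> exp (\<bar>l\<bar> * R)" by simp
    also have "\<dots> \<le> exp (l * R) + exp (l * (- R))" by (cases "l \<ge> 0") auto
    finally have "norm (a l) * exp (l * \<sigma>) \<le> norm (a l) * (exp (l * R) + exp (l * (- R)))"
      by (intro mult_left_mono) auto
    then show ?thesis by (simp add: w_def distrib_left)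
  qed
  obtain J where J: "finite J" "J \<subseteq> \<Lambda>" "infsum w (\<Lambda> - J) \<le> \<eta>/4"
    using summable_tail_small[OF smw, of "\<eta>/4"] \<eta> by auto
  define C where "C = sum w J"
  have C: "C \<ge> 0" unfolding C_def by (intro sum_nonneg w0)
  \<comment> \<open>The finite part costs \<open>\<delta> * C\<close>, at most
    \<open>\<eta>/2\<close>, and the 1 prevents division by 0. The tail costs twice
    \<open>\<eta>/4\<close>, because \<open>a\<close> and \<open>b\<close> both contribute to
    it.\<close>
  define \<delta> where "\<delta> = \<eta> / (2 * (C + 1))"
  have \<delta>: "\<delta> > 0" using \<eta> C by (simp add: \<delta>_def)
  have z: "norm (b l / a l) = 1" if "l \<in> J" for l
    using nz[of l] b[of l] that J(2) by (auto simp: norm_divide)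
  obtain t where t: "\<And>l. l \<in> J \<Longrightarrow> norm (cis (l * t) - b l / a l) \<le> \<delta>"
    using kronecker_cis[of \<Lambda> J "\<lambda>l. b l / a l", OF ind J(1,2) z \<delta>] by blast
  show thesis
  proof (rule that[of t])
    fix s :: complex assume s: "\<bar>Re s\<bar> \<le> R"
    define g where "g l = (a l * cis (l * t) - b l) * exp (of_real l * s)" for l
    have sa: "(\<lambda>l. a l * exp (of_real l * (s + \<i> * of_real t))) summable_on \<Lambda>"
      by (rule abs_summable_summable[OF exp_series_summable[OF sm]])
    have smb: "(\<lambda>l. norm (b l) * exp (l * \<sigma>)) summable_on \<Lambda>" for \<sigma> unfolding b by (rule sm)
    have sb: "(\<lambda>l. b l * exp (of_real l * s)) summable_on \<Lambda>"
      by (rule abs_summable_summable[OF exp_series_summable[OF smb]])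
    have geq: "g = (\<lambda>l. a l * exp (of_real l * (s + \<i> * of_real t)) + - (b l * exp (of_real l * s)))"
      by (rule ext) (simp add: g_def distrib_left exp_add cis_conv_exp algebra_simps)
    have sb': "(\<lambda>l. - (b l * exp (of_real l * s))) summable_on \<Lambda>" using sb by (simp only: summable_on_uminus)
    have sg: "g summable_on \<Lambda>" unfolding geq by (rule summable_on_add[OF sa sb'])
    have "exp_series \<Lambda> a (s + \<i> * of_real t) - exp_series \<Lambda> b s = infsum g \<Lambda>"
      unfolding geq infsum_add[OF sa sb'] by (simp add: exp_series_def infsum_uminus)
    also have "\<dots> = infsum g (\<Lambda> - J) + sum g J"
      using infsum_Diff[OF sg summable_on_finite[OF J(1)] J(2)] J(1) by simp
    also have "norm \<dots> \<le> 2 * infsum w (\<Lambda> - J) + \<delta> * C"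
    proof (intro norm_triangle_le add_mono)
      have wJ: "w summable_on (\<Lambda> - J)" by (rule summable_on_subset_banach[OF smw]) auto
      have gJ: "g summable_on (\<Lambda> - J)" by (rule summable_on_subset_banach[OF sg]) auto
      show "norm (infsum g (\<Lambda> - J)) \<le> 2 * infsum w (\<Lambda> - J)"
      proof (rule norm_infsum_le[OF has_sum_infsum[OF gJ] has_sum_cmult_right[OF has_sum_infsum[OF wJ]]])
        fix l
        have "norm (a l * cis (l * t) - b l) \<le> 2 * norm (a l)"
          using norm_triangle_ineq4[of "a l * cis (l * t)" "b l"] b[of l] by (simp add: norm_mult)
        then have "norm (g l) \<le> 2 * norm (a l) * exp (l * Re s)"
          unfolding g_def norm_exp_real_mult by (intro mult_right_mono) auto
        then show "norm (g l) \<le> 2 * w l" using w[OF s, of l] by simp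
      qed
      have "norm (sum g J) \<le> (\<Sum>l\<in>J. \<delta> * w l)"
      proof (rule sum_norm_le)
        fix l assume l: "l \<in> J"
        then have "a l * cis (l * t) - b l = a l * (cis (l * t) - b l / a l)"
          using nz[of l] J(2) by (auto simp: algebra_simps)
        then have "norm (a l * cis (l * t) - b l) \<le> norm (a l) * \<delta>"
          using t[OF l] by (simp add: norm_mult mult_left_mono del: right_diff_distrib')
        then have "norm (g l) \<le> norm (a l) * \<delta> * exp (l * Re s)"
          unfolding g_def norm_exp_real_mult by (intro mult_right_mono) auto
        also have "\<dots> \<le> \<delta> * w l" using mult_left_mono[OF w[OF s, of l], of \<delta>] \<delta> by (simp add: mult_ac)
        finally show "norm (g l) \<le> \<delta> * w l" .
      qed
      then show "norm (sum g J) \<le> \<delta> * C" by (simp add: C_def sum_distrib_left)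
    qed
    also have "\<dots> \<le> \<eta>/2 + \<eta>/2"
    proof (intro add_mono)
      show "2 * infsum w (\<Lambda> - J) \<le> \<eta>/2" using J(3) by simp
      have "\<delta> * C \<le> \<delta> * (C + 1)" using \<delta> by simp
      also have "\<dots> = \<eta>/2" using C by (simp add: \<delta>_def add_nonneg_eq_0_iff del: distrib_left_numeral)
      finally show "\<delta> * C \<le> \<eta>/2" .
    qed
    finally show "norm (exp_series \<Lambda> a (s + \<i> * of_real t) - exp_series \<Lambda> b s) \<le> \<eta>" by simp
  qed
qed

section \<open>Passage from the changed series back to the function by Hurwitz's theorem\<close>

lemma almost_periodic_has_zero:
  assumes ap: "almost_periodic f" and ind: "rat_independent (fourier_exponents f)"
    and two: "l1 \<in> fourier_exponents f" "l2 \<in> fourier_exponents f" "l1 \<noteq> l2"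
  shows "\<exists>s. f s = 0"
proof (rule ccontr)
  assume "\<not> (\<exists>s. f s = 0)"
  then have nozero: "f s \<noteq> 0" for s by blast
  define \<Lambda> where "\<Lambda> = fourier_exponents f"
  obtain a where nz: "\<And>l. l \<in> \<Lambda> \<Longrightarrow> a l \<noteq> 0"
    and sm: "\<And>\<sigma>. (\<lambda>l. norm (a l) * exp (l * \<sigma>)) summable_on \<Lambda>"
    and f: "\<And>s. f s = exp_series \<Lambda> a s"
    using almost_periodic_exp_series[OF ap ind] unfolding \<Lambda>_def by metis
  obtain b \<sigma> where b: "\<And>l. norm (b l) = norm (a l)" and zero: "exp_series \<Lambda> b (of_real \<sigma>) = 0"
    using exists_vanishing_phases[OF sm nz two[folded \<Lambda>_def]] by metis
  have smb: "(\<lambda>l. norm (b l) * exp (l * \<sigma>)) summable_on \<Lambda>" for \<sigma> unfolding b by (rule sm)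
  have "\<exists>t. \<forall>s. \<bar>Re s\<bar> \<le> real n \<longrightarrow> norm (f (s + \<i> * of_real t) - exp_series \<Lambda> b s) \<le> 1 / real (Suc n)" for n
  proof -
    have "1 / real (Suc n) > 0" by simp
    from translates_approximate_phase_change[OF ind[folded \<Lambda>_def] sm nz b this, of "real n"]
    show ?thesis unfolding f by metis
  qed
  then obtain t where t: "\<And>n s. \<bar>Re s\<bar> \<le> real n \<Longrightarrow> norm (f (s + \<i> * of_real (t n)) - exp_series \<Lambda> b s) \<le> 1 / real (Suc n)"
    by metis
  define F where "F n s = f (s + \<i> * of_real (t n))" for n s
  have "f holomorphic_on UNIV" using ap by (simp add: almost_periodic_def)
  then have holF: "F n holomorphic_on UNIV" for n
    unfolding F_def by (intro holomorphic_on_compose_gen[unfolded o_def, of "\<lambda>s. s + \<i> * of_real (t n)" UNIV f UNIV] holomorphic_intros) auto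
  have ul: "uniform_limit K F (exp_series \<Lambda> b) sequentially" if K: "compact K" for K
  proof (rule uniform_limitI)
    fix e :: real assume "e > 0"
    then obtain N1 where N1: "1 / real (Suc N1) < e" using nat_approx_posE by blast
    obtain B where B: "\<And>s. s \<in> K \<Longrightarrow> norm s \<le> B"
      using compact_imp_bounded[OF K] unfolding bounded_iff by blast
    obtain N2 where N2: "B \<le> real N2" using real_arch_simple by blast
    show "\<forall>\<^sub>F n in sequentially. \<forall>s\<in>K. dist (F n s) (exp_series \<Lambda> b s) < e"
      using eventually_ge_at_top[of "max N1 N2"]
    proof eventually_elim
      case (elim n)
      show ?case
      proof
        fix s assume "s \<in> K"
        then have "\<bar>Re s\<bar> \<le> real n" using B[of s] N2 elim abs_Re_le_cmod[of s] by linarith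
        then have "dist (F n s) (exp_series \<Lambda> b s) \<le> 1 / real (Suc n)"
          using t unfolding F_def dist_norm by blast
        also have "\<dots> \<le> 1 / real (Suc N1)" using elim by (simp add: frac_le)
        finally show "dist (F n s) (exp_series \<Lambda> b s) < e" using N1 by simp
      qed
    qed
  qed
  \<comment> \<open>Holomorphy is inherited from the entire translates through locally uniform
    convergence, without termwise differentiation.\<close>
  have hol: "exp_series \<Lambda> b holomorphic_on UNIV"
  proof (rule holomorphic_uniform_sequence[OF open_UNIV holF])
    fix x :: complex
    show "\<exists>d>0. cball x d \<subseteq> UNIV \<and> uniform_limit (cball x d) F (exp_series \<Lambda> b) sequentially"
      using ul[OF compact_cball] by (intro exI[of _ 1]) auto
  qed
  \<comment> \<open>A constant value would be 0 because of the zero at \<open>\<sigma>\<close>. Then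
    every Fourier mean on the line with abscissa 0 would vanish, although the one at
    \<open>l1\<close> is \<open>b l1\<close>, whose modulus is that of the nonzero
    \<open>a l1\<close>.\<close>
  have nonconst: "\<not> exp_series \<Lambda> b constant_on UNIV"
  proof
    assume "exp_series \<Lambda> b constant_on UNIV"
    then have "exp_series \<Lambda> b s = 0" for s using zero unfolding constant_on_def by auto
    then have "uniform_mean (\<lambda>_. 0) (b l1 * of_real (exp (l1 * 0)))"
      using exp_series_uniform_mean[OF smb, of 0 l1] two(1) unfolding \<Lambda>_def by simp
    then have "b l1 * of_real (exp (l1 * 0)) = 0" using uniform_mean_unique uniform_mean_zero by blast
    then show False using b[of l1] nz[of l1] two(1) unfolding \<Lambda>_def by simp
  qed
  have "exp_series \<Lambda> b (of_real \<sigma>) \<noteq> 0"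
  proof (rule Hurwitz_no_zeros[OF open_UNIV connected_UNIV holF hol _ nonconst])
    show "uniform_limit K F (exp_series \<Lambda> b) sequentially" if "compact K" for K using ul[OF that] .
    show "F n z \<noteq> 0" for n z unfolding F_def by (rule nozero)
  qed auto
  then show False using zero by blast
qed

theorem corollary8:
  fixes f :: "complex \<Rightarrow> complex"
  assumes "almost_periodic f"
    and "rat_independent (fourier_exponents f)"
    and "infinite (fourier_exponents f) \<or> card (fourier_exponents f) \<ge> 3"
  shows "zero_abscissae f \<noteq> {}"
proof -
  have nonsingleton: "\<not> fourier_exponents f \<subseteq> {l}" for l
  proof
    assume l: "fourier_exponents f \<subseteq> {l}"
    then have "finite (fourier_exponents f)" "card (fourier_exponents f) \<le> card {l}"
      using finite_subset[OF l] card_mono[OF _ l] by simp_all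
    then show False using assms(3) by simp
  qed
  obtain l1 where l1: "l1 \<in> fourier_exponents f" using nonsingleton[of 0] by blast
  obtain l2 where l2: "l2 \<in> fourier_exponents f" "l1 \<noteq> l2" using nonsingleton[of l1] by blast
  obtain s where "f s = 0" using almost_periodic_has_zero[OF assms(1,2) l1 l2] by blast
  then have "{Re s |s. f s = 0} \<noteq> {}" by blast
  then show ?thesis unfolding zero_abscissae_def by (simp add: closure_eq_empty)
qed

end
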